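(* Let $\nu>0$ and let $F\in H$ be a time-independent external force with coordinates $F_k$, $F=\sum_kF_kW_k$. For every integer $N\ge1$ and every $t>0$, the $\mathcal K^N$-Galerkin approximation with $\mathcal K^1$ as set of controlled modes, i.e. the control system on $\mathbb R^{\kappa_N}$ $$\dot u_k=\mathcal B_k(u)+\nu\bar k\,u_k+F_k+v_k\ (k\in\mathcal K^1),\qquad \dot u_k=\mathcal B_k(u)+\nu\bar k\,u_k+F_k\ (k\in\mathcal K^N\setminus\mathcal K^1),$$ is controllable at time $t$: for any two points $y,z\in\mathbb R^{\kappa_N}$ there is a control $v\in L^\infty([0,t],\mathbb R^{\kappa_1})$ such that the solution with $u(0)=y$ satisfies $u(t)=z$.
   Context: Let $a,b>0$, $R=]0,a[\times]0,b[$, $\mathbb N_0=\{1,2,3,\dots\}$, and $H=\{u\in L^2(R)^2:\nabla\cdot u=0,\ u\cdot\mathbf n=0\text{ on }\partial R\}$ with the $L^2$ scalar product $(\cdot,\cdot)$ and norm $|\cdot|$. For $k=(k_1,k_2)\in\mathbb N_0^2$ let $\bar k=-\pi^2\left(\frac{k_1^2}{a^2}+\frac{k_2^2}{b^2}\right)$ and $$W_k=\begin{pmatrix}-\frac{k_2\pi}{b}\sin\left(\frac{k_1\pi x_1}{a}\right)\cos\left(\frac{k_2\pi x_2}{b}\right)\\ \frac{k_1\pi}{a}\cos\left(\frac{k_1\pi x_1}{a}\right)\sin\left(\frac{k_2\pi x_2}{b}\right)\end{pmatrix};$$ $\{W_k\}_{k\in\mathbb N_0^2}$ is an orthogonal basis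 of $H$, $\Delta W_k=\bar kW_k$. For $j\ge1$, $\mathcal K^j=\{(n_1,n_2)\in\mathbb N_0^2: n_1,n_2\le j+2\}\setminus\{(j+2,j+2)\}$ and $\kappa_j=\#\mathcal K^j$; $\mathbb R^{\kappa_j}$ is the space of coordinate vectors $(u_k)_{k\in\mathcal K^j}$. For $u=(u_k)_{k\in\mathcal K^N}$, $\mathcal B_k(u)$ is the $W_k$-coordinate of $-P^\nabla[(U\cdot\nabla)U]$, where $U=\sum_{m\in\mathcal K^N}u_mW_m$ and $P^\nabla$ is the orthogonal projection of $L^2(R)^2$ onto $H$, i.e. $\mathcal B_k(u)=-\frac{((U\cdot\nabla)U,\,W_k)}{|W_k|^2}$. *)

theory Defs
  imports "HOL-Analysis.Analysis"
begin

text \<open>The plane is \<^typ>\<open>real \<times> real\<close>, with its Euclidean inner product.  Elements of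
  \<open>L\<^sup>2(R)\<^sup>2\<close> are represented by functions on the plane, of which only the values on the
  rectangle (up to null sets) matter.\<close>

definition rect :: "real \<Rightarrow> real \<Rightarrow> (real \<times> real) set" where
  "rect a b = {0<..<a} \<times> {0<..<b}"

definition L2_inner ::
    "real \<Rightarrow> real \<Rightarrow> (real \<times> real \<Rightarrow> real \<times> real) \<Rightarrow> (real \<times> real \<Rightarrow> real \<times> real) \<Rightarrow> real" where
  "L2_inner a b u w = (\<integral>x. u x \<bullet> w x \<partial>lebesgue_on (rect a b))"

definition L2_fields :: "real \<Rightarrow> real \<Rightarrow> (real \<times> real \<Rightarrow> real \<times> real) set" where
  "L2_fields a b = {u. u \<in> borel_measurable (lebesgue_on (rect a b)) \<and>
     integrable (lebesgue_on (rect a b)) (\<lambda>x. (norm (u x))\<^sup>2)}"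

definition C1_with_gradient :: "(real \<times> real \<Rightarrow> real) \<Rightarrow> (real \<times> real \<Rightarrow> real \<times> real) \<Rightarrow> bool" where
  "C1_with_gradient \<phi> g \<longleftrightarrow> (\<forall>x. GDERIV \<phi> x :> g x) \<and> continuous_on UNIV g"

text \<open>For \<open>L\<^sup>2\<close> fields the divergence is understood in the sense of distributions, and the
  normal trace of a divergence-free field by duality, through Green's formula
  \<open>\<integral>\<^bsub>\<partial>R\<^esub> (u \<cdot> n) \<phi> = \<integral>\<^bsub>R\<^esub> u \<cdot> \<nabla>\<phi>\<close> for test functions \<open>\<phi>\<close> that need not vanish
  near the boundary.\<close>

definition divergence_free :: "real \<Rightarrow> real \<Rightarrow> (real \<times> real \<Rightarrow> real \<times> real) \<Rightarrow> bool" where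
  "divergence_free a b u \<longleftrightarrow>
     (\<forall>\<phi> g. C1_with_gradient \<phi> g \<and> (\<exists>C. compact C \<and> C \<subseteq> rect a b \<and> (\<forall>x. x \<notin> C \<longrightarrow> \<phi> x = 0))
        \<longrightarrow> L2_inner a b u g = 0)"

definition zero_normal_trace :: "real \<Rightarrow> real \<Rightarrow> (real \<times> real \<Rightarrow> real \<times> real) \<Rightarrow> bool" where
  "zero_normal_trace a b u \<longleftrightarrow> (\<forall>\<phi> g. C1_with_gradient \<phi> g \<longrightarrow> L2_inner a b u g = 0)"

definition H_space :: "real \<Rightarrow> real \<Rightarrow> (real \<times> real \<Rightarrow> real \<times> real) set" where
  "H_space a b = {u \<in> L2_fields a b. divergence_free a b u \<and> zero_normal_trace a b u}"

definition kbar :: "real \<Rightarrow> real \<Rightarrow> nat \<times> nat \<Rightarrow> real" where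
  "kbar a b k = - pi\<^sup>2 * ((real (fst k))\<^sup>2 / a\<^sup>2 + (real (snd k))\<^sup>2 / b\<^sup>2)"

definition W :: "real \<Rightarrow> real \<Rightarrow> nat \<times> nat \<Rightarrow> real \<times> real \<Rightarrow> real \<times> real" where
  "W a b k x =
     (- (real (snd k) * pi / b) * sin (real (fst k) * pi * fst x / a) * cos (real (snd k) * pi * snd x / b),
      (real (fst k) * pi / a) * cos (real (fst k) * pi * fst x / a) * sin (real (snd k) * pi * snd x / b))"

text \<open>Coordinate of (the projection to \<open>H\<close> of) a field with respect to the orthogonal
  basis \<open>W\<^sub>k\<close>; since \<open>W\<^sub>k \<in> H\<close>, the orthogonal projection can be omitted.\<close>

definition W_coord :: "real \<Rightarrow> real \<Rightarrow> (real \<times> real \<Rightarrow> real \<times> real) \<Rightarrow> nat \<times> nat \<Rightarrow> real" where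
  "W_coord a b u k = L2_inner a b u (W a b k) / L2_inner a b (W a b k) (W a b k)"

definition modes :: "nat \<Rightarrow> (nat \<times> nat) set" where
  "modes j = ({1..j+2} \<times> {1..j+2}) - {(j+2, j+2)}"

text \<open>Vectors of \<open>\<real>\<^sup>\<kappa>\<close>, where \<open>\<kappa> = card (modes N)\<close>, are functions on \<^typ>\<open>nat \<times> nat\<close>
  of which only the values on \<open>modes N\<close> are used.\<close>

definition velocity :: "real \<Rightarrow> real \<Rightarrow> nat \<Rightarrow> (nat \<times> nat \<Rightarrow> real) \<Rightarrow> real \<times> real \<Rightarrow> real \<times> real" where
  "velocity a b N u x = (\<Sum>m\<in>modes N. u m *\<^sub>R W a b m x)"

text \<open>\<open>(U \<cdot> \<nabla>)U\<close> at \<open>x\<close> is the derivative of \<open>U\<close> at \<open>x\<close> in the direction \<open>U x\<close>.\<close>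

definition convection :: "(real \<times> real \<Rightarrow> real \<times> real) \<Rightarrow> real \<times> real \<Rightarrow> real \<times> real" where
  "convection U x = frechet_derivative U (at x) (U x)"

definition \<B> :: "real \<Rightarrow> real \<Rightarrow> nat \<Rightarrow> (nat \<times> nat \<Rightarrow> real) \<Rightarrow> nat \<times> nat \<Rightarrow> real" where
  "\<B> a b N u k = - W_coord a b (convection (velocity a b N u)) k"

definition Linfty_control :: "(nat \<times> nat) set \<Rightarrow> real \<Rightarrow> (real \<Rightarrow> nat \<times> nat \<Rightarrow> real) \<Rightarrow> bool" where
  "Linfty_control K t v \<longleftrightarrow>
     (\<forall>k\<in>K. (\<lambda>s. v s k) \<in> borel_measurable (lebesgue_on {0..t}) \<and>
        (\<exists>M. AE s in lebesgue_on {0..t}. \<bar>v s k\<bar> \<le> M))"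

text \<open>As controls are only essentially bounded, solutions are Caratheodory solutions: the
  differential equations are required in integrated form.  This makes \<open>u\<close> continuous on
  \<open>[0,t]\<close> in all its coordinates.\<close>

definition galerkin_solution ::
    "real \<Rightarrow> real \<Rightarrow> real \<Rightarrow> (real \<times> real \<Rightarrow> real \<times> real) \<Rightarrow> nat \<Rightarrow> (nat \<times> nat) set \<Rightarrow> real \<Rightarrow>
     (real \<Rightarrow> nat \<times> nat \<Rightarrow> real) \<Rightarrow> (nat \<times> nat \<Rightarrow> real) \<Rightarrow> (real \<Rightarrow> nat \<times> nat \<Rightarrow> real) \<Rightarrow> bool" where
  "galerkin_solution a b \<nu> F N K t v y u \<longleftrightarrow>
     (\<forall>k\<in>modes N. u 0 k = y k \<and>
        (\<forall>s\<in>{0..t}.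
           ((\<lambda>r. \<B> a b N (u r) k + \<nu> * kbar a b k * u r k + W_coord a b F k
                 + (if k \<in> K then v r k else 0)) has_integral (u s k - u 0 k)) {0..s}))"

text \<open>The solution from \<open>y\<close> exists on \<open>[0,t]\<close>, and it (hence every solution) ends at \<open>z\<close>.\<close>

definition galerkin_controllable ::
    "real \<Rightarrow> real \<Rightarrow> real \<Rightarrow> (real \<times> real \<Rightarrow> real \<times> real) \<Rightarrow> nat \<Rightarrow> (nat \<times> nat) set \<Rightarrow> real \<Rightarrow> bool" where
  "galerkin_controllable a b \<nu> F N K t \<longleftrightarrow>
     (\<forall>y z. \<exists>v. Linfty_control K t v \<and>
        (\<exists>u. galerkin_solution a b \<nu> F N K t v y u) \<and>
        (\<forall>u. galerkin_solution a b \<nu> F N K t v y u \<longrightarrow> (\<forall>k\<in>modes N. u t k = z k)))"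

end

theory Submission
  imports Defs "HOL-Probability.Discrete_Topology"
begin

text \<open>
  In vorticity form the nonlinearity is \<open>-{\<psi>, \<Delta>\<psi>}\<close>, so single modes \<open>W\<^sub>k\<close> are stationary for it and two
  modes \<open>m\<close>, \<open>n\<close> interact with strength \<open>kbar m - kbar n\<close> times the expansion of a Jacobian of
  products of sines.  If the directions \<open>e\<close> and \<open>h\<close> with \<open>B(e,e) = B(h,h) = 0\<close> can be followed by
  almost instantaneous translations, then so can \<open>B(e,h) + B(h,e)\<close>: jump by a large combination of
  \<open>e\<close> and \<open>h\<close>, let the drift act for a very short time, and jump back.  Starting from the controlled
  modes this reaches every mode.  The resulting approximate translations in all directions are
  Lipschitz-close to the exact ones, so a contraction turns them into exact steering in small time;
  arbitrary times follow by passing repeatedly through the origin, and no global existence of the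
  uncontrolled flow is needed.
\<close>

section \<open>Approximate translations by short flows\<close>

text \<open>The intermediate points of a bracket lie at distance of order 1 / \<sigma>, so error
  bounds on a ball containing them would depend on \<sigma>, while \<sigma> has to be chosen from
  those bounds. The drift phase is therefore studied in coordinates moved along with the jump, where
  all radii are fixed before \<sigma>; only the accuracy of the jump back is chosen afterwards. The
  directions that admit such translations form a linear subspace. Saturation thereby becomes linear
  algebra: the known terms of an interaction are removed, and the rest must determine the new
  vectors. An interaction is usable only if the two values of \<open>kbar\<close> differ. For modes
  ordered componentwise this holds for all side lengths; unordered pairs are used only for the
  corner (3,3). The dimension of the phase space depends on the variable \<open>N\<close>. The
  abstract part thus works in one Banach space containing every coordinate vector, and the
  truncation enters as a projection \<pi>.\<close>

lemma picard:
  fixes g :: "'a::banach \<Rightarrow> 'a"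
  assumes \<tau>: "0 \<le> \<tau>" and D: "0 \<le> D"
    and bound: "\<And>x. x \<in> cball u D \<Longrightarrow> norm (g x) \<le> B"
    and lip: "\<And>x y. x \<in> cball u D \<Longrightarrow> y \<in> cball u D \<Longrightarrow> norm (g x - g y) \<le> l * norm (x - y)"
    and small: "\<tau> * B \<le> D" "\<tau> * l \<le> 1/2" and l: "0 \<le> l"
  shows "\<exists>x. continuous_on {0..\<tau>} x \<and> (\<forall>r\<in>{0..\<tau>}. x r \<in> cball u D \<and>
           ((\<lambda>q. g (x q)) has_integral (x r - u)) {0..r})"
proof -
  define S where "S = {x :: real \<Rightarrow>\<^sub>C 'a. \<forall>r. apply_bcontfun x r \<in> cball u D}"
  \<comment> \<open>Clamping time to [0,\<tau>] makes the Picard operator act on bounded continuous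
    functions on the whole line, a complete space. The bound on \<open>g\<close> keeps trajectories
    in the ball; the Lipschitz bound, assumed on that ball alone because the fields below are
    quadratic, gives the contraction.\<close>
  define cl where "cl = (\<lambda>r::real. max 0 (min \<tau> r))"
  define I where "I = (\<lambda>(x :: real \<Rightarrow>\<^sub>C 'a) r. u + integral {0..cl r} (\<lambda>q. g (x q)))"
  have cl: "cl r \<in> {0..\<tau>}" "continuous_on UNIV cl" for r
    unfolding cl_def using \<tau> by (simp, intro continuous_intros)
  have B0: "0 \<le> B" using order_trans[OF norm_ge_zero bound[of u]] D by simp
  have gcont: "continuous_on (cball u D) g"
  proof (rule lipschitz_on_continuous_on)
    show "l-lipschitz_on (cball u D) g" using lip l by (auto intro!: lipschitz_onI simp: dist_norm)
  qed
  have gx: "continuous_on A (\<lambda>q. g (apply_bcontfun x q))" if "x \<in> S" for x A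
    by (rule continuous_on_compose2[OF gcont]) (use that in \<open>auto simp: S_def intro!: continuous_intros\<close>)
  have int: "(\<lambda>q. g (apply_bcontfun x q)) integrable_on {c..e}" if "x \<in> S" for x c e
    using gx[OF that] by (rule integrable_continuous_real)
  have Ibd: "norm (I x r - u) \<le> D" if "x \<in> S" for x r
  proof -
    have "norm (integral {0..cl r} (\<lambda>q. g (x q))) \<le> B * (cl r - 0)"
      by (rule integral_bound) (use cl gx[OF that] bound that in \<open>auto simp: S_def\<close>)
    also have "\<dots> \<le> B * \<tau>" using cl(1)[of r] B0 by (auto intro: mult_left_mono)
    finally show ?thesis using small by (simp add: I_def mult.commute)
  qed
  have Icont: "continuous_on UNIV (I x)" if "x \<in> S" for x
  proof -
    have "continuous_on {0..\<tau>} (\<lambda>r. integral {0..r} (\<lambda>q. g (x q)))"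
      by (rule indefinite_integral_continuous_1) (rule int[OF that])
    then have "continuous_on UNIV (\<lambda>r. integral {0..cl r} (\<lambda>q. g (x q)))"
      by (rule continuous_on_compose2) (use cl in auto)
    then show ?thesis unfolding I_def by (intro continuous_intros)
  qed
  have Ib: "I x \<in> bcontfun" if "x \<in> S" for x
  proof (rule bcontfun_normI[of _ "norm u + D"])
    show "norm (I x r) \<le> norm u + D" for r
      using Ibd[OF that, of r] norm_triangle_sub[of "I x r" u] by linarith
  qed (rule Icont[OF that])
  define P where "P = (\<lambda>x. Bcontfun (I x))"
  have Papp: "apply_bcontfun (P x) r = I x r" if "x \<in> S" for x r
    unfolding P_def using Bcontfun_inverse[OF Ib[OF that]] by simp
  have "\<exists>!x\<in>S. P x = x"
  proof (rule Banach_fix)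
    have "closed S"
    proof -
      have "S = (\<Inter>r. {x. norm (apply_bcontfun x r - u) \<le> D})"
        by (auto simp: S_def dist_norm norm_minus_commute)
      moreover have "closed {x :: real \<Rightarrow>\<^sub>C 'a. norm (apply_bcontfun x r - u) \<le> D}" for r
      proof -
        have "continuous_on UNIV (\<lambda>x :: real \<Rightarrow>\<^sub>C 'a. apply_bcontfun x r)"
          by (rule lipschitz_on_continuous_on[of 1])
             (auto intro!: lipschitz_onI simp: dist_bounded)
        then show ?thesis by (intro closed_Collect_le continuous_intros)
      qed
      ultimately show ?thesis by auto
    qed
    then show "complete S" by (simp add: complete_eq_closed)
    have "Bcontfun (\<lambda>_. u) \<in> S"
      using D by (auto simp: S_def Bcontfun_inverse[OF const_bcontfun])
    then show "S \<noteq> {}" by auto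
    show "P ` S \<subseteq> S"
      using Ibd Papp by (auto simp: S_def dist_norm norm_minus_commute)
    show "dist (P x) (P y) \<le> 1/2 * dist x y" if "x \<in> S" "y \<in> S" for x y
    proof (rule dist_bound)
      fix r
      have "norm (I x r - I y r) = norm (integral {0..cl r} (\<lambda>q. g (x q) - g (y q)))"
        unfolding I_def by (simp add: Henstock_Kurzweil_Integration.integral_diff int that)
      also have "\<dots> \<le> (l * dist x y) * (cl r - 0)"
      proof (rule integral_bound)
        show "norm (g (x t) - g (y t)) \<le> l * dist x y" for t
        proof -
          have "norm (g (x t) - g (y t)) \<le> l * norm (x t - y t)"
            using lip that by (auto simp: S_def)
          also have "\<dots> \<le> l * dist x y" using l dist_bounded[of x t y]
            by (intro mult_left_mono) (auto simp: dist_norm)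
          finally show ?thesis .
        qed
      qed (use cl in \<open>auto intro!: continuous_intros gx that\<close>)
      also have "\<dots> \<le> (l * dist x y) * \<tau>" using cl(1)[of r] l by (auto intro!: mult_left_mono)
      also have "\<dots> = (\<tau> * l) * dist x y" by simp
      also have "\<dots> \<le> 1/2 * dist x y" using small by (intro mult_right_mono) auto
      finally show "dist (P x r) (P y r) \<le> 1/2 * dist x y"
        using that by (simp add: Papp dist_norm)
    qed
  qed auto
  then obtain x where x: "x \<in> S" "P x = x" by auto
  have "x r = u + integral {0..r} (\<lambda>q. g (x q))" if "r \<in> {0..\<tau>}" for r
    using Papp[OF x(1), of r] x(2) that by (simp add: I_def cl_def)
  then have "((\<lambda>q. g (x q)) has_integral (x r - u)) {0..r}" if "r \<in> {0..\<tau>}" for r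
    using int[OF x(1), of 0 r] that by (simp add: has_integral_iff)
  then show ?thesis using x(1)
    by (intro exI[of _ "apply_bcontfun x"]) (auto simp: S_def intro!: continuous_intros)
qed

text \<open>\<open>G p\<close> is the translation by \<open>A p\<close> up to an error that is small together with its Lipschitz
  constant in \<open>p\<close> and \<open>u\<close>.  The Lipschitz bound lets a contraction replace a degree argument.\<close>

definition near_shift :: "real \<Rightarrow> real \<Rightarrow> ('p::real_normed_vector \<Rightarrow> 'a::real_normed_vector) \<Rightarrow> ('p \<Rightarrow> 'a \<Rightarrow> 'a) \<Rightarrow> bool" where
  "near_shift \<epsilon> R A G \<longleftrightarrow>
     (\<forall>p u. norm p \<le> R \<longrightarrow> norm u \<le> R \<longrightarrow> norm (G p u - u - A p) \<le> \<epsilon>) \<and>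
     (\<forall>p u p' u'. norm p \<le> R \<longrightarrow> norm u \<le> R \<longrightarrow> norm p' \<le> R \<longrightarrow> norm u' \<le> R \<longrightarrow>
        norm ((G p u - u - A p) - (G p' u' - u' - A p')) \<le> \<epsilon> * (norm (p - p') + norm (u - u')))"

lemma near_shiftD1: "near_shift \<epsilon> R A G \<Longrightarrow> norm p \<le> R \<Longrightarrow> norm u \<le> R \<Longrightarrow> norm (G p u - u - A p) \<le> \<epsilon>"
  and near_shiftD2: "near_shift \<epsilon> R A G \<Longrightarrow> norm p \<le> R \<Longrightarrow> norm u \<le> R \<Longrightarrow> norm p' \<le> R \<Longrightarrow> norm u' \<le> R \<Longrightarrow>
     norm ((G p u - u - A p) - (G p' u' - u' - A p')) \<le> \<epsilon> * (norm (p - p') + norm (u - u'))"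
  unfolding near_shift_def by blast+

lemma near_shift_mono:
  fixes A :: "'p::real_normed_vector \<Rightarrow> 'a::real_normed_vector"
  assumes "near_shift \<epsilon> R A G" "\<epsilon> \<le> \<epsilon>'" "R' \<le> R"
  shows "near_shift \<epsilon>' R' A G"
  unfolding near_shift_def
proof (intro conjI allI impI)
  fix p p' :: 'p and u u' :: 'a
  assume h: "norm p \<le> R'" "norm u \<le> R'" "norm p' \<le> R'" "norm u' \<le> R'"
  show "norm ((G p u - u - A p) - (G p' u' - u' - A p')) \<le> \<epsilon>' * (norm (p - p') + norm (u - u'))"
    using near_shiftD2[OF assms(1), of p u p' u'] h assms(2,3)
      mult_right_mono[OF assms(2), of "norm (p - p') + norm (u - u')"] by auto
next
  fix p :: 'p and u :: 'a assume "norm p \<le> R'" "norm u \<le> R'"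
  then show "norm (G p u - u - A p) \<le> \<epsilon>'" using near_shiftD1[OF assms(1), of p u] assms by auto
qed

text \<open>The error of the second map is taken at the moved point, so it is amplified by the
  Lipschitz constant of \<open>G1\<close>. With \<epsilon>1 \<le> 1 the moved points differ by at
  most (\<Lambda> + 1) |p - p'| + 2 |u - u'|. The parameter of the second map adds another |p - p'|,
  and \<Lambda> + 3 dominates both coefficients.\<close>

lemma near_shift_comp:
  fixes A B :: "'p::real_normed_vector \<Rightarrow> 'a::real_normed_vector"
  assumes n1: "near_shift \<epsilon>1 R A G1" and n2: "near_shift \<epsilon>2 R2 B G2"
    and A: "\<And>p. norm p \<le> R \<Longrightarrow> norm (A p) \<le> \<Lambda>"
    and Al: "\<And>p p'. norm (A p - A p') \<le> \<Lambda> * norm (p - p')"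
    and R2: "R + \<Lambda> + \<epsilon>1 \<le> R2" and e: "0 \<le> \<epsilon>1" "\<epsilon>1 \<le> 1" "0 \<le> \<epsilon>2" "0 \<le> \<Lambda>"
  shows "near_shift (\<epsilon>1 + \<epsilon>2 * (\<Lambda> + 3)) R (\<lambda>p. A p + B p) (\<lambda>p u. G2 p (G1 p u))"
proof -
  define \<rho>1 where "\<rho>1 p u = G1 p u - u - A p" for p :: 'p and u :: 'a
  define \<rho>2 where "\<rho>2 p u = G2 p u - u - B p" for p :: 'p and u :: 'a
  have G1: "G1 p u = u + A p + \<rho>1 p u" for p u by (simp add: \<rho>1_def)
  have tot: "G2 p (G1 p u) - u - (A p + B p) = \<rho>1 p u + \<rho>2 p (G1 p u)" for p u
    by (simp add: \<rho>1_def \<rho>2_def)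
  have b1: "norm (\<rho>1 p u) \<le> \<epsilon>1" if "norm p \<le> R" "norm u \<le> R" for p u
    using near_shiftD1[OF n1 that] by (simp add: \<rho>1_def)
  have bG: "norm (G1 p u) \<le> R2" if "norm p \<le> R" "norm u \<le> R" for p u
    unfolding G1 using b1[OF that] A[OF that(1)] that R2
      norm_triangle_ineq[of "u + A p" "\<rho>1 p u"] norm_triangle_ineq[of u "A p"] by linarith
  have RR: "R \<le> R2" using R2 e by linarith
  have e2: "\<epsilon>2 \<le> \<epsilon>2 * (\<Lambda> + 3)" using e by (simp add: mult_left_mono[of 1 "\<Lambda>+3" \<epsilon>2, simplified])
  show ?thesis unfolding near_shift_def tot
  proof (intro conjI allI impI)
    fix p :: 'p and u :: 'a assume h: "norm p \<le> R" "norm u \<le> R"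
    have "norm (\<rho>2 p (G1 p u)) \<le> \<epsilon>2" using near_shiftD1[OF n2, of p "G1 p u"] bG[OF h] h RR by (simp add: \<rho>2_def)
    then show "norm (\<rho>1 p u + \<rho>2 p (G1 p u)) \<le> \<epsilon>1 + \<epsilon>2 * (\<Lambda> + 3)"
      using b1[OF h] e2 norm_triangle_ineq[of "\<rho>1 p u" "\<rho>2 p (G1 p u)"] by linarith
  next
    fix p p' :: 'p and u u' :: 'a
    assume h: "norm p \<le> R" "norm u \<le> R" "norm p' \<le> R" "norm u' \<le> R"
    let ?a = "norm (p - p')" and ?b = "norm (u - u')"
    have 1: "norm (\<rho>1 p u - \<rho>1 p' u') \<le> \<epsilon>1 * (?a + ?b)"
      using near_shiftD2[OF n1 h] by (simp add: \<rho>1_def)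
    have "norm (\<rho>1 p u - \<rho>1 p' u') \<le> ?a + ?b"
      using 1 e mult_right_mono[of \<epsilon>1 1 "?a + ?b"] by simp
    moreover have "G1 p u - G1 p' u' = (u - u') + (A p - A p') + (\<rho>1 p u - \<rho>1 p' u')"
      by (simp add: G1)
    ultimately have d: "norm (G1 p u - G1 p' u') \<le> ?b + \<Lambda> * ?a + (?a + ?b)"
      using Al[of p p'] norm_triangle_ineq[of "(u - u') + (A p - A p')" "\<rho>1 p u - \<rho>1 p' u'"]
        norm_triangle_ineq[of "u - u'" "A p - A p'"] by (simp only:)
    have "norm (\<rho>2 p (G1 p u) - \<rho>2 p' (G1 p' u')) \<le> \<epsilon>2 * (?a + norm (G1 p u - G1 p' u'))"
      using near_shiftD2[OF n2, of p "G1 p u" p' "G1 p' u'"] bG h RR by (simp add: \<rho>2_def)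
    also have "\<dots> \<le> \<epsilon>2 * ((\<Lambda> + 3) * (?a + ?b))"
    proof (intro mult_left_mono)
      have "0 \<le> ?a + (\<Lambda> + 1) * ?b" using e by simp
      then show "?a + norm (G1 p u - G1 p' u') \<le> (\<Lambda> + 3) * (?a + ?b)"
        using d by (simp add: algebra_simps)
    qed (use e in auto)
    finally have 2: "norm (\<rho>2 p (G1 p u) - \<rho>2 p' (G1 p' u')) \<le> \<epsilon>2 * (\<Lambda> + 3) * (?a + ?b)" by simp
    have "(\<rho>1 p u + \<rho>2 p (G1 p u)) - (\<rho>1 p' u' + \<rho>2 p' (G1 p' u'))
        = (\<rho>1 p u - \<rho>1 p' u') + (\<rho>2 p (G1 p u) - \<rho>2 p' (G1 p' u'))" by simp
    then show "norm ((\<rho>1 p u + \<rho>2 p (G1 p u)) - (\<rho>1 p' u' + \<rho>2 p' (G1 p' u')))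
        \<le> (\<epsilon>1 + \<epsilon>2 * (\<Lambda> + 3)) * (?a + ?b)"
      using 1 2 norm_triangle_ineq[of "\<rho>1 p u - \<rho>1 p' u'" "\<rho>2 p (G1 p u) - \<rho>2 p' (G1 p' u')"]
      by (simp only: distrib_right)
  qed
qed

text \<open>In the frame of a fast motion the equation reads \<open>y' = (s / T) g + \<eta>\<close> with \<open>T \<eta>\<close> small, so that
  its time \<open>T\<close> map is close to the shift by \<open>s g\<close>, in the Lipschitz sense.\<close>

lemma slow_perturbation:
  fixes g :: "'a::banach" and \<eta> :: "real \<Rightarrow> 'a \<Rightarrow> 'a"
  assumes T: "0 < T" and R: "0 \<le> R" and \<beta>: "0 \<le> \<beta>"
    and bd: "\<And>s y. \<bar>s\<bar> \<le> R \<Longrightarrow> norm y \<le> R + R * norm g + 1 \<Longrightarrow> norm (\<eta> s y) \<le> \<beta>"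
    and lip: "\<And>s s' y y'. \<bar>s\<bar> \<le> R \<Longrightarrow> \<bar>s'\<bar> \<le> R \<Longrightarrow> norm y \<le> R + R * norm g + 1 \<Longrightarrow>
       norm y' \<le> R + R * norm g + 1 \<Longrightarrow> norm (\<eta> s y - \<eta> s' y') \<le> \<beta> * (\<bar>s - s'\<bar> + norm (y - y'))"
    and small: "T * \<beta> \<le> 1/2" "T * \<beta> * (2 + 2 * norm g) \<le> \<epsilon>"
  shows "\<exists>Y. near_shift \<epsilon> R (\<lambda>s. s *\<^sub>R g) Y \<and>
     (\<forall>s u. \<bar>s\<bar> \<le> R \<longrightarrow> norm u \<le> R \<longrightarrow> (\<exists>y. continuous_on {0..T} y \<and> y T = Y s u \<and>
       (\<forall>r\<in>{0..T}. ((\<lambda>q. (s / T) *\<^sub>R g + \<eta> s (y q)) has_integral (y r - u)) {0..r})))"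
proof -
  \<comment> \<open>The constant drift moves a point by at most \<open>R * norm g\<close> and \<eta>
    by at most T \<beta> \<le> 1/2, so trajectories stay where \<eta> is controlled.\<close>
  define D where "D = R * norm g + 1"
  define ok where "ok s u y \<longleftrightarrow> continuous_on {0..T} y \<and> (\<forall>r\<in>{0..T}. y r \<in> cball u D \<and>
       ((\<lambda>q. (s / T) *\<^sub>R g + \<eta> s (y q)) has_integral (y r - u)) {0..r})" for s u y
  have D0: "0 \<le> D" using R by (simp add: D_def)
  have ball: "norm y \<le> R + R * norm g + 1" if "norm u \<le> R" "y \<in> cball u D" for u y
    using that norm_triangle_sub[of y u] by (simp add: D_def dist_norm norm_minus_commute)
  have ex: "\<exists>y. ok s u y" if h: "\<bar>s\<bar> \<le> R" "norm u \<le> R" for s u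
    unfolding ok_def
  proof (rule picard)
    show "norm ((s / T) *\<^sub>R g + \<eta> s x) \<le> R * norm g / T + \<beta>" if "x \<in> cball u D" for x
    proof -
      have "norm ((s / T) *\<^sub>R g) \<le> R * norm g / T"
        using h T by (simp add: divide_right_mono mult_right_mono)
      then show ?thesis using bd[OF h(1) ball[OF h(2) that]]
          norm_triangle_ineq[of "(s/T) *\<^sub>R g" "\<eta> s x"] by linarith
    qed
    show "norm ((s / T) *\<^sub>R g + \<eta> s x - ((s / T) *\<^sub>R g + \<eta> s y)) \<le> \<beta> * norm (x - y)"
      if "x \<in> cball u D" "y \<in> cball u D" for x y
      using lip[OF h(1) h(1) ball[OF h(2) that(1)] ball[OF h(2) that(2)]] by simp
    show "T * (R * norm g / T + \<beta>) \<le> D"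
      using T small by (simp add: D_def distrib_left)
  qed (use T D0 small \<beta> in auto)
  define y where "y s u = (SOME y. ok s u y)" for s u
  have y: "ok s u (y s u)" if "\<bar>s\<bar> \<le> R" "norm u \<le> R" for s u
    unfolding y_def using someI_ex[OF ex[OF that]] .
  define Y where "Y s u = y s u T" for s u
  have yb: "norm (y s u r) \<le> R + R * norm g + 1" if "\<bar>s\<bar> \<le> R" "norm u \<le> R" "r \<in> {0..T}" for s u r
    using y[OF that(1,2)] that(3) ball[OF that(2)] by (auto simp: ok_def)
  \<comment> \<open>The integral of \<eta> along a trajectory is its deviation from the constant
    motion; at r = T it is the error term of \<open>near_shift\<close>.\<close>
  have yI: "((\<lambda>q. \<eta> s (y s u q)) has_integral (y s u r - u - (r * (s / T)) *\<^sub>R g)) {0..r}"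
    if h: "\<bar>s\<bar> \<le> R" "norm u \<le> R" "r \<in> {0..T}" for s u r
  proof -
    have "((\<lambda>q. (s / T) *\<^sub>R g + \<eta> s (y s u q)) has_integral (y s u r - u)) {0..r}"
      using y[OF h(1,2)] h(3) by (auto simp: ok_def)
    from has_integral_diff[OF this has_integral_const_real[of "(s/T) *\<^sub>R g" 0 r]] show ?thesis
      using h(3) by simp
  qed
  have diffI: "norm ((y s u r - u - (r * (s / T)) *\<^sub>R g) - (y s' u' r - u' - (r * (s' / T)) *\<^sub>R g))
      \<le> T * \<beta> * (\<bar>s - s'\<bar> + b)"
    if h: "\<bar>s\<bar> \<le> R" "norm u \<le> R" "\<bar>s'\<bar> \<le> R" "norm u' \<le> R" "r \<in> {0..T}"
      and b: "\<And>q. q \<in> {0..T} \<Longrightarrow> norm (y s u q - y s' u' q) \<le> b" for s u s' u' r b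
  proof -
    have b0: "0 \<le> b" using order_trans[OF norm_ge_zero b[of 0]] T by auto
    have "norm ((y s u r - u - (r * (s / T)) *\<^sub>R g) - (y s' u' r - u' - (r * (s' / T)) *\<^sub>R g))
        \<le> (\<beta> * (\<bar>s - s'\<bar> + b)) * measure lborel (cbox 0 r)"
    proof (rule has_integral_bound)
      show "((\<lambda>q. \<eta> s (y s u q) - \<eta> s' (y s' u' q)) has_integral
         ((y s u r - u - (r * (s / T)) *\<^sub>R g) - (y s' u' r - u' - (r * (s' / T)) *\<^sub>R g))) (cbox 0 r)"
        using has_integral_diff[OF yI[OF h(1,2,5)] yI[OF h(3,4,5)]] by simp
      show "0 \<le> \<beta> * (\<bar>s - s'\<bar> + b)" using \<beta> b0 by simp
      fix q assume "q \<in> cbox 0 r"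
      then have q: "q \<in> {0..T}" using h(5) by auto
      have "norm (\<eta> s (y s u q) - \<eta> s' (y s' u' q)) \<le> \<beta> * (\<bar>s - s'\<bar> + norm (y s u q - y s' u' q))"
        using lip yb q h by auto
      also have "\<dots> \<le> \<beta> * (\<bar>s - s'\<bar> + b)" using b[OF q] \<beta> by (intro mult_left_mono) auto
      finally show "norm (\<eta> s (y s u q) - \<eta> s' (y s' u' q)) \<le> \<beta> * (\<bar>s - s'\<bar> + b)" .
    qed
    also have "\<dots> \<le> (\<beta> * (\<bar>s - s'\<bar> + b)) * T"
      using h(5) \<beta> b0 by (intro mult_left_mono) auto
    finally show ?thesis by (simp add: mult.commute mult.left_commute)
  qed
  have "near_shift \<epsilon> R (\<lambda>s. s *\<^sub>R g) Y"
    unfolding near_shift_def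
  proof (intro conjI allI impI)
    fix s :: real and u :: 'a assume h: "norm (s::real) \<le> R" "norm u \<le> R"
    have "norm (Y s u - u - (T * (s / T)) *\<^sub>R g) \<le> \<beta> * measure lborel (cbox 0 T)"
      unfolding Y_def
      by (rule has_integral_bound[OF \<beta>, of "\<lambda>q. \<eta> s (y s u q)"])
         (use yI[of s u T] h T bd yb in auto)
    also have "\<dots> = T * \<beta>" using T by simp
    also have "\<dots> \<le> T * \<beta> * (2 + 2 * norm g)" using T \<beta> mult_left_mono[of 1 "2 + 2 * norm g" "T * \<beta>"] by simp
    finally show "norm (Y s u - u - s *\<^sub>R g) \<le> \<epsilon>" using small T by simp
  next
    fix s s' :: real and u u' :: 'a
    assume h: "norm s \<le> R" "norm u \<le> R" "norm s' \<le> R" "norm u' \<le> R"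
    then have h': "\<bar>s\<bar> \<le> R" "norm u \<le> R" "\<bar>s'\<bar> \<le> R" "norm u' \<le> R" by auto
    \<comment> \<open>In place of a Gronwall estimate, the largest distance \<open>m\<close> between
      the two trajectories is bounded in terms of itself with factor T \<beta> \<le> 1/2 and
      absorbed on the left.\<close>
    have "\<exists>r0\<in>{0..T}. \<forall>r\<in>{0..T}. norm (y s u r - y s' u' r) \<le> norm (y s u r0 - y s' u' r0)"
      by (rule continuous_attains_sup) (use T y h' in \<open>auto simp: ok_def intro!: continuous_intros\<close>)
    then obtain r0 where r0: "r0 \<in> {0..T}"
      and max: "\<And>r. r \<in> {0..T} \<Longrightarrow> norm (y s u r - y s' u' r) \<le> norm (y s u r0 - y s' u' r0)" by blast
    define m where "m = norm (y s u r0 - y s' u' r0)"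
    have main: "norm ((y s u r - u - (r * (s / T)) *\<^sub>R g) - (y s' u' r - u' - (r * (s' / T)) *\<^sub>R g))
        \<le> T * \<beta> * (\<bar>s - s'\<bar> + m)" if "r \<in> {0..T}" for r
      by (rule diffI[OF h' that]) (use max in \<open>auto simp: m_def\<close>)
    have "y s u r0 - y s' u' r0 = ((y s u r0 - u - (r0 * (s / T)) *\<^sub>R g) - (y s' u' r0 - u' - (r0 * (s' / T)) *\<^sub>R g))
        + ((u - u') + (r0 / T * (s - s')) *\<^sub>R g)"
      by (simp add: algebra_simps diff_divide_distrib)
    then have m1: "m \<le> T * \<beta> * (\<bar>s - s'\<bar> + m) + norm ((u - u') + (r0 / T * (s - s')) *\<^sub>R g)"
      using main[OF r0] by (smt (verit) m_def norm_triangle_ineq)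
    have m2: "norm ((u - u') + (r0 / T * (s - s')) *\<^sub>R g) \<le> norm (u - u') + \<bar>s - s'\<bar> * norm g"
    proof -
      have "norm ((r0 / T * (s - s')) *\<^sub>R g) = (r0 / T) * (\<bar>s - s'\<bar> * norm g)"
        using r0 T by (simp add: abs_mult)
      also have "\<dots> \<le> 1 * (\<bar>s - s'\<bar> * norm g)" using r0 T by (intro mult_right_mono) auto
      finally show ?thesis using norm_triangle_ineq[of "u - u'" "(r0 / T * (s - s')) *\<^sub>R g"] by linarith
    qed
    have m3: "T * \<beta> * (\<bar>s - s'\<bar> + m) \<le> 1/2 * (\<bar>s - s'\<bar> + m)"
      using small by (intro mult_right_mono) (auto simp: m_def)
    have m: "m \<le> \<bar>s - s'\<bar> + 2 * norm (u - u') + 2 * (\<bar>s - s'\<bar> * norm g)" using m1 m2 m3 by argo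
    have "norm ((Y s u - u - s *\<^sub>R g) - (Y s' u' - u' - s' *\<^sub>R g)) \<le> T * \<beta> * (\<bar>s - s'\<bar> + m)"
      using main[of T] T by (simp add: Y_def)
    also have "\<dots> \<le> T * \<beta> * ((2 + 2 * norm g) * (\<bar>s - s'\<bar> + norm (u - u')))"
    proof (rule mult_left_mono)
      have "(2 + 2 * norm g) * (\<bar>s - s'\<bar> + norm (u - u')) = 2 * \<bar>s - s'\<bar> + 2 * norm (u - u')
          + 2 * (\<bar>s - s'\<bar> * norm g) + 2 * (norm g * norm (u - u'))"
        by (simp add: algebra_simps)
      moreover have "0 \<le> norm g * norm (u - u')" "0 \<le> \<bar>s - s'\<bar>" "0 \<le> norm (u - u')" by auto
      ultimately show "\<bar>s - s'\<bar> + m \<le> (2 + 2 * norm g) * (\<bar>s - s'\<bar> + norm (u - u'))"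
        using m by argo
    qed (use T \<beta> in simp)
    also have "\<dots> = (T * \<beta> * (2 + 2 * norm g)) * (\<bar>s - s'\<bar> + norm (u - u'))" by simp
    also have "\<dots> \<le> \<epsilon> * (\<bar>s - s'\<bar> + norm (u - u'))" by (rule mult_right_mono[OF small(2)]) auto
    finally show "norm ((Y s u - u - s *\<^sub>R g) - (Y s' u' - u' - s' *\<^sub>R g)) \<le> \<epsilon> * (norm (s - s') + norm (u - u'))"
      by simp
  qed
  moreover have "\<exists>z. continuous_on {0..T} z \<and> z T = Y s u \<and>
       (\<forall>r\<in>{0..T}. ((\<lambda>q. (s / T) *\<^sub>R g + \<eta> s (z q)) has_integral (z r - u)) {0..r})"
    if "\<bar>s\<bar> \<le> R" "norm u \<le> R" for s u
    using y[OF that] by (intro exI[of _ "y s u"]) (auto simp: Y_def ok_def)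
  ultimately show ?thesis by blast
qed

text \<open>Coordinates centred at \<open>A p\<close>: after the jump the state differs from its
  starting point only by the error of the jump. A motion that follows can then be analysed without
  the size of \<open>A p\<close> entering the radii.\<close>

lemma near_shift_frame_in: "near_shift \<epsilon> R A G \<Longrightarrow> near_shift \<epsilon> R (\<lambda>_. 0) (\<lambda>p u. G p u - A p)"
  by (simp add: near_shift_def algebra_simps)

text \<open>The way back from the moved coordinates. The jump by \<open>- A p\<close> starts at
  \<open>u + A p\<close>, so it must be accurate on the larger ball of radius \<open>R'\<close>, and
  the Lipschitz constant of \<open>A\<close> costs a factor 1 + \<Lambda>.\<close>

lemma near_shift_frame_out:
  fixes A :: "'p::real_normed_vector \<Rightarrow> 'a::real_normed_vector"
  assumes n: "near_shift \<epsilon> R' (\<lambda>p. - A p) G"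
    and A: "\<And>p. norm p \<le> R \<Longrightarrow> norm (A p) \<le> \<Lambda>"
    and Al: "\<And>p p'. norm (A p - A p') \<le> \<Lambda> * norm (p - p')"
    and R': "R + \<Lambda> \<le> R'" and e: "0 \<le> \<epsilon>" "0 \<le> \<Lambda>"
  shows "near_shift (\<epsilon> * (1 + \<Lambda>)) R (\<lambda>_. 0) (\<lambda>p u. G p (u + A p))"
proof -
  have b: "norm p \<le> R'" "norm (u + A p) \<le> R'" if "norm p \<le> R" "norm u \<le> R" for p u
    using A[OF that(1)] that R' e norm_triangle_ineq[of u "A p"] by linarith+
  have eq: "G p (u + A p) - u - 0 = G p (u + A p) - (u + A p) - - A p" for p u by simp
  show ?thesis unfolding near_shift_def eq
  proof (intro conjI allI impI)
    fix p :: 'p and u :: 'a assume h: "norm p \<le> R" "norm u \<le> R"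
    show "norm (G p (u + A p) - (u + A p) - - A p) \<le> \<epsilon> * (1 + \<Lambda>)"
      using near_shiftD1[OF n b[OF h]] mult_left_mono[of 1 "1 + \<Lambda>" \<epsilon>] e by linarith
  next
    fix p p' :: 'p and u u' :: 'a
    assume h: "norm p \<le> R" "norm u \<le> R" "norm p' \<le> R" "norm u' \<le> R"
    have "norm (G p (u + A p) - (u + A p) - - A p - (G p' (u' + A p') - (u' + A p') - - A p'))
        \<le> \<epsilon> * (norm (p - p') + norm ((u + A p) - (u' + A p')))"
      by (rule near_shiftD2[OF n b[OF h(1,2)] b[OF h(3,4)]])
    also have "\<dots> \<le> \<epsilon> * ((1 + \<Lambda>) * (norm (p - p') + norm (u - u')))"
    proof (rule mult_left_mono[OF _ e(1)])
      have "(u + A p) - (u' + A p') = (u - u') + (A p - A p')" by simp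
      then have "norm ((u + A p) - (u' + A p')) \<le> norm (u - u') + \<Lambda> * norm (p - p')"
        using Al[of p p'] norm_triangle_ineq[of "u - u'" "A p - A p'"] by (simp only:)
      moreover have "0 \<le> \<Lambda> * norm (u - u')" using e by simp
      ultimately show "norm (p - p') + norm ((u + A p) - (u' + A p')) \<le> (1 + \<Lambda>) * (norm (p - p') + norm (u - u'))"
        unfolding distrib_left distrib_right by argo
    qed
    finally show "norm (G p (u + A p) - (u + A p) - - A p - (G p' (u' + A p') - (u' + A p') - - A p'))
        \<le> \<epsilon> * (1 + \<Lambda>) * (norm (p - p') + norm (u - u'))" by (simp only: mult.assoc)
  qed
qed

lemma small_factor:
  fixes \<beta> \<kappa> T0 :: real
  assumes "0 \<le> \<beta>" "0 < \<kappa>" "0 < T0"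
  obtains T where "0 < T" "T < T0" "T * \<beta> \<le> \<kappa>"
proof -
  define T where "T = min (T0 / 2) (\<kappa> / (\<beta> + 1))"
  have "T * \<beta> \<le> \<kappa> / (\<beta> + 1) * (\<beta> + 1)" using assms by (intro mult_mono) (auto simp: T_def)
  also have "\<dots> = \<kappa>" using assms by simp
  finally have "T * \<beta> \<le> \<kappa>" .
  moreover have "0 < T" "T < T0" using assms by (auto simp: T_def min_less_iff_disj)
  ultimately show thesis by (rule that[rotated 2])
qed

section \<open>Quadratic systems with piecewise constant controls\<close>

locale quadratic_control =
  fixes Q :: "'a::banach \<Rightarrow> 'a \<Rightarrow> 'a" and L :: "'a \<Rightarrow> 'a" and d :: 'a and E :: "'a set"
  assumes Q: "bounded_bilinear Q" and L: "bounded_linear L"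
    and E0: "0 \<in> E" and E: "e \<in> E \<Longrightarrow> c *\<^sub>R e \<in> E"
begin

definition field :: "'a \<Rightarrow> 'a" where "field x = Q x x + L x + d"

text \<open>No flow map is chosen: one solution ending at \<open>w\<close> suffices for steering,
  and uniqueness is settled separately in \<open>galerkin_solution_unique\<close>.\<close>

definition flow :: "real \<Rightarrow> 'a \<Rightarrow> 'a \<Rightarrow> 'a \<Rightarrow> bool" where
  "flow T c u w \<longleftrightarrow> (\<exists>x. continuous_on {0..T} x \<and> x T = w \<and>
     (\<forall>r\<in>{0..T}. ((\<lambda>q. field (x q) + c) has_integral (x r - u)) {0..r}))"

inductive reach :: "real \<Rightarrow> 'a \<Rightarrow> 'a \<Rightarrow> bool" where
  reach_flow: "0 \<le> T \<Longrightarrow> c \<in> E \<Longrightarrow> flow T c u w \<Longrightarrow> reach T u w"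
| reach_trans: "reach S u v \<Longrightarrow> reach T v w \<Longrightarrow> reach (S + T) u w"

text \<open>All translations by \<open>A p\<close> can be realised approximately in arbitrarily short time.\<close>

definition impulsive :: "('p::real_normed_vector \<Rightarrow> 'a) \<Rightarrow> bool" where
  "impulsive A \<longleftrightarrow> (\<forall>R>0. \<forall>\<epsilon>>0. \<forall>T0>0. \<exists>T G. 0 < T \<and> T < T0 \<and> near_shift \<epsilon> R A G \<and>
     (\<forall>p u. norm p \<le> R \<longrightarrow> norm u \<le> R \<longrightarrow> reach T u (G p u)))"

lemma impulsiveE:
  assumes "impulsive A" "0 < R" "0 < \<epsilon>" "0 < T0"
  obtains T G where "0 < T" "T < T0" "near_shift \<epsilon> R A G"
    "\<And>p u. norm p \<le> R \<Longrightarrow> norm u \<le> R \<Longrightarrow> reach T u (G p u)"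
proof -
  have "\<exists>T G. 0 < T \<and> T < T0 \<and> near_shift \<epsilon> R A G \<and>
      (\<forall>p u. norm p \<le> R \<longrightarrow> norm u \<le> R \<longrightarrow> reach T u (G p u))"
    using assms(1)[unfolded impulsive_def, rule_format, OF assms(2-4)] .
  then show thesis using that by metis
qed

lemma bounds:
  obtains K where "0 < K" "\<And>x y. norm (Q x y) \<le> K * norm x * norm y"
    "\<And>x. norm (L x) \<le> K * norm x" "norm d \<le> K"
proof -
  obtain K1 where K1: "0 < K1" "\<And>x y. norm (Q x y) \<le> norm x * norm y * K1"
    using bounded_bilinear.pos_bounded[OF Q] by blast
  obtain K2 where K2: "0 < K2" "\<And>x. norm (L x) \<le> norm x * K2"
    using bounded_linear.pos_bounded[OF L] by blast
  let ?K = "K1 + K2 + norm d"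
  show thesis
  proof (rule that)
    show "0 < ?K" using K1 K2 by (simp add: add_pos_nonneg)
    show "norm (Q x y) \<le> ?K * norm x * norm y" for x y
    proof -
      have "norm x * norm y * K1 \<le> norm x * norm y * ?K" using K2 by (intro mult_left_mono) auto
      then show ?thesis using K1(2)[of x y] by (simp add: mult_ac)
    qed
    show "norm (L x) \<le> ?K * norm x" for x
    proof -
      have "norm x * K2 \<le> norm x * ?K" using K1 by (intro mult_left_mono) auto
      then show ?thesis using K2(2)[of x] by (simp add: mult_ac)
    qed
  qed (use K1 K2 in auto)
qed

lemma field_bound:
  assumes K: "0 < K" "\<And>x y. norm (Q x y) \<le> K * norm x * norm y"
    "\<And>x. norm (L x) \<le> K * norm x" "norm d \<le> K"
    and x: "norm x \<le> M" and M: "0 \<le> M"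
  shows "norm (field x) \<le> K * (M\<^sup>2 + M + 1)"
proof -
  have "norm (Q x x) \<le> K * M * M" 
    using order_trans[OF K(2)[of x x]] x K(1) M by (intro order_trans[OF K(2)[of x x]] mult_mono) auto
  moreover have "norm (L x) \<le> K * M" using K(1) x by (intro order_trans[OF K(3)] mult_left_mono) auto
  ultimately show ?thesis using K(4) norm_triangle_ineq[of "Q x x + L x" d] norm_triangle_ineq[of "Q x x" "L x"]
    by (simp add: field_def algebra_simps power2_eq_square)
qed

lemma field_lipschitz:
  assumes K: "0 < K" "\<And>x y. norm (Q x y) \<le> K * norm x * norm y" "\<And>x. norm (L x) \<le> K * norm x"
    and x: "norm x \<le> M" "norm y \<le> M" and M: "0 \<le> M"
  shows "norm (field x - field y) \<le> K * (2 * M + 1) * norm (x - y)"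
proof -
  interpret Q: bounded_bilinear Q by (rule Q)
  interpret L: bounded_linear L by (rule L)
  have "field x - field y = Q x (x - y) + Q (x - y) y + L (x - y)"
    by (simp add: field_def Q.diff_left Q.diff_right L.diff)
  moreover have "norm (Q x (x - y)) \<le> K * M * norm (x - y)"
    using x K(1) M by (intro order_trans[OF K(2)] mult_mono) auto
  moreover have "norm (Q (x - y) y) \<le> K * norm (x - y) * M"
    using x K(1) M by (intro order_trans[OF K(2)] mult_mono) auto
  moreover have "norm (L (x - y)) \<le> K * norm (x - y)" by (rule K)
  ultimately show ?thesis
    using norm_triangle_ineq[of "Q x (x - y) + Q (x - y) y" "L (x - y)"]
      norm_triangle_ineq[of "Q x (x - y)" "Q (x - y) y"]
    by (simp add: algebra_simps)
qed

text \<open>The control (s / T) e displaces by s e in time T, whereas the drift contributes only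
  O(T). This is \<open>slow_perturbation\<close> with the whole field as \<eta>.\<close>

lemma impulsive_control:
  assumes e: "e \<in> E"
  shows "impulsive (\<lambda>s::real. s *\<^sub>R e)"
  unfolding impulsive_def
proof (intro allI impI)
  fix R \<epsilon> T0 :: real assume pos: "0 < R" "0 < \<epsilon>" "0 < T0"
  obtain K where K: "0 < K" "\<And>x y. norm (Q x y) \<le> K * norm x * norm y"
    "\<And>x. norm (L x) \<le> K * norm x" "norm d \<le> K" by (rule bounds) (rule that)
  define M where "M = R + R * norm e + 1"
  define \<beta> where "\<beta> = K * (M\<^sup>2 + M + 1) + K * (2 * M + 1)"
  have M: "0 \<le> M" using pos by (simp add: M_def)
  have b12: "0 \<le> K * (M\<^sup>2 + M + 1)" "0 \<le> K * (2 * M + 1)" using M K by auto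
  then have \<beta>: "0 \<le> \<beta>" by (simp add: \<beta>_def)
  obtain T where T: "0 < T" "T < T0" "T * \<beta> \<le> min (1/2) (\<epsilon> / (2 + 2 * norm e))"
    using small_factor[of \<beta> "min (1/2) (\<epsilon> / (2 + 2 * norm e))" T0] \<beta> pos
    by (auto simp: add_pos_nonneg)
  have "\<exists>Y. near_shift \<epsilon> R (\<lambda>s. s *\<^sub>R e) Y \<and>
     (\<forall>s u. \<bar>s\<bar> \<le> R \<longrightarrow> norm u \<le> R \<longrightarrow> (\<exists>y. continuous_on {0..T} y \<and> y T = Y s u \<and>
       (\<forall>r\<in>{0..T}. ((\<lambda>q. (s / T) *\<^sub>R e + field (y q)) has_integral (y r - u)) {0..r})))"
  proof (rule slow_perturbation[where \<beta> = \<beta>])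
    show "norm (field y) \<le> \<beta>" if "norm y \<le> R + R * norm e + 1" for y
      using field_bound[OF K, of y M] that M b12 by (simp add: M_def \<beta>_def)
    show "norm (field y - field y') \<le> \<beta> * (\<bar>s - s'\<bar> + norm (y - y'))"
      if "norm y \<le> R + R * norm e + 1" "norm y' \<le> R + R * norm e + 1" for s s' y y'
    proof -
      have "norm (field y - field y') \<le> K * (2 * M + 1) * norm (y - y')"
        using field_lipschitz[OF K(1-3), of y M y'] that M by (simp add: M_def)
      also have "\<dots> \<le> \<beta> * (\<bar>s - s'\<bar> + norm (y - y'))"
        using b12 by (intro mult_mono) (auto simp: \<beta>_def)
      finally show ?thesis .
    qed
    show "T * \<beta> * (2 + 2 * norm e) \<le> \<epsilon>"
    proof -
      have "0 < 2 + 2 * norm e" using norm_ge_zero[of e] by linarith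
      then show ?thesis using T(3) by (simp only: pos_le_divide_eq min.bounded_iff)
    qed
  qed (use T \<beta> pos in auto)
  then obtain Y where Y: "near_shift \<epsilon> R (\<lambda>s. s *\<^sub>R e) Y" and sol: "\<And>s u. \<bar>s\<bar> \<le> R \<Longrightarrow> norm u \<le> R \<Longrightarrow>
     (\<exists>y. continuous_on {0..T} y \<and> y T = Y s u \<and>
       (\<forall>r\<in>{0..T}. ((\<lambda>q. (s / T) *\<^sub>R e + field (y q)) has_integral (y r - u)) {0..r}))" by blast
  have "reach T u (Y s u)" if "norm s \<le> R" "norm u \<le> R" for s u
  proof (rule reach_flow)
    show "(s / T) *\<^sub>R e \<in> E" by (rule E[OF e])
    show "flow T ((s / T) *\<^sub>R e) u (Y s u)" using sol[of s u] that by (simp add: flow_def add.commute)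
  qed (use T in auto)
  then have "\<forall>p u. norm p \<le> R \<longrightarrow> norm u \<le> R \<longrightarrow> reach T u (Y p u)" by simp
  with T(1,2) Y show "\<exists>T G. 0 < T \<and> T < T0 \<and> near_shift \<epsilon> R (\<lambda>s. s *\<^sub>R e) G \<and>
     (\<forall>p u. norm p \<le> R \<longrightarrow> norm u \<le> R \<longrightarrow> reach T u (G p u))"
    by (intro exI conjI)
qed

lemma impulsive_add:
  fixes A B :: "'p::real_normed_vector \<Rightarrow> 'a"
  assumes A: "impulsive A" and B: "impulsive B" and lip: "\<Lambda>-lipschitz_on UNIV A"
  shows "impulsive (\<lambda>p. A p + B p)"
  unfolding impulsive_def
proof (intro allI impI)
  fix R \<epsilon> T0 :: real assume pos: "0 < R" "0 < \<epsilon>" "0 < T0"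
  \<comment> \<open>One constant for both uses in \<open>near_shift_comp\<close>: a bound for
    \<open>A\<close> on the ball of radius \<open>R\<close> and a Lipschitz constant.\<close>
  define \<Lambda>' where "\<Lambda>' = norm (A 0) + \<Lambda> * R + \<Lambda>"
  have \<Lambda>: "0 \<le> \<Lambda>" "\<And>p q. norm (A p - A q) \<le> \<Lambda> * norm (p - q)"
    using lipschitz_on_nonneg[OF lip] lipschitz_onD[OF lip] by (auto simp: dist_norm)
  have \<Lambda>': "0 \<le> \<Lambda>'" "\<Lambda> \<le> \<Lambda>'" using \<Lambda>(1) pos by (auto simp: \<Lambda>'_def)
  have Ab: "norm (A p) \<le> \<Lambda>'" if "norm p \<le> R" for p
    using \<Lambda>(2)[of p 0] norm_triangle_sub[of "A p" "A 0"] mult_left_mono[OF that \<Lambda>(1)] \<Lambda>(1)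
    by (simp add: \<Lambda>'_def)
  have Al: "norm (A p - A p') \<le> \<Lambda>' * norm (p - p')" for p p'
    using \<Lambda>(2)[of p p'] mult_right_mono[OF \<Lambda>'(2), of "norm (p - p')"] by simp
  obtain T1 G1 where 1: "0 < T1" "T1 < T0 / 2" "near_shift (min 1 (\<epsilon> / 2)) R A G1"
    "\<And>p u. norm p \<le> R \<Longrightarrow> norm u \<le> R \<Longrightarrow> reach T1 u (G1 p u)"
    using impulsiveE[OF A, of R "min 1 (\<epsilon> / 2)" "T0 / 2"] pos by auto
  have "0 < R + \<Lambda>' + 1" "0 < \<epsilon> / (2 * (\<Lambda>' + 3))" "0 < T0 / 2" using pos \<Lambda>' by auto
  then obtain T2 G2 where 2: "0 < T2" "T2 < T0 / 2" "near_shift (\<epsilon> / (2 * (\<Lambda>' + 3))) (R + \<Lambda>' + 1) B G2"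
    "\<And>p u. norm p \<le> R + \<Lambda>' + 1 \<Longrightarrow> norm u \<le> R + \<Lambda>' + 1 \<Longrightarrow> reach T2 u (G2 p u)"
    using impulsiveE[OF B] by metis
  have n: "near_shift \<epsilon> R (\<lambda>p. A p + B p) (\<lambda>p u. G2 p (G1 p u))"
  proof (rule near_shift_mono[OF near_shift_comp[OF 1(3) 2(3) Ab Al]])
    have "\<epsilon> / (2 * (\<Lambda>' + 3)) * (\<Lambda>' + 3) = \<epsilon> / 2" using \<Lambda>' by (simp add: field_simps)
    then show "min 1 (\<epsilon> / 2) + \<epsilon> / (2 * (\<Lambda>' + 3)) * (\<Lambda>' + 3) \<le> \<epsilon>"
      using min.cobounded2[of 1 "\<epsilon> / 2"] by argo
  qed (use pos \<Lambda>' in auto)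
  have "reach (T1 + T2) u (G2 p (G1 p u))" if h: "norm p \<le> R" "norm u \<le> R" for p u
  proof (rule reach_trans[OF 1(4)[OF h] 2(4)])
    have "G1 p u = (G1 p u - u - A p) + u + A p" by simp
    then show "norm (G1 p u) \<le> R + \<Lambda>' + 1"
      using near_shiftD1[OF 1(3) h] Ab[OF h(1)] h norm_triangle_ineq[of "(G1 p u - u - A p) + u" "A p"]
        norm_triangle_ineq[of "(G1 p u - u - A p)" u] by simp
  qed (use h \<Lambda>' in auto)
  then show "\<exists>T G. 0 < T \<and> T < T0 \<and> near_shift \<epsilon> R (\<lambda>p. A p + B p) G \<and>
     (\<forall>p u. norm p \<le> R \<longrightarrow> norm u \<le> R \<longrightarrow> reach T u (G p u))"
    using 1(1,2) 2(1,2) n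
    by (intro exI[of _ "T1 + T2"] exI[of _ "\<lambda>p u. G2 p (G1 p u)"]) auto
qed

text \<open>Constants, multiples and coordinate functionals will be substituted for the parameter.
  Asking for tolerance \<epsilon> / (1 + \<Lambda>) pays for the Lipschitz constant of the
  substitution.\<close>

lemma impulsive_reparam:
  fixes A :: "'p::real_normed_vector \<Rightarrow> 'a" and \<sigma> :: "'q::real_normed_vector \<Rightarrow> 'p"
  assumes A: "impulsive A" and lip: "\<Lambda>-lipschitz_on UNIV \<sigma>"
  shows "impulsive (\<lambda>q. A (\<sigma> q))"
  unfolding impulsive_def
proof (intro allI impI)
  fix R \<epsilon> T0 :: real assume pos: "0 < R" "0 < \<epsilon>" "0 < T0"
  have \<Lambda>: "0 \<le> \<Lambda>" "\<And>p q. norm (\<sigma> p - \<sigma> q) \<le> \<Lambda> * norm (p - q)"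
    using lipschitz_on_nonneg[OF lip] lipschitz_onD[OF lip] by (auto simp: dist_norm)
  define R' where "R' = R + norm (\<sigma> 0) + \<Lambda> * R"
  have R': "R \<le> R'" using \<Lambda> pos by (simp add: R'_def)
  have \<sigma>: "norm (\<sigma> p) \<le> R'" if "norm p \<le> R" for p
    using \<Lambda>(2)[of p 0] norm_triangle_sub[of "\<sigma> p" "\<sigma> 0"] mult_left_mono[OF that \<Lambda>(1)] pos
    by (simp add: R'_def)
  have "0 < R'" "0 < \<epsilon> / (1 + \<Lambda>)" using R' pos \<Lambda> by (auto simp: add_pos_nonneg)
  then obtain T G where T: "0 < T" "T < T0" and n: "near_shift (\<epsilon> / (1 + \<Lambda>)) R' A G"
    and r: "\<And>p u. norm p \<le> R' \<Longrightarrow> norm u \<le> R' \<Longrightarrow> reach T u (G p u)"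
    using impulsiveE[OF A] pos by metis
  have e: "\<epsilon> / (1 + \<Lambda>) \<le> \<epsilon>" using pos \<Lambda> by (simp add: divide_le_eq add_pos_nonneg)
  have "near_shift \<epsilon> R (\<lambda>q. A (\<sigma> q)) (\<lambda>q. G (\<sigma> q))"
    unfolding near_shift_def
  proof (intro conjI allI impI)
    fix p :: 'q and u :: 'a assume h: "norm p \<le> R" "norm u \<le> R"
    then show "norm (G (\<sigma> p) u - u - A (\<sigma> p)) \<le> \<epsilon>"
      using near_shiftD1[OF n \<sigma>, of p u] R' e by simp
  next
    fix p p' :: 'q and u u' :: 'a
    assume h: "norm p \<le> R" "norm u \<le> R" "norm p' \<le> R" "norm u' \<le> R"
    have "norm (G (\<sigma> p) u - u - A (\<sigma> p) - (G (\<sigma> p') u' - u' - A (\<sigma> p')))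
        \<le> \<epsilon> / (1 + \<Lambda>) * (norm (\<sigma> p - \<sigma> p') + norm (u - u'))"
      by (rule near_shiftD2[OF n \<sigma> _ \<sigma>]) (use h R' in auto)
    also have "\<dots> \<le> \<epsilon> / (1 + \<Lambda>) * ((1 + \<Lambda>) * (norm (p - p') + norm (u - u')))"
    proof (rule mult_left_mono)
      have "0 \<le> \<Lambda> * norm (u - u')" using \<Lambda> by simp
      then show "norm (\<sigma> p - \<sigma> p') + norm (u - u') \<le> (1 + \<Lambda>) * (norm (p - p') + norm (u - u'))"
        using \<Lambda>(2)[of p p'] norm_ge_zero[of "p - p'"] unfolding distrib_left distrib_right by argo
    qed (use pos \<Lambda> in auto)
    also have "\<dots> = \<epsilon> * (norm (p - p') + norm (u - u'))" using \<Lambda> by simp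
    finally show "norm (G (\<sigma> p) u - u - A (\<sigma> p) - (G (\<sigma> p') u' - u' - A (\<sigma> p')))
        \<le> \<epsilon> * (norm (p - p') + norm (u - u'))" .
  qed
  moreover have "reach T u (G (\<sigma> p) u)" if "norm p \<le> R" "norm u \<le> R" for p u
    using r[OF \<sigma>[OF that(1)]] that R' by auto
  ultimately show "\<exists>T G. 0 < T \<and> T < T0 \<and> near_shift \<epsilon> R (\<lambda>q. A (\<sigma> q)) G \<and>
     (\<forall>p u. norm p \<le> R \<longrightarrow> norm u \<le> R \<longrightarrow> reach T u (G p u))"
    using T by (intro exI[of _ T] exI[of _ "\<lambda>q. G (\<sigma> q)"]) auto
qed

end

section \<open>Brackets and exact steering\<close>

context quadratic_control
begin

text \<open>Jump by \<open>(e + s h) / \<sigma>\<close>, drift for time \<open>\<sigma>\<^sup>2\<close>, and jump back.  Since \<open>Q e e = Q h h = 0\<close>, the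
  quadratic part of the drift is \<open>(s / \<sigma>\<^sup>2) (Q e h + Q h e)\<close> while all other terms are \<open>O(1 / \<sigma>)\<close>.
  The parameter \<open>s\<close> may have either sign.\<close>

lemma impulsive_bracket:
  assumes e: "impulsive (\<lambda>s::real. s *\<^sub>R e)" and h: "impulsive (\<lambda>s::real. s *\<^sub>R h)"
    and Qe: "Q e e = 0" and Qh: "Q h h = 0"
  shows "impulsive (\<lambda>s::real. s *\<^sub>R (Q e h + Q h e))"
  unfolding impulsive_def
proof (intro allI impI)
  fix R \<epsilon> T0 :: real assume pos: "0 < R" "0 < \<epsilon>" "0 < T0"
  interpret Q: bounded_bilinear Q by (rule Q)
  interpret L: bounded_linear L by (rule L)
  obtain K where K: "0 < K" "\<And>x y. norm (Q x y) \<le> K * norm x * norm y"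
    "\<And>x. norm (L x) \<le> K * norm x" "norm d \<le> K" by (rule bounds) (rule that)
  define g where "g = Q e h + Q h e"
  \<comment> \<open>\<open>R1\<close>, \<open>M\<close>, \<open>m\<close> and \<open>C\<close>
    depend on \<open>R\<close>, \<open>e\<close>, \<open>h\<close> and the bound \<open>K\<close>,
    but not on \<sigma>; this is what the moved coordinates achieve. The 1 in \<open>R1\<close>
    leaves room for the error of the first jump.\<close>
  define R1 where "R1 = R + 1"
  define M where "M = R1 + R1 * norm g + 1"
  define m where "m = norm e + R1 * norm h"
  define C where "C = K * (2 * m * M + m + (M\<^sup>2 + M + 1)) + K * (2 * m + (2 * M + 1) + 2 * norm h * M + norm h)"
  have M: "0 \<le> M" and m: "0 \<le> m" using pos by (auto simp: M_def R1_def m_def)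
  have C1: "0 \<le> K * (2 * m * M + m + (M\<^sup>2 + M + 1))" and C2: "0 \<le> K * (2 * m + (2 * M + 1) + 2 * norm h * M + norm h)"
    using M m K(1) by auto
  then have C: "0 \<le> C" by (simp add: C_def)
  \<comment> \<open>Error budget: the first jump and the drift together use \<epsilon>1 + 3
    \<epsilon>2 \<le> \<epsilon> / 2, the jump back the other half. The bound by 1 keeps
    intermediate points in fixed balls.\<close>
  define \<epsilon>1 where "\<epsilon>1 = min (1/2) (\<epsilon> / 4)"
  define \<epsilon>2 where "\<epsilon>2 = min (1/6) (\<epsilon> / 12)"
  have \<epsilon>12: "0 < \<epsilon>1" "0 < \<epsilon>2" "\<epsilon>1 \<le> 1" "\<epsilon>1 + \<epsilon>2 * 3 \<le> 1" "\<epsilon>1 + \<epsilon>2 * 3 \<le> \<epsilon> / 2"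
    using pos min.cobounded1[of "1/2" "\<epsilon>/4"] min.cobounded2[of "1/2" "\<epsilon>/4"]
      min.cobounded1[of "1/6" "\<epsilon>/12"] min.cobounded2[of "1/6" "\<epsilon>/12"]
    unfolding \<epsilon>1_def \<epsilon>2_def by (auto simp del: min.cobounded1 min.cobounded2)
  have g2: "0 < 2 + 2 * norm g" using norm_ge_zero[of g] by linarith
  \<comment> \<open>The perturbation has size \<open>C / \<sigma>\<close> and acts during the time
    \<sigma> \<sigma>, so its total effect is \<sigma> C.\<close>
  obtain \<sigma> where \<sigma>: "0 < \<sigma>" "\<sigma> < min 1 (T0 / 3)" "\<sigma> * C \<le> min (1/2) (\<epsilon>2 / (2 + 2 * norm g))"
  proof (rule small_factor[of C "min (1/2) (\<epsilon>2 / (2 + 2 * norm g))" "min 1 (T0 / 3)"])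
    show "0 < min (1/2) (\<epsilon>2 / (2 + 2 * norm g))" using \<epsilon>12 g2 by simp
  qed (use C pos in auto)
  define T where "T = \<sigma> * \<sigma>"
  have T: "0 < T" "T < T0 / 3" using \<sigma> mult_strict_mono[of \<sigma> 1 \<sigma> "T0 / 3"] pos by (auto simp: T_def)
  have TC: "T * (C / \<sigma>) = \<sigma> * C" using \<sigma> by (simp add: T_def)
  define A where "A s = (1 / \<sigma>) *\<^sub>R e + (s / \<sigma>) *\<^sub>R h" for s :: real
  have Ab: "norm (A s) \<le> (norm e + r * norm h) / \<sigma>" if "\<bar>s\<bar> \<le> r" for s r
  proof -
    have "norm (A s) \<le> norm e / \<sigma> + \<bar>s\<bar> * norm h / \<sigma>"
      using norm_triangle_ineq[of "(1 / \<sigma>) *\<^sub>R e" "(s / \<sigma>) *\<^sub>R h"] \<sigma> by (simp add: A_def)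
    also have "\<dots> \<le> norm e / \<sigma> + r * norm h / \<sigma>"
      using \<sigma> that by (intro add_left_mono divide_right_mono mult_right_mono) auto
    finally show ?thesis by (simp add: add_divide_distrib)
  qed
  have Ad: "A s - A s' = ((s - s') / \<sigma>) *\<^sub>R h" for s s'
    by (simp add: A_def algebra_simps diff_divide_distrib)
  have Al: "norm (A s - A s') \<le> (norm h / \<sigma>) * \<bar>s - s'\<bar>" for s s'
    unfolding Ad using \<sigma> by (simp add: mult.commute)
  \<comment> \<open>The field seen from the coordinates centred at \<open>A s\<close>, without its
    leading part (s / T) g. Since \<open>A s\<close> enters at most linearly, \<eta> is only O(1 /
    \<sigma>) on a fixed ball.\<close>
  define \<eta> where "\<eta> s y = Q (A s) y + Q y (A s) + field y + L (A s)" for s y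
  have QA: "Q (A s) (A s) = (s / T) *\<^sub>R g" for s
    by (simp add: A_def g_def Q.add_left Q.add_right Q.scaleR_left Q.scaleR_right Qe Qh T_def algebra_simps)
  have shift: "field (y + A s) = (s / T) *\<^sub>R g + \<eta> s y" for y s
    by (simp add: field_def \<eta>_def Q.add_left Q.add_right L.add QA)
  have s1: "1 \<le> 1 / \<sigma>" using \<sigma> by simp
  have "\<exists>Y. near_shift \<epsilon>2 R1 (\<lambda>s. s *\<^sub>R g) Y \<and>
     (\<forall>s u. \<bar>s\<bar> \<le> R1 \<longrightarrow> norm u \<le> R1 \<longrightarrow> (\<exists>y. continuous_on {0..T} y \<and> y T = Y s u \<and>
       (\<forall>r\<in>{0..T}. ((\<lambda>q. (s / T) *\<^sub>R g + \<eta> s (y q)) has_integral (y r - u)) {0..r})))"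
  proof (rule slow_perturbation[where \<beta> = "C / \<sigma>"])
    show "norm (\<eta> s y) \<le> C / \<sigma>" if s: "\<bar>s\<bar> \<le> R1" and y: "norm y \<le> R1 + R1 * norm g + 1" for s y
    proof -
      have A: "norm (A s) \<le> m / \<sigma>" using Ab[OF s] by (simp add: m_def)
      have y: "norm y \<le> M" using y by (simp add: M_def)
      have "norm (Q (A s) y) \<le> K * (m / \<sigma>) * M" "norm (Q y (A s)) \<le> K * M * (m / \<sigma>)"
        by (rule order_trans[OF K(2)]; use A y K(1) M m \<sigma> in \<open>intro mult_mono; simp\<close>)+
      moreover have "norm (L (A s)) \<le> K * (m / \<sigma>)"
        using A K by (intro order_trans[OF K(3)] mult_left_mono) auto
      moreover have "norm (field y) \<le> K * (M\<^sup>2 + M + 1) * (1 / \<sigma>)"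
        using field_bound[OF K y M] mult_left_mono[OF s1, of "K * (M\<^sup>2 + M + 1)"] K(1) M by simp
      ultimately have "norm (\<eta> s y) \<le> K * (m / \<sigma>) * M + K * M * (m / \<sigma>) + K * (M\<^sup>2 + M + 1) * (1 / \<sigma>) + K * (m / \<sigma>)"
        unfolding \<eta>_def by (intro norm_triangle_le add_mono)
      also have "\<dots> = K * (2 * m * M + m + (M\<^sup>2 + M + 1)) / \<sigma>"
        using \<sigma>(1) by (simp add: divide_simps) (simp add: algebra_simps)
      also have "\<dots> \<le> C / \<sigma>" using C2 \<sigma> by (intro divide_right_mono) (auto simp: C_def)
      finally show ?thesis .
    qed
    show "norm (\<eta> s y - \<eta> s' y') \<le> C / \<sigma> * (\<bar>s - s'\<bar> + norm (y - y'))"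
      if s: "\<bar>s\<bar> \<le> R1" "\<bar>s'\<bar> \<le> R1" and y: "norm y \<le> R1 + R1 * norm g + 1" "norm y' \<le> R1 + R1 * norm g + 1"
      for s s' y y'
    proof -
      let ?\<Delta> = "\<bar>s - s'\<bar> + norm (y - y')"
      have A: "norm (A s) \<le> m / \<sigma>" using Ab[OF s(1)] by (simp add: m_def)
      have y: "norm y \<le> M" "norm y' \<le> M" using y by (auto simp: M_def)
      have Al': "norm (A s - A s') \<le> (norm h / \<sigma>) * ?\<Delta>"
        using \<sigma> by (intro order_trans[OF Al] mult_left_mono) auto
      have eq: "\<eta> s y - \<eta> s' y' = Q (A s) (y - y') + Q (A s - A s') y' + Q (y - y') (A s) + Q y' (A s - A s')
          + (field y - field y') + L (A s - A s')"
        by (simp add: \<eta>_def Q.diff_left Q.diff_right L.diff)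
      have 1: "norm (Q (A s) (y - y')) \<le> K * (m / \<sigma>) * ?\<Delta>"
        by (rule order_trans[OF K(2)]; use A K(1) M m \<sigma> in \<open>intro mult_mono; simp\<close>)
      have 2: "norm (Q (A s - A s') y') \<le> K * ((norm h / \<sigma>) * ?\<Delta>) * M"
        by (rule order_trans[OF K(2)]; use Al' y K(1) M m \<sigma> in \<open>intro mult_mono; simp\<close>)
      have 3: "norm (Q (y - y') (A s)) \<le> K * ?\<Delta> * (m / \<sigma>)"
        by (rule order_trans[OF K(2)]; use A K(1) M m \<sigma> in \<open>intro mult_mono; simp\<close>)
      have 4: "norm (Q y' (A s - A s')) \<le> K * M * ((norm h / \<sigma>) * ?\<Delta>)"
        by (rule order_trans[OF K(2)]; use Al' y K(1) M m \<sigma> in \<open>intro mult_mono; simp\<close>)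
      have 5: "norm (L (A s - A s')) \<le> K * ((norm h / \<sigma>) * ?\<Delta>)"
        using Al' K by (intro order_trans[OF K(3)] mult_left_mono) auto
      have "norm (field y - field y') \<le> K * (2 * M + 1) * norm (y - y')"
        by (rule field_lipschitz[OF K(1-3) y M])
      also have "\<dots> \<le> (K * (2 * M + 1) * (1 / \<sigma>)) * ?\<Delta>"
        by (rule mult_mono) (use K(1) M \<sigma> mult_left_mono[OF s1, of "K * (2 * M + 1)"] in auto)
      finally have 6: "norm (field y - field y') \<le> K * (2 * M + 1) * (1 / \<sigma>) * ?\<Delta>" .
      have "norm (\<eta> s y - \<eta> s' y') \<le> K * (m / \<sigma>) * ?\<Delta> + K * ((norm h / \<sigma>) * ?\<Delta>) * M + K * ?\<Delta> * (m / \<sigma>)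
          + K * M * ((norm h / \<sigma>) * ?\<Delta>) + K * (2 * M + 1) * (1 / \<sigma>) * ?\<Delta> + K * ((norm h / \<sigma>) * ?\<Delta>)"
        unfolding eq using 1 2 3 4 5 6 by (intro norm_triangle_le add_mono)
      also have "\<dots> = (K * (2 * m + (2 * M + 1) + 2 * norm h * M + norm h) / \<sigma>) * ?\<Delta>"
        using \<sigma>(1) by (simp add: divide_simps) (simp add: algebra_simps)
      also have "\<dots> \<le> C / \<sigma> * ?\<Delta>"
        using C1 \<sigma> by (intro mult_right_mono divide_right_mono) (auto simp: C_def)
      finally show ?thesis .
    qed
    show "T * (C / \<sigma>) * (2 + 2 * norm g) \<le> \<epsilon>2"
      unfolding TC using \<sigma>(3) g2 by (simp only: pos_le_divide_eq min.bounded_iff)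
    show "T * (C / \<sigma>) \<le> 1 / 2" unfolding TC using \<sigma>(3) by simp
  qed (use T C \<sigma> pos in \<open>auto simp: R1_def\<close>)
  then obtain Y where Y: "near_shift \<epsilon>2 R1 (\<lambda>s. s *\<^sub>R g) Y" and sol: "\<And>s u. \<bar>s\<bar> \<le> R1 \<Longrightarrow> norm u \<le> R1 \<Longrightarrow>
     (\<exists>y. continuous_on {0..T} y \<and> y T = Y s u \<and>
       (\<forall>r\<in>{0..T}. ((\<lambda>q. (s / T) *\<^sub>R g + \<eta> s (y q)) has_integral (y r - u)) {0..r}))" by blast
  have lipc: "\<exists>\<Lambda>. \<Lambda>-lipschitz_on UNIV (\<lambda>s::real. c * s)" for c
    using lipschitz_on_cmult_real[OF lipschitz_on_id] by blast
  have impL: "impulsive (\<lambda>s. (c *\<^sub>R e) + ((c' * s) *\<^sub>R h))" for c c' :: real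
  proof (rule impulsive_add)
    show "impulsive (\<lambda>s::real. c *\<^sub>R e)"
      by (rule impulsive_reparam[OF e lipschitz_on_constant])
    show "impulsive (\<lambda>s::real. (c' * s) *\<^sub>R h)"
      using impulsive_reparam[OF h] lipc[of c'] by blast
  qed (rule lipschitz_on_constant)
  have impA: "impulsive A" using impL[of "1 / \<sigma>" "1 / \<sigma>"] by (simp add: A_def[abs_def])
  have impmA: "impulsive (\<lambda>s. - A s)" using impL[of "- (1 / \<sigma>)" "- (1 / \<sigma>)"] by (simp add: A_def[abs_def])
  define \<Lambda> where "\<Lambda> = R * norm g + norm g"
  define R3 where "R3 = R + \<Lambda> + 1"
  \<comment> \<open>Unlike the constants above, \<Lambda>A is of order 1 / \<sigma>. The tolerance
    \<open>\<epsilon>b\<close> of the jump back is lowered accordingly; its factors anticipate the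
    losses in \<open>near_shift_frame_out\<close> and \<open>near_shift_comp\<close>.\<close>
  define \<Lambda>A where "\<Lambda>A = (norm e + R3 * norm h + norm h) / \<sigma>"
  define \<epsilon>b where "\<epsilon>b = \<epsilon> / (2 * (1 + \<Lambda>A) * (\<Lambda> + 3))"
  have \<Lambda>: "0 \<le> \<Lambda>" "norm g \<le> \<Lambda>" "R * norm g \<le> \<Lambda>" using pos by (auto simp: \<Lambda>_def)
  have R3: "R \<le> R3" "0 < R3" using \<Lambda> pos by (auto simp: R3_def)
  have \<Lambda>A: "0 \<le> \<Lambda>A" using \<sigma> R3 by (auto simp: \<Lambda>A_def)
  have \<epsilon>b: "0 < \<epsilon>b" using pos \<Lambda>A \<Lambda> by (simp add: \<epsilon>b_def)
  obtain Ta Ga where a: "0 < Ta" "Ta < T0 / 3" "near_shift \<epsilon>1 R A Ga"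
    "\<And>p u. norm p \<le> R \<Longrightarrow> norm u \<le> R \<Longrightarrow> reach Ta u (Ga p u)"
    by (rule impulsiveE[OF impA pos(1) \<epsilon>12(1), of "T0 / 3"]) (use pos in auto)
  obtain Tb Gb where b: "0 < Tb" "Tb < T0 / 3" "near_shift \<epsilon>b (R3 + \<Lambda>A) (\<lambda>s. - A s) Gb"
    "\<And>p u. norm p \<le> R3 + \<Lambda>A \<Longrightarrow> norm u \<le> R3 + \<Lambda>A \<Longrightarrow> reach Tb u (Gb p u)"
    by (rule impulsiveE[OF impmA _ \<epsilon>b, of "R3 + \<Lambda>A" "T0 / 3"]) (use pos R3 \<Lambda>A in auto)
  have n12: "near_shift (\<epsilon>1 + \<epsilon>2 * (0 + 3)) R (\<lambda>s. 0 + s *\<^sub>R g) (\<lambda>s u. Y s (Ga s u - A s))"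
    by (rule near_shift_comp[OF near_shift_frame_in[OF a(3)] Y]) (use \<epsilon>12 in \<open>auto simp: R1_def\<close>)
  have n3: "near_shift (\<epsilon>b * (1 + \<Lambda>A)) R3 (\<lambda>_. 0) (\<lambda>s u. Gb s (u + A s))"
  proof (rule near_shift_frame_out[OF b(3)])
    show "norm (A p) \<le> \<Lambda>A" if "norm p \<le> R3" for p
    proof -
      have "norm (A p) \<le> (norm e + R3 * norm h) / \<sigma>" using Ab[of p R3] that by simp
      also have "\<dots> \<le> \<Lambda>A" using \<sigma> unfolding \<Lambda>A_def by (intro divide_right_mono) auto
      finally show ?thesis .
    qed
    show "norm (A p - A p') \<le> \<Lambda>A * norm (p - p')" for p p'
    proof -
      have "norm h / \<sigma> \<le> \<Lambda>A" using \<sigma> R3 unfolding \<Lambda>A_def by (intro divide_right_mono) auto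
      then show ?thesis using order_trans[OF Al mult_right_mono] by simp
    qed
  qed (use \<Lambda>A \<epsilon>b in auto)
  have n: "near_shift \<epsilon> R (\<lambda>s. s *\<^sub>R g) (\<lambda>s u. Gb s (Y s (Ga s u - A s) + A s))"
  proof -
    have "near_shift ((\<epsilon>1 + \<epsilon>2 * (0 + 3)) + \<epsilon>b * (1 + \<Lambda>A) * (\<Lambda> + 3)) R (\<lambda>s. (0 + s *\<^sub>R g) + 0)
       (\<lambda>s u. Gb s (Y s (Ga s u - A s) + A s))"
    proof (rule near_shift_comp[OF n12 n3])
      show "norm (0 + p *\<^sub>R g) \<le> \<Lambda>" if "norm p \<le> R" for p
        using mult_right_mono[OF that, of "norm g"] \<Lambda> by simp
      show "norm ((0 + p *\<^sub>R g) - (0 + p' *\<^sub>R g)) \<le> \<Lambda> * norm (p - p')" for p p'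
        using mult_right_mono[OF \<Lambda>(2), of "\<bar>p - p'\<bar>"]
        by (simp add: scaleR_diff_left[symmetric] mult.commute del: scaleR_diff_left)
    qed (use \<epsilon>12 \<Lambda> \<Lambda>A \<epsilon>b in \<open>auto simp: R3_def\<close>)
    moreover have "\<epsilon>b * (1 + \<Lambda>A) * (\<Lambda> + 3) = \<epsilon> / 2"
      using \<Lambda>A \<Lambda> by (simp add: \<epsilon>b_def divide_simps)
    then have "(\<epsilon>1 + \<epsilon>2 * (0 + 3)) + \<epsilon>b * (1 + \<Lambda>A) * (\<Lambda> + 3) \<le> \<epsilon>"
      using \<epsilon>12(5) by argo
    ultimately have "near_shift \<epsilon> R (\<lambda>s. (0 + s *\<^sub>R g) + 0) (\<lambda>s u. Gb s (Y s (Ga s u - A s) + A s))"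
      using near_shift_mono[OF _ _ order_refl] by blast
    then show ?thesis by simp
  qed
  have "reach (Ta + (T + Tb)) u (Gb s (Y s (Ga s u - A s) + A s))" if h: "norm s \<le> R" "norm u \<le> R" for s u
  proof (rule reach_trans[OF a(4)[OF h] reach_trans])
    let ?u = "Ga s u - A s"
    have "norm (?u - u) \<le> 1" using near_shiftD1[OF a(3) h] \<epsilon>12 by (simp add: algebra_simps)
    then have u1: "norm ?u \<le> R1" using h norm_triangle_sub[of ?u u] by (simp add: R1_def)
    obtain y where y: "continuous_on {0..T} y" "y T = Y s ?u"
       "\<And>r. r \<in> {0..T} \<Longrightarrow> ((\<lambda>q. (s / T) *\<^sub>R g + \<eta> s (y q)) has_integral (y r - ?u)) {0..r}"
      using sol[of s ?u] h u1 by (auto simp: R1_def)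
    \<comment> \<open>Back in the original coordinates, \<open>y\<close> translated by
      \<open>A s\<close> solves the uncontrolled equation, by \<open>shift\<close>.\<close>
    show "reach T (Ga s u) (Y s ?u + A s)"
    proof (rule reach_flow[OF _ E0])
      show "flow T 0 (Ga s u) (Y s ?u + A s)"
        unfolding flow_def
      proof (intro exI conjI ballI)
        show "continuous_on {0..T} (\<lambda>r. y r + A s)" by (intro continuous_intros y)
        show "((\<lambda>q. field (y q + A s) + 0) has_integral (y r + A s - Ga s u)) {0..r}" if "r \<in> {0..T}" for r
        proof -
          have "y r + A s - Ga s u = y r - ?u" by simp
          then show ?thesis using y(3)[OF that] by (simp only: shift add_0_right)
        qed
      qed (simp add: y)
    qed (use T in simp)
    have ns: "norm (s *\<^sub>R g) \<le> \<Lambda>" using mult_right_mono[OF h(1), of "norm g"] \<Lambda> by simp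
    have "norm (Y s ?u - u - (0 + s *\<^sub>R g)) \<le> 1"
      using near_shiftD1[OF n12 h] \<epsilon>12(4) by simp
    moreover have "Y s ?u = (Y s ?u - u - (0 + s *\<^sub>R g)) + u + s *\<^sub>R g" by simp
    ultimately have "norm (Y s ?u) \<le> 1 + R + \<Lambda>"
      using ns h(2) by (metis add_mono norm_triangle_le)
    moreover have "norm (A s) \<le> \<Lambda>A"
    proof -
      have "norm (A s) \<le> (norm e + R3 * norm h) / \<sigma>" using Ab[of s R3] h R3 by simp
      also have "\<dots> \<le> \<Lambda>A" using \<sigma> unfolding \<Lambda>A_def by (intro divide_right_mono) auto
      finally show ?thesis .
    qed
    ultimately have "norm (Y s ?u + A s) \<le> R3 + \<Lambda>A"
      using norm_triangle_ineq[of "Y s ?u" "A s"] by (simp add: R3_def)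
    then show "reach Tb (Y s ?u + A s) (Gb s (Y s ?u + A s))"
      by (intro b(4)) (use h R3 \<Lambda>A in auto)
  qed
  then have r: "\<forall>p u. norm p \<le> R \<longrightarrow> norm u \<le> R \<longrightarrow> reach (Ta + (T + Tb)) u (Gb p (Y p (Ga p u - A p) + A p))"
    by simp
  have t: "0 < Ta + (T + Tb)" "Ta + (T + Tb) < T0" using a(1,2) b(1,2) T by auto
  show "\<exists>T G. 0 < T \<and> T < T0 \<and> near_shift \<epsilon> R (\<lambda>s. s *\<^sub>R (Q e h + Q h e)) G \<and>
     (\<forall>p u. norm p \<le> R \<longrightarrow> norm u \<le> R \<longrightarrow> reach T u (G p u))"
    using t n r unfolding g_def[symmetric] by (intro exI conjI)
qed

lemma reach_nonneg: "reach T u w \<Longrightarrow> 0 \<le> T"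
  by (induction rule: reach.induct) auto

lemma impulsive_zero: "impulsive (\<lambda>_ :: 'p::real_normed_vector. 0)"
proof -
  have "impulsive (\<lambda>p :: 'p. (0::real) *\<^sub>R (0::'a))"
    by (rule impulsive_reparam[OF impulsive_control[OF E0] lipschitz_on_constant])
  then show ?thesis by simp
qed

lemma impulsive_sum:
  fixes \<phi> :: "'i \<Rightarrow> 'p::real_normed_vector \<Rightarrow> real" and b :: "'i \<Rightarrow> 'a"
  assumes "finite I" "\<And>i. i \<in> I \<Longrightarrow> bounded_linear (\<phi> i)"
    "\<And>i. i \<in> I \<Longrightarrow> impulsive (\<lambda>s::real. s *\<^sub>R b i)"
  shows "impulsive (\<lambda>p. \<Sum>i\<in>I. \<phi> i p *\<^sub>R b i)"
  using assms
proof (induction rule: finite_induct)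
  case empty
  then show ?case using impulsive_zero by simp
next
  case (insert i I)
  obtain B where B: "B-lipschitz_on UNIV (\<phi> i)"
    using bounded_linear.lipschitz_boundE[of "\<phi> i"] insert.prems by blast
  have "bounded_linear (\<lambda>p. \<phi> i p *\<^sub>R b i)"
    using insert.prems by (intro bounded_linear_scaleR_const) auto
  then obtain B' where B': "B'-lipschitz_on UNIV (\<lambda>p. \<phi> i p *\<^sub>R b i)"
    using bounded_linear.lipschitz_boundE by blast
  have "impulsive (\<lambda>p. \<phi> i p *\<^sub>R b i)"
    by (rule impulsive_reparam[OF insert.prems(2) B]) auto
  then have "impulsive (\<lambda>p. \<phi> i p *\<^sub>R b i + (\<Sum>i\<in>I. \<phi> i p *\<^sub>R b i))"
    by (rule impulsive_add[OF _ insert.IH B']) (use insert.prems in auto)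
  then show ?case using insert.hyps by simp
qed

lemma impulsive_cmul:
  assumes "impulsive (\<lambda>s::real. s *\<^sub>R g)"
  shows "impulsive (\<lambda>s::real. s *\<^sub>R (c *\<^sub>R g))"
proof -
  obtain \<Lambda> where "\<Lambda>-lipschitz_on UNIV (\<lambda>s::real. c * s)"
    using lipschitz_on_cmult_real[OF lipschitz_on_id] by blast
  from impulsive_reparam[OF assms this] show ?thesis by (simp add: mult.commute)
qed

text \<open>This reduces saturation to linear algebra: brackets may be combined and known directions
  subtracted freely.\<close>

lemma subspace_impulsive: "subspace {g. impulsive (\<lambda>s::real. s *\<^sub>R g)}"
proof (rule subspaceI)
  show "0 \<in> {g. impulsive (\<lambda>s::real. s *\<^sub>R g)}" using impulsive_zero by simp
  show "x + y \<in> {g. impulsive (\<lambda>s::real. s *\<^sub>R g)}"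
    if "x \<in> {g. impulsive (\<lambda>s::real. s *\<^sub>R g)}" "y \<in> {g. impulsive (\<lambda>s::real. s *\<^sub>R g)}" for x y
  proof -
    obtain B where "B-lipschitz_on UNIV (\<lambda>s::real. s *\<^sub>R x)"
      using bounded_linear.lipschitz_boundE[OF bounded_linear_scaleR_left[of x]] by blast
    then have "impulsive (\<lambda>s::real. s *\<^sub>R x + s *\<^sub>R y)" using that by (intro impulsive_add) auto
    then show ?thesis by (simp add: scaleR_add_right)
  qed
qed (use impulsive_cmul in auto)

end

section \<open>Exact steering within the range of a projection\<close>

locale projected_control = quadratic_control +
  fixes \<pi> :: "'a \<Rightarrow> 'a"
  assumes \<pi>: "bounded_linear \<pi>" and \<pi>\<pi>: "\<pi> (\<pi> x) = \<pi> x"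
    and \<pi>_field: "\<pi> (field x) = field x" and \<pi>_E: "e \<in> E \<Longrightarrow> \<pi> e = e"
begin

text \<open>The increment is an integral of vectors fixed by \<pi>, and a bounded linear map
  commutes with the integral. The range of \<pi> thus serves as phase space.\<close>

lemma flow_invariant:
  assumes "flow T c u w" "0 \<le> T" "c \<in> E" "\<pi> u = u"
  shows "\<pi> w = w"
proof -
  interpret \<pi>: bounded_linear \<pi> by (rule \<pi>)
  obtain x where "x T = w" and x: "((\<lambda>q. field (x q) + c) has_integral (x T - u)) {0..T}"
    using assms by (force simp: flow_def)
  have "((\<lambda>q. \<pi> (field (x q) + c)) has_integral \<pi> (x T - u)) {0..T}"
    using has_integral_linear[OF x \<pi>] by (simp add: o_def)
  then have "((\<lambda>q. field (x q) + c) has_integral \<pi> (x T - u)) {0..T}"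
    using assms by (simp add: \<pi>.add \<pi>_field \<pi>_E)
  then have "\<pi> (x T - u) = x T - u" using x has_integral_unique by blast
  then show ?thesis using assms \<open>x T = w\<close> by (simp add: \<pi>.diff)
qed

lemma reach_invariant:
  assumes "reach T u w" "\<pi> u = u" shows "\<pi> w = w"
  using assms by (induction rule: reach.induct) (auto intro: flow_invariant)

text \<open>All times up to \<tau> are covered because the waiting time in
  \<open>exact_small_time\<close> is T - T', where T' is dictated by the approximate shift. The
  proof is \<open>slow_perturbation\<close> in the direction 0.\<close>

lemma drift:
  assumes R: "0 \<le> R"
  obtains \<tau> where "0 < \<tau>" "\<And>T u. 0 < T \<Longrightarrow> T \<le> \<tau> \<Longrightarrow> norm u \<le> R \<Longrightarrow> \<exists>w. reach T u w \<and> norm (w - u) \<le> 1"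
proof -
  obtain K where K: "0 < K" "\<And>x y. norm (Q x y) \<le> K * norm x * norm y"
    "\<And>x. norm (L x) \<le> K * norm x" "norm d \<le> K" by (rule bounds) (rule that)
  define M where "M = R + 1"
  define \<beta> where "\<beta> = K * (M\<^sup>2 + M + 1) + K * (2 * M + 1)"
  have M: "0 \<le> M" using R by (simp add: M_def)
  have b12: "0 \<le> K * (M\<^sup>2 + M + 1)" "0 < K * (2 * M + 1)" using M K by auto
  then have \<beta>: "0 < \<beta>" by (simp add: \<beta>_def)
  show thesis
  proof (rule that[of "1 / (2 * \<beta>)"])
    fix T :: real and u :: 'a assume T: "0 < T" "T \<le> 1 / (2 * \<beta>)" and u: "norm u \<le> R"
    have T\<beta>: "T * \<beta> \<le> 1/2" using T(2) \<beta> by (simp add: field_simps)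
    have "\<exists>Y. near_shift 1 R (\<lambda>s. s *\<^sub>R 0) Y \<and>
     (\<forall>s u. \<bar>s\<bar> \<le> R \<longrightarrow> norm u \<le> R \<longrightarrow> (\<exists>y. continuous_on {0..T} y \<and> y T = Y s u \<and>
       (\<forall>r\<in>{0..T}. ((\<lambda>q. (s / T) *\<^sub>R (0::'a) + field (y q)) has_integral (y r - u)) {0..r})))"
    proof (rule slow_perturbation[where \<beta> = \<beta>])
      show "norm (field y) \<le> \<beta>" if "norm y \<le> R + R * norm (0::'a) + 1" for y
        using field_bound[OF K, of y M] that M b12 by (simp add: M_def \<beta>_def)
      show "norm (field y - field y') \<le> \<beta> * (\<bar>s - s'\<bar> + norm (y - y'))"
        if "norm y \<le> R + R * norm (0::'a) + 1" "norm y' \<le> R + R * norm (0::'a) + 1" for s s' y y'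
      proof -
        have "norm (field y - field y') \<le> K * (2 * M + 1) * norm (y - y')"
          using field_lipschitz[OF K(1-3), of y M y'] that M by (simp add: M_def)
        also have "\<dots> \<le> \<beta> * (\<bar>s - s'\<bar> + norm (y - y'))"
          using b12 by (intro mult_mono) (auto simp: \<beta>_def)
        finally show ?thesis .
      qed
    qed (use T T\<beta> \<beta> R in auto)
    then obtain Y where Y: "near_shift 1 R (\<lambda>s. s *\<^sub>R (0::'a)) Y" and sol: "\<And>s u. \<bar>s\<bar> \<le> R \<Longrightarrow> norm u \<le> R \<Longrightarrow>
      (\<exists>y. continuous_on {0..T} y \<and> y T = Y s u \<and>
       (\<forall>r\<in>{0..T}. ((\<lambda>q. (s / T) *\<^sub>R 0 + field (y q)) has_integral (y r - u)) {0..r}))" by blast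
    have "reach T u (Y 0 u)"
    proof (rule reach_flow[OF _ E0])
      show "flow T 0 u (Y 0 u)" using sol[of 0 u] u R by (simp add: flow_def)
    qed (use T in simp)
    moreover have "norm (Y 0 u - u) \<le> 1" using near_shiftD1[OF Y, of 0 u] R u by simp
    ultimately show "\<exists>w. reach T u w \<and> norm (w - u) \<le> 1" by blast
  qed (use \<beta> in simp)
qed

text \<open>Drift for most of the time to \<open>x\<close>, then shift by \<open>w\<close>, where \<open>w\<close> is the fixed point of the
  contraction that compensates the error of the approximate shift.\<close>

lemma exact_small_time:
  assumes impulsive: "impulsive \<pi>" and R: "0 \<le> R"
  obtains \<tau> where "0 < \<tau>" "\<And>T y z. 0 < T \<Longrightarrow> T \<le> \<tau> \<Longrightarrow> norm y \<le> R \<Longrightarrow> norm z \<le> R \<Longrightarrow>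
     \<pi> y = y \<Longrightarrow> \<pi> z = z \<Longrightarrow> reach T y z"
proof -
  interpret \<pi>: bounded_linear \<pi> by (rule \<pi>)
  obtain \<tau> where \<tau>: "0 < \<tau>" and dr: "\<And>T u. 0 < T \<Longrightarrow> T \<le> \<tau> \<Longrightarrow> norm u \<le> R \<Longrightarrow> \<exists>w. reach T u w \<and> norm (w - u) \<le> 1"
    using drift[OF R] by metis
  obtain P where P: "0 < P" "\<And>x. norm (\<pi> x) \<le> norm x * P" using \<pi>.pos_bounded by blast
  \<comment> \<open>Then |x| \<le> R + 1 and |z - x| \<le> 2 R + 1, so the unit ball around
    \<open>z - x\<close>, where the fixed point is sought, has norms at most
    \<open>R'\<close>.\<close>
  define R' where "R' = 2 * R + 2"
  define \<epsilon> where "\<epsilon> = 1 / (2 * P)"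
  have \<epsilon>: "0 < \<epsilon>" "P * \<epsilon> = 1/2" using P by (auto simp: \<epsilon>_def)
  show thesis
  proof (rule that[OF \<tau>])
    fix T y z assume T: "0 < T" "T \<le> \<tau>" and y: "norm y \<le> R" "\<pi> y = y" and z: "norm z \<le> R" "\<pi> z = z"
    obtain T' G where G: "0 < T'" "T' < T" "near_shift \<epsilon> R' \<pi> G"
      "\<And>p u. norm p \<le> R' \<Longrightarrow> norm u \<le> R' \<Longrightarrow> reach T' u (G p u)"
      by (rule impulsiveE[OF impulsive _ \<epsilon>(1) T(1), of R']) (use R in \<open>auto simp: R'_def\<close>)
    obtain x where x: "reach (T - T') y x" "norm (x - y) \<le> 1"
      using dr[of "T - T'" y] G T y by auto
    have \<pi>x: "\<pi> x = x" using reach_invariant[OF x(1) y(2)] .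
    have nx: "norm x \<le> R + 1" using x(2) y norm_triangle_sub[of x y] by simp
    then have nxR: "norm x \<le> R'" using R by (simp add: R'_def)
    have nzx: "norm (z - x) \<le> R' - 1" using nx z norm_triangle_ineq4[of z x] by (simp add: R'_def)
    let ?S = "cball (z - x) 1"
    define \<rho> where "\<rho> w = G w x - x - \<pi> w" for w
    \<comment> \<open>Values of \<Xi> lie in the range of \<pi>, so a fixed point satisfies
      \<open>\<pi> w = w\<close>. The equation w + \<pi> (\<rho> w) = z - x then says that the
      perturbed shift from \<open>x\<close> ends exactly at \<open>z\<close>. The choice of
      \<epsilon> makes the contraction factor 1/2.\<close>
    define \<Xi> where "\<Xi> w = z - x - \<pi> (\<rho> w)" for w
    have S: "norm w \<le> R'" if "w \<in> ?S" for w
    proof -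
      have "norm (w - (z - x)) \<le> 1" using that by (simp add: dist_norm norm_minus_commute)
      then show ?thesis using nzx norm_triangle_sub[of w "z - x"] by simp
    qed
    have "\<exists>!w\<in>?S. \<Xi> w = w"
    proof (rule Banach_fix[where c = "1/2"])
      show "\<Xi> ` ?S \<subseteq> ?S"
      proof (rule image_subsetI)
        fix w assume "w \<in> ?S"
        then have "norm (\<rho> w) \<le> \<epsilon>" using near_shiftD1[OF G(3) S nxR] by (simp add: \<rho>_def)
        then have "norm (\<pi> (\<rho> w)) \<le> \<epsilon> * P" using P by (intro order_trans[OF P(2)] mult_right_mono) auto
        then show "\<Xi> w \<in> ?S" using \<epsilon> by (simp add: \<Xi>_def dist_norm mult.commute)
      qed
      show "dist (\<Xi> v) (\<Xi> w) \<le> 1/2 * dist v w" if "v \<in> ?S" "w \<in> ?S" for v w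
      proof -
        have "norm (\<rho> v - \<rho> w) \<le> \<epsilon> * (norm (v - w) + norm (x - x))"
          unfolding \<rho>_def using near_shiftD2[OF G(3) S[OF that(1)] nxR S[OF that(2)] nxR] .
        then have "norm (\<pi> (\<rho> v - \<rho> w)) \<le> \<epsilon> * norm (v - w) * P"
          using P by (intro order_trans[OF P(2)] mult_right_mono) auto
        also have "\<dots> = 1/2 * norm (v - w)" using \<epsilon> by (metis mult.assoc mult.commute)
        finally show ?thesis by (simp add: \<Xi>_def dist_norm \<pi>.diff norm_minus_commute)
      qed
    qed (auto simp: complete_eq_closed)
    then obtain w where w: "w \<in> ?S" "\<Xi> w = w" by blast
    have r: "reach T' x (G w x)" using G(4)[OF S[OF w(1)] nxR] .
    have "\<pi> w = w"
    proof -
      have "\<pi> (\<Xi> w) = \<Xi> w" by (simp add: \<Xi>_def \<pi>.diff \<pi>\<pi> \<pi>x z)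
      then show ?thesis using w by simp
    qed
    have "G w x = \<pi> (G w x)" using reach_invariant[OF r \<pi>x] by simp
    also have "G w x = x + \<pi> w + \<rho> w" by (simp add: \<rho>_def)
    also have "\<pi> (x + \<pi> w + \<rho> w) = x + w + \<pi> (\<rho> w)" by (simp add: \<pi>.add \<pi>\<pi> \<pi>x \<open>\<pi> w = w\<close>)
    also have "\<dots> = z" using w(2) by (simp add: \<Xi>_def algebra_simps)
    finally have "G w x = z" by (simp add: \<rho>_def)
    then show "reach T y z" using reach_trans[OF x(1) r] by simp
  qed
qed

lemma exact_controllability:
  assumes impulsive: "impulsive \<pi>" and t: "0 < t" and yz: "\<pi> y = y" "\<pi> z = z"
  shows "reach t y z"
proof -
  define R where "R = norm y + norm z"
  have "0 \<le> R" by (simp add: R_def)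
  then obtain \<tau> where \<tau>: "0 < \<tau>" and small: "\<And>T y z. 0 < T \<Longrightarrow> T \<le> \<tau> \<Longrightarrow> norm y \<le> R \<Longrightarrow> norm z \<le> R \<Longrightarrow>
     \<pi> y = y \<Longrightarrow> \<pi> z = z \<Longrightarrow> reach T y z"
    using exact_small_time[OF impulsive] by metis
  obtain n :: nat where n: "t / \<tau> < real n" using reals_Archimedean2 by blast
  \<comment> \<open>There are n + 2 legs: n + 1 ending at the origin and a last one to
    \<open>z\<close>. All their endpoints lie in the ball of radius \<open>R\<close>, so the same
    \<tau> serves every leg.\<close>
  define T where "T = t / real (n + 2)"
  have T: "0 < T" "T \<le> \<tau>"
  proof -
    show "0 < T" using t by (simp add: T_def)
    have "t \<le> \<tau> * real n" using n \<tau> by (simp add: field_simps)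
    also have "\<dots> \<le> \<tau> * real (n + 2)" using \<tau> by (intro mult_left_mono) auto
    finally show "T \<le> \<tau>" unfolding T_def by (simp add: divide_le_eq)
  qed
  have \<pi>0: "\<pi> 0 = 0" using bounded_linear.linear[OF \<pi>] linear_0 by blast
  have "reach (real (k + 1) * T) y 0" for k
  proof (induction k)
    case 0
    show ?case using small[OF T, of y 0] yz \<pi>0 \<open>0 \<le> R\<close> by (simp add: R_def)
  next
    case (Suc k)
    have "reach (real (k + 1) * T + T) y 0"
      by (rule reach_trans[OF Suc small[OF T]]) (use \<pi>0 \<open>0 \<le> R\<close> in auto)
    then show ?case by (simp add: algebra_simps)
  qed
  from reach_trans[OF this[of n] small[OF T, of 0 z]]
  have "reach (real (n + 1) * T + T) y z" using yz \<pi>0 \<open>0 \<le> R\<close> by (simp add: R_def)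
  moreover have "real (n + 1) * T + T = real (n + 2) * T" by (simp add: algebra_simps)
  ultimately show ?thesis by (simp add: T_def)
qed

end

section \<open>Gluing flows into one bounded measurable control\<close>

context quadratic_control
begin

lemma reach_realize:
  assumes "reach T u w"
  shows "\<exists>v x. (\<forall>r. v r \<in> E) \<and> v \<in> borel_measurable borel \<and> bounded (range v) \<and>
    continuous_on {0..T} x \<and> x 0 = u \<and> x T = w \<and>
    (\<forall>s\<in>{0..T}. ((\<lambda>q. field (x q) + v q) has_integral (x s - u)) {0..s})"
  using assms
proof (induction rule: reach.induct)
  case (reach_flow T c u w)
  then obtain x where x: "continuous_on {0..T} x" "x T = w"
     "\<And>r. r\<in>{0..T} \<Longrightarrow> ((\<lambda>q. field (x q) + c) has_integral (x r - u)) {0..r}"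
    by (auto simp: flow_def)
  have "x 0 = u" using has_integral_unique[OF x(3)[of 0], of 0] reach_flow(1) by auto
  then show ?case using x reach_flow(2) by (intro exI[of _ "\<lambda>_. c"] exI[of _ x]) auto
next
  case (reach_trans S u w T z)
  obtain v1 x1 where 1: "\<And>r. v1 r \<in> E" "v1 \<in> borel_measurable borel" "bounded (range v1)"
    "continuous_on {0..S} x1" "x1 0 = u" "x1 S = w"
    "\<And>s. s\<in>{0..S} \<Longrightarrow> ((\<lambda>q. field (x1 q) + v1 q) has_integral (x1 s - u)) {0..s}"
    using reach_trans.IH(1) by blast
  obtain v2 x2 where 2: "\<And>r. v2 r \<in> E" "v2 \<in> borel_measurable borel" "bounded (range v2)"
    "continuous_on {0..T} x2" "x2 0 = w" "x2 T = z"
    "\<And>s. s\<in>{0..T} \<Longrightarrow> ((\<lambda>q. field (x2 q) + v2 q) has_integral (x2 s - w)) {0..s}"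
    using reach_trans.IH(2) by blast
  have ST: "0 \<le> S" "0 \<le> T" using reach_trans.hyps reach_nonneg by auto
  define v where "v = (\<lambda>r. if r \<le> S then v1 r else v2 (r - S))"
  define x where "x = (\<lambda>r. if r \<le> S then x1 r else x2 (r - S))"
  have "v \<in> borel_measurable borel"
    unfolding v_def using 1(2) 2(2) by measurable
  moreover have "bounded (range v)"
    by (rule bounded_subset[OF bounded_Un[THEN iffD2, OF conjI[OF 1(3) 2(3)]]]) (auto simp: v_def)
  moreover have "continuous_on {0..S + T} x"
  proof -
    have "continuous_on ({0..S} \<union> {S..S + T}) x"
      unfolding x_def
    proof (rule continuous_on_If)
      show "continuous_on {S..S + T} (\<lambda>r. x2 (r - S))"
        by (rule continuous_on_compose2[OF 2(4)]) (auto intro!: continuous_intros)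
    qed (use 1 2 ST in auto)
    then show ?thesis using ST by (simp add: ivl_disj_un_two_touch)
  qed
  moreover have "x 0 = u" "x (S + T) = z" using 1 2 ST by (auto simp: x_def)
  moreover have "((\<lambda>q. field (x q) + v q) has_integral (x s - u)) {0..s}" if s: "s \<in> {0..S + T}" for s
  proof (cases "s \<le> S")
    case True
    have "((\<lambda>q. field (x q) + v q) has_integral (x1 s - u)) {0..s}"
      by (rule has_integral_eq[OF _ 1(7)]) (use True s in \<open>auto simp: x_def v_def\<close>)
    then show ?thesis using True by (simp add: x_def)
  next
    case False
    have "((\<lambda>q. field (x q) + v q) has_integral (x1 S - u)) {0..S}"
      by (rule has_integral_eq[OF _ 1(7)]) (use ST in \<open>auto simp: x_def v_def\<close>)
    moreover have "((\<lambda>q. field (x q) + v q) has_integral (x2 (s - S) - w)) {S..s}"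
    \<comment> \<open>At the time \<open>S\<close> the glued control takes the value of the first
      piece, which may differ from \<open>v2 0\<close>; this single point is discarded.\<close>
    proof (rule has_integral_spike_finite[of "{S}"])
      have "((\<lambda>q. field (x2 (q - S)) + v2 (q - S)) has_integral (x2 (s - S) - w)) {0 + S..s - S + S}"
        using 2(7)[of "s - S"] False s
        by (subst has_integral_shift_Icc_real[symmetric]) (simp add: o_def)
      then show "((\<lambda>q. field (x2 (q - S)) + v2 (q - S)) has_integral (x2 (s - S) - w)) {S..s}" by simp
    qed (auto simp: x_def v_def)
    ultimately have "((\<lambda>q. field (x q) + v q) has_integral (x1 S - u + (x2 (s - S) - w))) {0..s}"
      using False ST by (intro has_integral_combine[of 0 S s]) auto
    then show ?thesis using False 1(6) by (simp add: x_def)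
  qed
  ultimately show ?case using 1(1) 2(1)
    by (intro exI[of _ v] exI[of _ x]) (auto simp: v_def)
qed

end

section \<open>Interaction of the modes on the rectangle\<close>

lemma L2_inner_eq_integral:
  assumes c: "continuous_on UNIV (\<lambda>x. u x \<bullet> w x)"
  shows "L2_inner a b u w = integral (cbox (0, 0) (a, b)) (\<lambda>x. u x \<bullet> w x)"
proof -
  have r: "rect a b = box (0, 0) (a, b)" by (simp add: rect_def box_prod)
  have "(\<lambda>x. u x \<bullet> w x) absolutely_integrable_on cbox (0, 0) (a, b)"
    by (rule absolutely_integrable_continuous) (rule continuous_on_subset[OF c], simp)
  then have "(\<lambda>x. u x \<bullet> w x) absolutely_integrable_on rect a b"
    unfolding r by (rule set_integrable_subset) (auto simp: box_subset_cbox)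
  then have "integrable (lebesgue_on (rect a b)) (\<lambda>x. u x \<bullet> w x)"
    by (simp add: integrable_restrict_space set_integrable_def r)
  then have "L2_inner a b u w = integral (rect a b) (\<lambda>x. u x \<bullet> w x)"
    unfolding L2_inner_def by (rule lebesgue_integral_eq_integral) (simp add: r)
  then show ?thesis by (simp add: r integral_open_interval)
qed

lemma integral_rect_iterated:
  fixes f :: "real \<times> real \<Rightarrow> real"
  assumes "continuous_on UNIV f"
  shows "integral (cbox (0, 0) (a, b)) f = integral {0..a} (\<lambda>x. integral {0..b} (\<lambda>y. f (x, y)))"
    and "integral (cbox (0, 0) (a, b)) f = integral {0..b} (\<lambda>y. integral {0..a} (\<lambda>x. f (x, y)))"
proof -
  have c: "continuous_on (cbox (0, 0) (a, b)) f" by (rule continuous_on_subset[OF assms]) simp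
  show 1: "integral (cbox (0, 0) (a, b)) f = integral {0..a} (\<lambda>x. integral {0..b} (\<lambda>y. f (x, y)))"
    using integral_prod_continuous[OF c] by simp
  show "integral (cbox (0, 0) (a, b)) f = integral {0..b} (\<lambda>y. integral {0..a} (\<lambda>x. f (x, y)))"
    using integral_swap_continuous[of 0 0 a b "\<lambda>x y. f (x, y)"] c 1 by simp
qed

lemma integral_rect_prod:
  fixes f g :: "real \<Rightarrow> real"
  assumes "continuous_on UNIV f" "continuous_on UNIV g"
  shows "integral (cbox (0, 0) (a, b)) (\<lambda>x. f (fst x) * g (snd x)) = integral {0..a} f * integral {0..b} g"
proof -
  have "continuous_on UNIV (\<lambda>x :: real \<times> real. f (fst x) * g (snd x))"
    by (intro continuous_intros continuous_on_compose2[OF assms(1)] continuous_on_compose2[OF assms(2)]) auto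
  from integral_rect_iterated(1)[OF this, of a b] show ?thesis by (simp add: integral_mult_left)
qed

lemma continuous_on_eq_integrable_rect:
  fixes f :: "real \<times> real \<Rightarrow> real"
  assumes "continuous_on UNIV f" shows "f integrable_on cbox (0, 0) (a, b)"
  by (rule integrable_continuous) (rule continuous_on_subset[OF assms], simp)

text \<open>Integrating in the first variable first leaves boundary values, which vanish. Together
  with its companion for the second variable this gives the integration by parts in
  \<open>green\<close>.\<close>

lemma integral_rect_partial_fst:
  fixes f :: "real \<times> real \<Rightarrow> real"
  assumes "continuous_on UNIV f'" "\<And>x y. ((\<lambda>x. f (x, y)) has_real_derivative f' (x, y)) (at x)"
    and "\<And>y. f (0, y) = 0" "\<And>y. f (a, y) = 0" "0 \<le> a"
  shows "integral (cbox (0, 0) (a, b)) f' = 0"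
proof -
  have "integral {0..a} (\<lambda>x. f' (x, y)) = f (a, y) - f (0, y)" for y
    by (rule integral_unique, rule fundamental_theorem_of_calculus)
       (use assms in \<open>auto simp: has_real_derivative_iff_has_vector_derivative[symmetric] intro: has_field_derivative_at_within\<close>)
  then show ?thesis using assms by (simp add: integral_rect_iterated(2))
qed

lemma integral_rect_partial_snd:
  fixes f :: "real \<times> real \<Rightarrow> real"
  assumes "continuous_on UNIV f'" "\<And>x y. ((\<lambda>y. f (x, y)) has_real_derivative f' (x, y)) (at y)"
    and "\<And>x. f (x, 0) = 0" "\<And>x. f (x, b) = 0" "0 \<le> b"
  shows "integral (cbox (0, 0) (a, b)) f' = 0"
proof -
  have "integral {0..b} (\<lambda>y. f' (x, y)) = f (x, b) - f (x, 0)" for x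
    by (rule integral_unique, rule fundamental_theorem_of_calculus)
       (use assms in \<open>auto simp: has_real_derivative_iff_has_vector_derivative[symmetric] intro: has_field_derivative_at_within\<close>)
  then show ?thesis using assms by (simp add: integral_rect_iterated(1))
qed

section \<open>Stream functions and the symmetrised nonlinearity\<close>

locale rectangle =
  fixes a b :: real
  assumes a: "0 < a" and b: "0 < b"
begin

definition \<alpha> :: "nat \<times> nat \<Rightarrow> real" where "\<alpha> k = real (fst k) * pi / a"
definition \<beta> :: "nat \<times> nat \<Rightarrow> real" where "\<beta> k = real (snd k) * pi / b"

text \<open>The stream functions: \<open>W\<close> is (- d2 \<psi>, d1 \<psi>). Indices are integers
  because products of modes produce differences of indices; \<psi> is odd in each of them.\<close>

definition \<psi> :: "int \<Rightarrow> int \<Rightarrow> real \<times> real \<Rightarrow> real" where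
  "\<psi> i j x = sin (of_int i * pi / a * fst x) * sin (of_int j * pi / b * snd x)"

abbreviation \<psi>n :: "nat \<times> nat \<Rightarrow> real \<times> real \<Rightarrow> real" where
  "\<psi>n k \<equiv> \<psi> (int (fst k)) (int (snd k))"

lemma \<psi>n_eq: "\<psi>n k x = sin (\<alpha> k * fst x) * sin (\<beta> k * snd x)"
  by (simp add: \<psi>_def \<alpha>_def \<beta>_def)

lemma W_eq: "W a b k x = (- \<beta> k * sin (\<alpha> k * fst x) * cos (\<beta> k * snd x), \<alpha> k * cos (\<alpha> k * fst x) * sin (\<beta> k * snd x))"
  by (simp add: W_def \<alpha>_def \<beta>_def)

lemma kbar_eq: "kbar a b k = - ((\<alpha> k)\<^sup>2 + (\<beta> k)\<^sup>2)"
  by (simp add: kbar_def \<alpha>_def \<beta>_def power_divide power_mult_distrib algebra_simps)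

definition DW :: "nat \<times> nat \<Rightarrow> real \<times> real \<Rightarrow> real \<times> real \<Rightarrow> real \<times> real" where
  "DW k x h =
    (- \<beta> k * (\<alpha> k * cos (\<alpha> k * fst x) * cos (\<beta> k * snd x) * fst h - \<beta> k * sin (\<alpha> k * fst x) * sin (\<beta> k * snd x) * snd h),
     \<alpha> k * (\<beta> k * cos (\<alpha> k * fst x) * cos (\<beta> k * snd x) * snd h - \<alpha> k * sin (\<alpha> k * fst x) * sin (\<beta> k * snd x) * fst h))"

lemma W_has_derivative: "(W a b k has_derivative DW k x) (at x)"
  unfolding W_eq[abs_def] DW_def[abs_def]
  by (auto intro!: derivative_eq_intros simp: algebra_simps fun_eq_iff)

lemma DW_linear: "linear (DW k x)"
  using W_has_derivative has_derivative_linear by blast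

lemma continuous_W [continuous_intros]: "continuous_on S (W a b k)"
  unfolding W_eq[abs_def] by (intro continuous_intros)

definition trilinear :: "nat \<times> nat \<Rightarrow> nat \<times> nat \<Rightarrow> nat \<times> nat \<Rightarrow> real" where
  "trilinear m n k = integral (cbox (0, 0) (a, b)) (\<lambda>x. DW n x (W a b m x) \<bullet> W a b k x)"

lemma continuous_trilinear: "continuous_on UNIV (\<lambda>x. DW n x (W a b m x) \<bullet> W a b k x)"
  unfolding DW_def W_eq by (simp only: inner_Pair inner_real_def) (intro continuous_intros)

lemma convection_eq:
  "convection (velocity a b N u) x = (\<Sum>m\<in>modes N. \<Sum>n\<in>modes N. (u m * u n) *\<^sub>R DW n x (W a b m x))"
proof -
  have "(velocity a b N u has_derivative (\<lambda>h. \<Sum>n\<in>modes N. u n *\<^sub>R DW n x h)) (at x)"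
    unfolding velocity_def[abs_def]
    by (intro has_derivative_sum has_derivative_scaleR_right W_has_derivative)
  from frechet_derivative_at[OF this, symmetric] 
  have "convection (velocity a b N u) x = (\<Sum>n\<in>modes N. u n *\<^sub>R DW n x (\<Sum>m\<in>modes N. u m *\<^sub>R W a b m x))"
    by (simp add: convection_def velocity_def)
  also have "\<dots> = (\<Sum>n\<in>modes N. \<Sum>m\<in>modes N. (u m * u n) *\<^sub>R DW n x (W a b m x))"
    by (simp add: linear_sum[OF DW_linear] linear_cmul[OF DW_linear] scaleR_sum_right mult.commute)
  finally show ?thesis by (subst sum.swap) 
qed

lemma finite_modes: "finite (modes N)" by (simp add: modes_def)

lemma B_eq: "\<B> a b N u k = - (\<Sum>m\<in>modes N. \<Sum>n\<in>modes N. u m * u n * trilinear m n k) / L2_inner a b (W a b k) (W a b k)"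
proof -
  let ?f = "\<lambda>m n x. (u m * u n) *\<^sub>R (DW n x (W a b m x) \<bullet> W a b k x)"
  have eq: "convection (velocity a b N u) x \<bullet> W a b k x = (\<Sum>m\<in>modes N. \<Sum>n\<in>modes N. ?f m n x)" for x
    by (simp add: convection_eq inner_sum_left)
  have c: "continuous_on UNIV (?f m n)" for m n by (intro continuous_intros continuous_trilinear)
  have i: "?f m n integrable_on cbox (0, 0) (a, b)" for m n
    by (rule continuous_on_eq_integrable_rect[OF c])
  have "L2_inner a b (convection (velocity a b N u)) (W a b k)
      = integral (cbox (0, 0) (a, b)) (\<lambda>x. \<Sum>m\<in>modes N. \<Sum>n\<in>modes N. ?f m n x)"
    by (subst L2_inner_eq_integral)
       (auto simp: eq intro!: continuous_on_sum continuous_on_mult continuous_on_const continuous_trilinear)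
  also have "\<dots> = (\<Sum>m\<in>modes N. \<Sum>n\<in>modes N. integral (cbox (0, 0) (a, b)) (?f m n))"
    by (simp only: integral_sum[OF finite_modes] integrable_sum[OF finite_modes] i)
  also have "\<dots> = (\<Sum>m\<in>modes N. \<Sum>n\<in>modes N. u m * u n * trilinear m n k)"
    by (simp add: trilinear_def)
  finally show ?thesis by (simp add: \<B>_def W_coord_def)
qed

text \<open>Green's formula: \<open>W\<^sub>k\<close> is the rotated gradient of \<open>\<psi>\<^sub>k\<close>, which vanishes on the boundary.\<close>

lemma green:
  fixes g1 g2 g1' g2' :: "real \<times> real \<Rightarrow> real"
  assumes d1: "\<And>x y. ((\<lambda>y. g1 (x, y)) has_real_derivative g1' (x, y)) (at y)"
    and d2: "\<And>x y. ((\<lambda>x. g2 (x, y)) has_real_derivative g2' (x, y)) (at x)"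
    and c: "continuous_on UNIV g1" "continuous_on UNIV g2" "continuous_on UNIV g1'" "continuous_on UNIV g2'"
  shows "integral (cbox (0, 0) (a, b)) (\<lambda>x. (g1 x, g2 x) \<bullet> W a b k x)
       = integral (cbox (0, 0) (a, b)) (\<lambda>x. (g1' x - g2' x) * \<psi>n k x)"
proof -
  let ?R = "cbox (0, 0) (a, b)"
  \<comment> \<open>\<open>p1\<close> is d2 of g1 \<psi> and \<open>p2\<close> is d1 of g2 \<psi>,
    so both integrate to zero; their difference is the difference of the two integrands in the
    claim.\<close>
  define p1 where "p1 x = g1' x * \<psi>n k x + g1 x * (\<beta> k * sin (\<alpha> k * fst x) * cos (\<beta> k * snd x))" for x
  define p2 where "p2 x = g2' x * \<psi>n k x + g2 x * (\<alpha> k * cos (\<alpha> k * fst x) * sin (\<beta> k * snd x))" for x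
  have cont: "continuous_on UNIV p1" "continuous_on UNIV p2"
    unfolding p1_def p2_def \<psi>n_eq by (intro continuous_intros c)+
  have ends: "sin (\<alpha> k * a) = 0" "sin (\<beta> k * b) = 0"
    using a b by (simp_all add: \<alpha>_def \<beta>_def mult.commute)
  have "integral ?R p1 = 0"
  proof (rule integral_rect_partial_snd[where f = "\<lambda>x. g1 x * \<psi>n k x"])
    show "((\<lambda>y. g1 (x, y) * \<psi>n k (x, y)) has_real_derivative p1 (x, y)) (at y)" for x y
      unfolding p1_def \<psi>n_eq by (auto intro!: derivative_eq_intros d1)
  qed (use cont b ends in \<open>auto simp: \<psi>n_eq\<close>)
  moreover have "integral ?R p2 = 0"
  proof (rule integral_rect_partial_fst[where f = "\<lambda>x. g2 x * \<psi>n k x"])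
    show "((\<lambda>x. g2 (x, y) * \<psi>n k (x, y)) has_real_derivative p2 (x, y)) (at x)" for x y
      unfolding p2_def \<psi>n_eq by (auto intro!: derivative_eq_intros d2)
  qed (use cont a ends in \<open>auto simp: \<psi>n_eq\<close>)
  moreover have "integral ?R (\<lambda>x. (g1' x - g2' x) * \<psi>n k x) - integral ?R (\<lambda>x. (g1 x, g2 x) \<bullet> W a b k x)
      = integral ?R (\<lambda>x. (g1' x - g2' x) * \<psi>n k x - (g1 x, g2 x) \<bullet> W a b k x)"
  proof (rule Henstock_Kurzweil_Integration.integral_diff[symmetric]; rule continuous_on_eq_integrable_rect)
    show "continuous_on UNIV (\<lambda>x. (g1' x - g2' x) * \<psi>n k x)"
      unfolding \<psi>_def by (intro continuous_intros c)
    show "continuous_on UNIV (\<lambda>x. (g1 x, g2 x) \<bullet> W a b k x)"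
      by (intro continuous_intros c)
  qed
  moreover have "(\<lambda>x. (g1' x - g2' x) * \<psi>n k x - (g1 x, g2 x) \<bullet> W a b k x) = (\<lambda>x. p1 x - p2 x)"
    by (auto simp: fun_eq_iff p1_def p2_def W_eq algebra_simps)
  moreover have "integral ?R (\<lambda>x. p1 x - p2 x) = integral ?R p1 - integral ?R p2"
    by (rule Henstock_Kurzweil_Integration.integral_diff; rule continuous_on_eq_integrable_rect; rule cont)
  ultimately show ?thesis by simp
qed

text \<open>The Jacobian d1 \<psi>m d2 \<psi>n - d2 \<psi>m d1 \<psi>n of two stream
  functions.\<close>

definition jac :: "nat \<times> nat \<Rightarrow> nat \<times> nat \<Rightarrow> real \<times> real \<Rightarrow> real" where
  "jac m n x = \<alpha> m * \<beta> n * (cos (\<alpha> m * fst x) * sin (\<alpha> n * fst x)) * (sin (\<beta> m * snd x) * cos (\<beta> n * snd x))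
     - \<beta> m * \<alpha> n * (sin (\<alpha> m * fst x) * cos (\<alpha> n * fst x)) * (cos (\<beta> m * snd x) * sin (\<beta> n * snd x))"

text \<open>The curl of (U . grad) U is the Jacobian of the stream function and its Laplacian.
  Polarising, with each mode an eigenfunction of the Laplacian, gives (kbar n - kbar m) times the
  Jacobian of the two modes by antisymmetry; \<open>green\<close> reverses the sign.\<close>

lemma trilinear_sym:
  "trilinear m n k + trilinear n m k
     = (kbar a b m - kbar a b n) * integral (cbox (0, 0) (a, b)) (\<lambda>x. jac m n x * \<psi>n k x)"
proof -
  let ?R = "cbox (0, 0) (a, b)"
  define sm where "sm x = sin (\<alpha> m * fst x)" for x :: "real \<times> real"
  define cm where "cm x = cos (\<alpha> m * fst x)" for x :: "real \<times> real"
  define sn where "sn x = sin (\<alpha> n * fst x)" for x :: "real \<times> real"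
  define cn where "cn x = cos (\<alpha> n * fst x)" for x :: "real \<times> real"
  define Sm where "Sm x = sin (\<beta> m * snd x)" for x :: "real \<times> real"
  define Cm where "Cm x = cos (\<beta> m * snd x)" for x :: "real \<times> real"
  define Sn where "Sn x = sin (\<beta> n * snd x)" for x :: "real \<times> real"
  define Cn where "Cn x = cos (\<beta> n * snd x)" for x :: "real \<times> real"
  note defs = sm_def cm_def sn_def cn_def Sm_def Cm_def Sn_def Cn_def
  define p where "p = \<alpha> m"
  define q where "q = \<beta> m"
  define r where "r = \<alpha> n"
  define s where "s = \<beta> n"
  note pq = p_def q_def r_def s_def
  define g1 where "g1 x = s * r * q * (cn x * Cn x * sm x * Cm x) + s * s * p * (sn x * Sn x * cm x * Sm x)
     + (q * p * s * (cm x * Cm x * sn x * Cn x) + q * q * r * (sm x * Sm x * cn x * Sn x))" for x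
  define g2 where "g2 x = r * s * p * (cn x * Cn x * cm x * Sm x) + r * r * q * (sn x * Sn x * sm x * Cm x)
     + (p * q * r * (cm x * Cm x * cn x * Sn x) + p * p * s * (sm x * Sm x * sn x * Cn x))" for x
  define g1' where "g1' x = s * r * q * (cn x * sm x * (- s * Sn x * Cm x - q * Cn x * Sm x))
       + s * s * p * (sn x * cm x * (s * Cn x * Sm x + q * Sn x * Cm x))
     + (q * p * s * (cm x * sn x * (- s * Sn x * Cm x - q * Cn x * Sm x))
       + q * q * r * (sm x * cn x * (s * Cn x * Sm x + q * Sn x * Cm x)))" for x
  define g2' where "g2' x = r * s * p * (Cn x * Sm x * (- r * sn x * cm x - p * cn x * sm x))
       + r * r * q * (Sn x * Cm x * (r * cn x * sm x + p * sn x * cm x))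
     + (p * q * r * (Cm x * Sn x * (- r * sn x * cm x - p * cn x * sm x))
       + p * p * s * (Sm x * Cn x * (r * cn x * sm x + p * sn x * cm x)))" for x
  have eq: "DW n x (W a b m x) \<bullet> W a b k x + DW m x (W a b n x) \<bullet> W a b k x = (g1 x, g2 x) \<bullet> W a b k x" for x
  proof -
    have "DW n x (W a b m x) + DW m x (W a b n x) = (g1 x, g2 x)"
      unfolding DW_def W_eq g1_def g2_def defs pq fst_conv snd_conv add_Pair prod.inject
      by (intro conjI; algebra)
    then show ?thesis by (simp add: inner_add_left[symmetric])
  qed
  \<comment> \<open>With sines and cosines as independent atoms this is a polynomial identity; no
    trigonometric relation enters.\<close>
  have curl: "g1' x - g2' x = (kbar a b m - kbar a b n) * jac m n x" for x
    unfolding g1'_def g2'_def jac_def kbar_eq defs pq by algebra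
  have c: "continuous_on UNIV g1" "continuous_on UNIV g2" "continuous_on UNIV g1'" "continuous_on UNIV g2'"
    unfolding g1_def g2_def g1'_def g2'_def defs by (intro continuous_intros)+
  have "trilinear m n k + trilinear n m k = integral ?R (\<lambda>x. (g1 x, g2 x) \<bullet> W a b k x)"
    unfolding trilinear_def eq[symmetric]
    by (rule Henstock_Kurzweil_Integration.integral_add[symmetric]; rule continuous_on_eq_integrable_rect; rule continuous_trilinear)
  also have "\<dots> = integral ?R (\<lambda>x. (g1' x - g2' x) * \<psi>n k x)"
  proof (rule green[OF _ _ c])
    show "((\<lambda>y. g1 (x, y)) has_real_derivative g1' (x, y)) (at y)" for x y
      unfolding g1_def g1'_def defs fst_conv snd_conv pq
      by (rule derivative_eq_intros refl | algebra)+
    show "((\<lambda>x. g2 (x, y)) has_real_derivative g2' (x, y)) (at x)" for x y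
      unfolding g2_def g2'_def defs fst_conv snd_conv pq
      by (rule derivative_eq_intros refl | algebra)+
  qed
  also have "\<dots> = (kbar a b m - kbar a b n) * integral ?R (\<lambda>x. jac m n x * \<psi>n k x)"
    unfolding curl by (simp add: mult.assoc)
  finally show ?thesis .
qed

end

section \<open>Fourier coefficients of the interaction\<close>

lemma integral_cos_multiple:
  fixes a :: real and q :: int
  assumes "0 < a"
  shows "integral {0..a} (\<lambda>x. cos (of_int q * pi / a * x)) = (if q = 0 then a else 0)"
proof (cases "q = 0")
  case False
  let ?w = "of_int q * pi / a"
  have w: "?w \<noteq> 0" using False assms by simp
  have "((\<lambda>x. cos (?w * x)) has_integral (sin (?w * a) / ?w - sin (?w * 0) / ?w)) {0..a}"
  proof (rule fundamental_theorem_of_calculus)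
    show "((\<lambda>x. sin (?w * x) / ?w) has_vector_derivative cos (?w * x)) (at x within {0..a})" for x
      unfolding has_real_derivative_iff_has_vector_derivative[symmetric]
      using w by (auto intro!: derivative_eq_intros)
  qed (use assms in simp)
  moreover have "sin (?w * a) = 0" using assms by (simp add: sin_int_times_real mult.commute)
  ultimately show ?thesis using False by (simp add: integral_unique)
qed (use assms in simp)

text \<open>Coefficients from the product-to-sum formulas: the two terms of the Jacobian subtract to
  \<open>wedge\<close> when both indices are added or both subtracted, and add up to
  \<open>vee\<close> in the mixed cases.\<close>

definition wedge :: "nat \<times> nat \<Rightarrow> nat \<times> nat \<Rightarrow> real" where
  "wedge m n = real (fst m) * real (snd n) - real (snd m) * real (fst n)"
definition vee :: "nat \<times> nat \<Rightarrow> nat \<times> nat \<Rightarrow> real" where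
  "vee m n = real (fst m) * real (snd n) + real (snd m) * real (fst n)"

text \<open>The Jacobian of two products of sines, with \<open>f i j\<close> in place of \<open>sin (i x) sin (j y)\<close>.\<close>

definition interaction :: "(int \<Rightarrow> int \<Rightarrow> 'b::real_vector) \<Rightarrow> nat \<times> nat \<Rightarrow> nat \<times> nat \<Rightarrow> 'b" where
  "interaction f m n =
     wedge m n *\<^sub>R (f (int (fst m) + int (fst n)) (int (snd m) + int (snd n)) - f (int (fst m) - int (fst n)) (int (snd m) - int (snd n)))
   + vee m n *\<^sub>R (f (int (fst m) + int (fst n)) (int (snd m) - int (snd n)) - f (int (fst m) - int (fst n)) (int (snd m) + int (snd n)))"

text \<open>The pairing of \<open>sin (i \<cdot>)\<close> with \<open>sin (p \<cdot>)\<close>, normalised; meaningful for \<open>p \<ge> 1\<close> only.\<close>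

definition odd_delta :: "int \<Rightarrow> nat \<Rightarrow> real" where
  "odd_delta i p = (if i = int p then 1 else if i = - int p then -1 else 0)"

lemma integral_sin_sin:
  fixes a :: real
  assumes "0 < a" "1 \<le> p"
  shows "integral {0..a} (\<lambda>x. sin (of_int i * pi / a * x) * sin (of_int (int p) * pi / a * x)) = a / 2 * odd_delta i p"
proof -
  have "(\<lambda>x. sin (of_int i * pi / a * x) * sin (of_int (int p) * pi / a * x))
     = (\<lambda>x. (1/2) * cos (of_int (i - int p) * pi / a * x) - (1/2) * cos (of_int (i + int p) * pi / a * x))"
    by (simp add: fun_eq_iff sin_times_sin algebra_simps diff_divide_distrib add_divide_distrib)
  moreover have "integral {0..a} (\<lambda>x. (1/2) * cos (of_int (i - int p) * pi / a * x) - (1/2) * cos (of_int (i + int p) * pi / a * x))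
     = (1/2) * integral {0..a} (\<lambda>x. cos (of_int (i - int p) * pi / a * x)) - (1/2) * integral {0..a} (\<lambda>x. cos (of_int (i + int p) * pi / a * x))"
    by (subst Henstock_Kurzweil_Integration.integral_diff)
       (use assms(1) in \<open>auto intro!: integrable_continuous_real continuous_intros simp del: of_int_diff of_int_add\<close>)
  ultimately show ?thesis
    by (simp only: integral_cos_multiple[OF assms(1)]) (use assms(2) in \<open>auto simp: odd_delta_def\<close>)
qed

context rectangle
begin

lemma integral_\<psi>:
  assumes "1 \<le> fst k" "1 \<le> snd k"
  shows "integral (cbox (0, 0) (a, b)) (\<lambda>x. \<psi> i j x * \<psi>n k x) = a * b / 4 * (odd_delta i (fst k) * odd_delta j (snd k))"
proof -
  let ?f = "\<lambda>x. sin (of_int i * pi / a * x) * sin (of_int (int (fst k)) * pi / a * x)"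
  let ?g = "\<lambda>x. sin (of_int j * pi / b * x) * sin (of_int (int (snd k)) * pi / b * x)"
  have "integral (cbox (0, 0) (a, b)) (\<lambda>x. ?f (fst x) * ?g (snd x)) = integral {0..a} ?f * integral {0..b} ?g"
    by (rule integral_rect_prod) (intro continuous_intros)+
  then show ?thesis unfolding integral_sin_sin[OF a assms(1)] integral_sin_sin[OF b assms(2)]
    by (simp add: \<psi>_def mult_ac)
qed

lemma jac_eq: "jac m n x = pi\<^sup>2 / (4 * a * b) * interaction (\<lambda>i j. \<psi> i j x) m n"
proof -
  define p where "p = \<alpha> m * fst x"
  define q where "q = \<beta> m * snd x"
  define r where "r = \<alpha> n * fst x"
  define s where "s = \<beta> n * snd x"
  have \<psi>: "\<psi> (int (fst m) + int (fst n)) (int (snd m) + int (snd n)) x = sin (p + r) * sin (q + s)"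
    "\<psi> (int (fst m) - int (fst n)) (int (snd m) - int (snd n)) x = sin (p - r) * sin (q - s)"
    "\<psi> (int (fst m) + int (fst n)) (int (snd m) - int (snd n)) x = sin (p + r) * sin (q - s)"
    "\<psi> (int (fst m) - int (fst n)) (int (snd m) + int (snd n)) x = sin (p - r) * sin (q + s)"
    by (simp_all add: \<psi>_def p_def q_def r_def s_def \<alpha>_def \<beta>_def algebra_simps add_divide_distrib diff_divide_distrib)
  have co: "\<alpha> m * \<beta> n = pi\<^sup>2 / (a * b) * (real (fst m) * real (snd n))"
    "\<beta> m * \<alpha> n = pi\<^sup>2 / (a * b) * (real (snd m) * real (fst n))"
    by (simp_all add: \<alpha>_def \<beta>_def power2_eq_square mult_ac)
  have "jac m n x = pi\<^sup>2 / (a * b) * (real (fst m) * real (snd n) * (cos p * sin r) * (sin q * cos s)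
     - real (snd m) * real (fst n) * (sin p * cos r) * (cos q * sin s))"
    unfolding jac_def co p_def q_def r_def s_def by (simp add: algebra_simps)
  also have "\<dots> = pi\<^sup>2 / (4 * a * b) * (4 * (real (fst m) * real (snd n) * (cos p * sin r) * (sin q * cos s)
     - real (snd m) * real (fst n) * (sin p * cos r) * (cos q * sin s)))"
    using a b by (simp add: field_simps)
  also have "4 * (real (fst m) * real (snd n) * (cos p * sin r) * (sin q * cos s)
     - real (snd m) * real (fst n) * (sin p * cos r) * (cos q * sin s)) = interaction (\<lambda>i j. \<psi> i j x) m n"
    unfolding interaction_def \<psi> wedge_def vee_def sin_add sin_diff real_scaleR_def by algebra
  finally show ?thesis .
qed

lemma integral_jac:
  assumes "1 \<le> fst k" "1 \<le> snd k"
  shows "integral (cbox (0, 0) (a, b)) (\<lambda>x. jac m n x * \<psi>n k x)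
     = pi\<^sup>2 / 16 * interaction (\<lambda>i j. odd_delta i (fst k) * odd_delta j (snd k)) m n"
proof -
  have i: "(\<lambda>x. c * (\<psi> i j x * \<psi>n k x)) integrable_on cbox (0, 0) (a, b)" for c i j
    by (rule continuous_on_eq_integrable_rect) (unfold \<psi>_def, intro continuous_intros)
  have int: "integral (cbox (0, 0) (a, b)) (\<lambda>x. c * (\<psi> i j x * \<psi>n k x)) = c * (a * b / 4 * (odd_delta i (fst k) * odd_delta j (snd k)))" for c i j
    by (simp add: integral_\<psi>[OF assms])
  let ?c = "pi\<^sup>2 / (4 * a * b)"
  let ?t = "\<lambda>c i j x. (c * (\<psi> i j x * \<psi>n k x)) :: real"
  let ?m1 = "int (fst m)" and ?m2 = "int (snd m)" and ?n1 = "int (fst n)" and ?n2 = "int (snd n)"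
  have "(\<lambda>x. jac m n x * \<psi>n k x) = (\<lambda>x. (?t (?c * wedge m n) (?m1 + ?n1) (?m2 + ?n2) x - ?t (?c * wedge m n) (?m1 - ?n1) (?m2 - ?n2) x)
     + (?t (?c * vee m n) (?m1 + ?n1) (?m2 - ?n2) x - ?t (?c * vee m n) (?m1 - ?n1) (?m2 + ?n2) x))"
    by (simp add: jac_eq interaction_def fun_eq_iff algebra_simps)
  then have "integral (cbox (0, 0) (a, b)) (\<lambda>x. jac m n x * \<psi>n k x)
     = ((?c * wedge m n) * (a * b / 4 * (odd_delta (?m1 + ?n1) (fst k) * odd_delta (?m2 + ?n2) (snd k)))
       - (?c * wedge m n) * (a * b / 4 * (odd_delta (?m1 - ?n1) (fst k) * odd_delta (?m2 - ?n2) (snd k))))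
     + ((?c * vee m n) * (a * b / 4 * (odd_delta (?m1 + ?n1) (fst k) * odd_delta (?m2 - ?n2) (snd k)))
       - (?c * vee m n) * (a * b / 4 * (odd_delta (?m1 - ?n1) (fst k) * odd_delta (?m2 + ?n2) (snd k))))"
    by (simp only: Henstock_Kurzweil_Integration.integral_add Henstock_Kurzweil_Integration.integral_diff
        integrable_diff i int)
  also have "\<dots> = (?c * (a * b / 4)) * interaction (\<lambda>i j. odd_delta i (fst k) * odd_delta j (snd k)) m n"
    by (simp add: interaction_def algebra_simps)
  also have "?c * (a * b / 4) = pi\<^sup>2 / 16" using a b by simp
  finally show ?thesis .
qed

text \<open>This is \<open>green\<close> with \<open>W\<close> itself as the field, whose negative
  curl is - kbar times the stream function.\<close>

lemma L2_norm_W: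
  assumes "1 \<le> fst k" "1 \<le> snd k"
  shows "L2_inner a b (W a b k) (W a b k) = - kbar a b k * (a * b / 4)"
proof -
  let ?g1 = "\<lambda>x. - \<beta> k * sin (\<alpha> k * fst x) * cos (\<beta> k * snd x)"
  let ?g2 = "\<lambda>x. \<alpha> k * cos (\<alpha> k * fst x) * sin (\<beta> k * snd x)"
  let ?g1' = "\<lambda>x. \<beta> k * \<beta> k * sin (\<alpha> k * fst x) * sin (\<beta> k * snd x)"
  let ?g2' = "\<lambda>x. - \<alpha> k * \<alpha> k * sin (\<alpha> k * fst x) * sin (\<beta> k * snd x)"
  have "L2_inner a b (W a b k) (W a b k) = integral (cbox (0, 0) (a, b)) (\<lambda>x. W a b k x \<bullet> W a b k x)"
    by (rule L2_inner_eq_integral) (intro continuous_intros)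
  also have "\<dots> = integral (cbox (0, 0) (a, b)) (\<lambda>x. (?g1 x, ?g2 x) \<bullet> W a b k x)" by (simp add: W_eq)
  also have "\<dots> = integral (cbox (0, 0) (a, b)) (\<lambda>x. (?g1' x - ?g2' x) * \<psi>n k x)"
  proof (rule green)
    show "((\<lambda>y. ?g1 (x, y)) has_real_derivative ?g1' (x, y)) (at y)" for x y
      by (auto intro!: derivative_eq_intros)
    show "((\<lambda>x. ?g2 (x, y)) has_real_derivative ?g2' (x, y)) (at x)" for x y
      by (auto intro!: derivative_eq_intros)
  qed (intro continuous_intros)+
  also have "\<dots> = integral (cbox (0, 0) (a, b)) (\<lambda>x. - kbar a b k * (\<psi>n k x * \<psi>n k x))"
    by (simp add: \<psi>n_eq kbar_eq algebra_simps power2_eq_square)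
  also have "\<dots> = - kbar a b k * (a * b / 4 * (odd_delta (int (fst k)) (fst k) * odd_delta (int (snd k)) (snd k)))"
    by (simp only: integral_mult_right integral_\<psi>[OF assms])
  finally show ?thesis by (simp add: odd_delta_def)
qed

lemma kbar_neg: "1 \<le> fst k \<Longrightarrow> kbar a b k < 0"
  using a by (simp add: kbar_def add_pos_nonneg)

definition Bcoef :: "nat \<times> nat \<Rightarrow> nat \<times> nat \<Rightarrow> nat \<times> nat \<Rightarrow> real" where
  "Bcoef m n k = - trilinear m n k / L2_inner a b (W a b k) (W a b k)"

lemma B_eq_Bcoef: "\<B> a b N u k = (\<Sum>m\<in>modes N. \<Sum>n\<in>modes N. u m * u n * Bcoef m n k)"
  by (simp add: B_eq Bcoef_def sum_divide_distrib sum_negf)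

text \<open>The only dependence of the squared norm of \<open>W a b k\<close> on \<open>k\<close> is
  through \<open>kbar a b k\<close>. Moving that factor into the argument of
  \<open>interaction\<close> leaves a prefactor common to all coordinates, so that the lemma can be
  read as an identity of vectors.\<close>

lemma Bcoef_sym:
  assumes "1 \<le> fst k" "1 \<le> snd k"
  shows "Bcoef m n k + Bcoef n m k = (kbar a b m - kbar a b n) * pi\<^sup>2 / (4 * a * b)
     * interaction (\<lambda>i j. odd_delta i (fst k) * odd_delta j (snd k) / kbar a b k) m n"
proof -
  have "Bcoef m n k + Bcoef n m k = - (trilinear m n k + trilinear n m k) / L2_inner a b (W a b k) (W a b k)"
    by (simp add: Bcoef_def add_divide_distrib diff_divide_distrib)
  also have "\<dots> = - ((kbar a b m - kbar a b n) * (pi\<^sup>2 / 16 * interaction (\<lambda>i j. odd_delta i (fst k) * odd_delta j (snd k)) m n))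
      / (- kbar a b k * (a * b / 4))"
    by (simp only: trilinear_sym integral_jac[OF assms] L2_norm_W[OF assms])
  also have "\<dots> = (kbar a b m - kbar a b n) * pi\<^sup>2 / (4 * a * b)
     * (interaction (\<lambda>i j. odd_delta i (fst k) * odd_delta j (snd k)) m n / kbar a b k)"
    using a b kbar_neg[OF assms(1)] by (simp add: field_simps)
  also have "interaction (\<lambda>i j. odd_delta i (fst k) * odd_delta j (snd k)) m n / kbar a b k
     = interaction (\<lambda>i j. odd_delta i (fst k) * odd_delta j (snd k) / kbar a b k) m n"
    by (simp add: interaction_def add_divide_distrib diff_divide_distrib right_diff_distrib)
  finally show ?thesis .
qed

end

section \<open>Saturation of the controlled modes\<close>

lemma subspace_cancel:
  assumes "subspace G" "c *\<^sub>R x + r \<in> G" "r \<in> G" "c \<noteq> 0"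
  shows "x \<in> G"
proof -
  have "(1 / c) *\<^sub>R ((c *\<^sub>R x + r) - r) \<in> G" by (intro subspace_scale subspace_diff assms)
  then show ?thesis using assms(4) by simp
qed

text \<open>Differences of indices carry arbitrary signs. Oddness reduces them to positive indices
  and makes index 0 vanish; the last hypothesis excludes just the reflections of the corner (J,
  J).\<close>

lemma odd_extension_mem:
  fixes E :: "int \<Rightarrow> int \<Rightarrow> 'v::real_vector" and J :: nat
  assumes G: "subspace G"
    and odd: "\<And>i j. E (- i) j = - E i j" "\<And>i j. E i (- j) = - E i j"
    and IH: "\<And>p q. 1 \<le> p \<Longrightarrow> p \<le> J \<Longrightarrow> 1 \<le> q \<Longrightarrow> q \<le> J \<Longrightarrow> (p, q) \<noteq> (J, J) \<Longrightarrow> E (int p) (int q) \<in> G"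
    and i: "\<bar>i\<bar> \<le> int J" and j: "\<bar>j\<bar> \<le> int J" and ne: "\<bar>i\<bar> < int J \<or> \<bar>j\<bar> < int J"
  shows "E i j \<in> G"
proof -
  have z: "E 0 j = 0" "E i 0 = 0" for i j
    using odd(1)[of 0 j] odd(2)[of i 0] by (simp_all add: eq_neg_iff_add_eq_0 scaleR_2[symmetric])
  have "E \<bar>i\<bar> \<bar>j\<bar> \<in> G"
  proof (cases "i = 0 \<or> j = 0")
    case True
    then show ?thesis using z subspace_0[OF G] by auto
  next
    case False
    have "E (int (nat \<bar>i\<bar>)) (int (nat \<bar>j\<bar>)) \<in> G" by (rule IH) (use i j ne False in auto)
    then show ?thesis by simp
  qed
  moreover have "E i j = E \<bar>i\<bar> \<bar>j\<bar> \<or> E i j = - E \<bar>i\<bar> \<bar>j\<bar>"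
    using odd(1)[of "\<bar>i\<bar>" "\<bar>j\<bar>"] odd(1)[of "\<bar>i\<bar>" j] odd(2)[of "\<bar>i\<bar>" "\<bar>j\<bar>"] odd(2)[of i "\<bar>j\<bar>"]
    by (auto simp: abs_if split: if_splits)
  ultimately show ?thesis using subspace_neg[OF G] by metis
qed

text \<open>Interacting (1,1) with (J, q) links \<open>E\<close> at (J + 1, q + 1) and (J + 1, q -
  1) with leading coefficient q - J, nonzero for q < J. This recursion of step two needs two
  starting values. For even indices it starts from index 0, where \<open>E\<close> vanishes; for odd
  indices a second relation between rows 1 and 3 comes from (2,1) and (J - 1, 2). Only pairs ordered
  componentwise occur, so the side lengths do not matter.\<close>

lemma saturation_column:
  fixes E :: "int \<Rightarrow> int \<Rightarrow> 'v::real_vector" and J :: nat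
  assumes G: "subspace G"
    and odd: "\<And>i j. E (- i) j = - E i j" "\<And>i j. E i (- j) = - E i j"
    and J: "3 \<le> J"
    and IH: "\<And>p q. 1 \<le> p \<Longrightarrow> p \<le> J \<Longrightarrow> 1 \<le> q \<Longrightarrow> q \<le> J \<Longrightarrow> (p, q) \<noteq> (J, J) \<Longrightarrow> E (int p) (int q) \<in> G"
    and cl: "\<And>p q r s. 1 \<le> p \<Longrightarrow> p \<le> r \<Longrightarrow> r \<le> J \<Longrightarrow> 1 \<le> q \<Longrightarrow> q \<le> s \<Longrightarrow> s \<le> J \<Longrightarrow>
       (p, q) \<noteq> (r, s) \<Longrightarrow> (r, s) \<noteq> (J, J) \<Longrightarrow> interaction E (p, q) (r, s) \<in> G"
    and q: "1 \<le> q" "q \<le> J"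
  shows "E (int J + 1) (int q) \<in> G"
proof -
  have mem: "E i j \<in> G" if "\<bar>i\<bar> \<le> int J" "\<bar>j\<bar> \<le> int J" "\<bar>i\<bar> < int J \<or> \<bar>j\<bar> < int J" for i j
    by (rule odd_extension_mem[OF G odd IH]) (use that in auto)
  have z: "E i 0 = 0" for i using odd(2)[of i 0] by (simp add: eq_neg_iff_add_eq_0 scaleR_2[symmetric])
  have X: "(real q - real J) *\<^sub>R E (int J + 1) (int q + 1) + (real q + real J) *\<^sub>R E (int J + 1) (1 - int q) \<in> G"
    if q: "1 \<le> q" "q < J" for q
  proof -
    have "interaction E (1, 1) (J, q) \<in> G" by (rule cl) (use q J in auto)
    moreover have "E (1 - int J) (1 - int q) \<in> G" "E (1 - int J) (1 + int q) \<in> G"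
      using q J by (auto intro!: mem)
    ultimately have "interaction E (1, 1) (J, q) + (real q - real J) *\<^sub>R E (1 - int J) (1 - int q)
       + (real q + real J) *\<^sub>R E (1 - int J) (1 + int q) \<in> G"
      by (intro subspace_add[OF G] subspace_scale[OF G])
    then show ?thesis by (simp add: interaction_def wedge_def vee_def algebra_simps)
  qed
  have E2: "E (int J + 1) 2 \<in> G"
    by (rule subspace_cancel[OF G _ subspace_0[OF G], of "1 - real J"]) (use X[of 1] z J in auto)
  define x where "x = E (int J + 1) 3"
  define y where "y = E (int J + 1) 1"
  define j where "j = real J"
  have j: "3 \<le> j" using J by (simp add: j_def)
  have u: "(2 - j) *\<^sub>R x - (2 + j) *\<^sub>R y \<in> G"
    using X[of 2] J odd(2)[of "int J + 1" 1] by (simp add: x_def y_def j_def)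
  have v: "(5 - j) *\<^sub>R x - (j + 3) *\<^sub>R y \<in> G"
  proof -
    have "interaction E (2, 1) (J - 1, 2) \<in> G" by (rule cl) (use J in auto)
    moreover have "E (3 - int J) (-1) \<in> G" "E (3 - int J) 3 \<in> G"
      using J by (auto intro!: mem)
    ultimately have "interaction E (2, 1) (J - 1, 2) + (5 - j) *\<^sub>R E (3 - int J) (-1) + (j + 3) *\<^sub>R E (3 - int J) 3 \<in> G"
      by (intro subspace_add[OF G] subspace_scale[OF G])
    moreover have "int (J - 1) = int J - 1" "real (J - 1) = j - 1" using J by (auto simp: j_def of_nat_diff)
    ultimately show ?thesis using odd(2)[of "int J + 1" 1]
      by (simp add: interaction_def wedge_def vee_def x_def y_def algebra_simps)
  qed
  \<comment> \<open>The multipliers eliminate \<open>y\<close>. The remaining coefficient - 4 j - 4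
    is nonzero for every \<open>J\<close>, even where 5 - j vanishes.\<close>
  have "(j + 3) *\<^sub>R ((2 - j) *\<^sub>R x - (2 + j) *\<^sub>R y) - (j + 2) *\<^sub>R ((5 - j) *\<^sub>R x - (j + 3) *\<^sub>R y) \<in> G"
    by (intro subspace_diff[OF G] subspace_scale[OF G] u v)
  moreover have "(j + 3) *\<^sub>R ((2 - j) *\<^sub>R x - (2 + j) *\<^sub>R y) - (j + 2) *\<^sub>R ((5 - j) *\<^sub>R x - (j + 3) *\<^sub>R y)
      = (- 4 * j - 4) *\<^sub>R x + 0"
  proof -
    have "c *\<^sub>R (p *\<^sub>R x - q *\<^sub>R y) - d *\<^sub>R (r *\<^sub>R x - s *\<^sub>R y) = (c * p - d * r) *\<^sub>R x + (d * s - c * q) *\<^sub>R y"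
      for c d p q r s by (simp add: algebra_simps)
    moreover have "(j + 3) * (2 - j) - (j + 2) * (5 - j) = - 4 * j - 4" "(j + 2) * (j + 3) - (j + 3) * (2 + j) = 0"
      by algebra+
    ultimately show ?thesis by (simp only: scaleR_zero_left)
  qed
  ultimately have x: "x \<in> G"
    using subspace_cancel[OF G _ subspace_0[OF G], of "- 4 * j - 4" x] j by auto
  have y: "y \<in> G"
  proof (rule subspace_cancel[OF G])
    show "(- (2 + j)) *\<^sub>R y + (2 - j) *\<^sub>R x \<in> G" using u by (simp add: algebra_simps)
    show "(2 - j) *\<^sub>R x \<in> G" by (intro subspace_scale[OF G] x)
  qed (use j in simp)
  show ?thesis using q
  proof (induction q rule: less_induct)
    case (less q)
    consider "q = 1" | "q = 2" | "q = 3" | "4 \<le> q" using less.prems by linarith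
    then show ?case
    proof cases
      case 4
      have p: "E (int J + 1) (int (q - 2)) \<in> G" by (rule less.IH) (use 4 less.prems in auto)
      have i: "int (q - 1) + 1 = int q" "1 - int (q - 1) = - int (q - 2)" using 4 by auto
      have "(real (q - 1) - real J) *\<^sub>R E (int J + 1) (int q)
         + (real (q - 1) + real J) *\<^sub>R E (int J + 1) (- int (q - 2)) \<in> G"
        using X[of "q - 1"] 4 less.prems unfolding i by simp
      then show ?thesis
      proof (rule subspace_cancel[OF G])
        show "(real (q - 1) + real J) *\<^sub>R E (int J + 1) (- int (q - 2)) \<in> G"
          unfolding odd by (intro subspace_scale[OF G] subspace_neg[OF G] p)
      qed (use 4 less.prems in auto)
    qed (use E2 x y in \<open>auto simp: x_def y_def\<close>)
  qed
qed

text \<open>Reflection in the diagonal changes the sign of a Jacobian. Hence rows follow from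
  columns.\<close>

lemma interaction_swap:
  "interaction (\<lambda>i j. E j i) m n = - interaction E (prod.swap m) (prod.swap n)"
  by (simp add: interaction_def wedge_def vee_def algebra_simps)

lemma modes_mono: "j \<le> N \<Longrightarrow> modes j \<subseteq> modes N"
  by (auto simp: modes_def)

lemma modes_Suc_cases:
  assumes "k \<in> modes (Suc j)"
  obtains "k \<in> modes j" | "k = (j + 2, j + 2)"
    | q where "k = (j + 3, q)" "1 \<le> q" "q \<le> j + 2" | q where "k = (q, j + 3)" "1 \<le> q" "q \<le> j + 2"
  using assms by (cases k) (auto simp: modes_def le_Suc_eq)

context rectangle
begin

lemma kbar_strict:
  assumes "fst m \<le> fst n" "snd m \<le> snd n" "m \<noteq> n"
  shows "kbar a b m \<noteq> kbar a b n"
proof -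
  have "\<alpha> m \<le> \<alpha> n" "\<beta> m \<le> \<beta> n" "0 \<le> \<alpha> m" "0 \<le> \<beta> m"
    using assms a b by (auto simp: \<alpha>_def \<beta>_def divide_right_mono mult_right_mono)
  moreover have "\<alpha> m < \<alpha> n \<or> \<beta> m < \<beta> n"
    using assms a b by (cases m; cases n) (auto simp: \<alpha>_def \<beta>_def divide_strict_right_mono)
  ultimately have "(\<alpha> m)\<^sup>2 \<le> (\<alpha> n)\<^sup>2" "(\<beta> m)\<^sup>2 \<le> (\<beta> n)\<^sup>2"
    "(\<alpha> m)\<^sup>2 < (\<alpha> n)\<^sup>2 \<or> (\<beta> m)\<^sup>2 < (\<beta> n)\<^sup>2"
    by (auto intro: power_mono power_strict_mono)
  then have "(\<alpha> m)\<^sup>2 + (\<beta> m)\<^sup>2 < (\<alpha> n)\<^sup>2 + (\<beta> n)\<^sup>2" by linarith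
  then show ?thesis by (simp add: kbar_eq)
qed

text \<open>The assumed coincidence forces a = b; then (3,1) and (2,2) have sums of squares 10 and
  8.\<close>

lemma kbar_cases:
  assumes "kbar a b (1, 2) = kbar a b (2, 1)"
  shows "kbar a b (3, 1) \<noteq> kbar a b (2, 2)"
proof -
  have *: "kbar a b k = - (pi\<^sup>2 / a\<^sup>2) * (real (fst k))\<^sup>2 - (pi\<^sup>2 / b\<^sup>2) * (real (snd k))\<^sup>2" for k
    by (simp add: kbar_def algebra_simps)
  have "0 < pi\<^sup>2 / a\<^sup>2" using a by simp
  then show ?thesis using assms unfolding * by simp
qed

text \<open>\<open>E\<close> is the odd extension of the basis to all integer indices.  The pair \<open>(1,2)\<close>, \<open>(2,1)\<close> that gives the
  corner \<open>(3,3)\<close> is degenerate on a square, where one goes through \<open>(5,1)\<close> and \<open>(5,3)\<close> instead; if these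
  modes have been truncated, the corresponding \<open>E\<close> vanish.\<close>

lemma saturation:
  fixes E :: "int \<Rightarrow> int \<Rightarrow> 'v::real_vector" and N :: nat
  assumes G: "subspace G"
    and odd: "\<And>i j. E (- i) j = - E i j" "\<And>i j. E i (- j) = - E i j"
    and base: "\<And>k. k \<in> modes 1 \<Longrightarrow> E (int (fst k)) (int (snd k)) \<in> G"
    and cl: "\<And>m n. m \<in> modes N \<Longrightarrow> n \<in> modes N \<Longrightarrow> E (int (fst m)) (int (snd m)) \<in> G \<Longrightarrow>
       E (int (fst n)) (int (snd n)) \<in> G \<Longrightarrow> kbar a b m \<noteq> kbar a b n \<Longrightarrow> interaction E m n \<in> G"
    and j: "1 \<le> j" "j \<le> N" and k: "k \<in> modes j"
  shows "E (int (fst k)) (int (snd k)) \<in> G"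
  using j k
proof (induction j arbitrary: k rule: nat_induct_at_least)
  case base
  then show ?case using assms(4) by simp
next
  case (Suc j)
  define J where "J = j + 2"
  have J: "3 \<le> J" using Suc.hyps by (simp add: J_def)
  have jN: "modes j \<subseteq> modes N" using Suc.prems by (intro modes_mono) simp
  have IH: "E (int p) (int q) \<in> G" if "1 \<le> p" "p \<le> J" "1 \<le> q" "q \<le> J" "(p, q) \<noteq> (J, J)" for p q
    using Suc.IH[of "(p, q)"] that Suc.prems by (auto simp: modes_def J_def)
  have mem: "E i j \<in> G" if "\<bar>i\<bar> \<le> int J" "\<bar>j\<bar> \<le> int J" "\<bar>i\<bar> < int J \<or> \<bar>j\<bar> < int J" for i j
    by (rule odd_extension_mem[OF G odd IH]) (use that in auto)
  have modesJ: "(p, q) \<in> modes j \<longleftrightarrow> 1 \<le> p \<and> p \<le> J \<and> 1 \<le> q \<and> q \<le> J \<and> (p, q) \<noteq> (J, J)" for p q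
    by (auto simp: modes_def J_def)
  have clk: "interaction E m n \<in> G" if "m \<in> modes j" "n \<in> modes j" "kbar a b m \<noteq> kbar a b n" for m n
    by (rule cl) (use that jN Suc.IH Suc.prems in auto)
  have clJ: "interaction E (p, q) (r, s) \<in> G"
    if "1 \<le> p" "p \<le> r" "r \<le> J" "1 \<le> q" "q \<le> s" "s \<le> J" "(p, q) \<noteq> (r, s)" "(r, s) \<noteq> (J, J)" for p q r s
  proof (rule clk)
    show "kbar a b (p, q) \<noteq> kbar a b (r, s)" by (rule kbar_strict) (use that in simp_all)
  qed (use that in \<open>auto simp: modesJ\<close>)
  have col: "E (int J + 1) (int q) \<in> G" if "1 \<le> q" "q \<le> J" for q
    by (rule saturation_column[OF G odd J IH clJ that])
  have row: "E (int q) (int J + 1) \<in> G" if q: "1 \<le> q" "q \<le> J" for q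
  proof (rule saturation_column[where E = "\<lambda>i j. E j i", OF G odd(2) odd(1) J _ _ q])
    show "E (int q) (int p) \<in> G" if "1 \<le> p" "p \<le> J" "1 \<le> q" "q \<le> J" "(p, q) \<noteq> (J, J)" for p q
      by (rule IH) (use that in auto)
    show "interaction (\<lambda>i j. E j i) (p, q) (r, s) \<in> G"
      if "1 \<le> p" "p \<le> r" "r \<le> J" "1 \<le> q" "q \<le> s" "s \<le> J" "(p, q) \<noteq> (r, s)" "(r, s) \<noteq> (J, J)" for p q r s
    proof -
      have "interaction E (q, p) (s, r) \<in> G" by (rule clJ) (use that in \<open>simp_all, blast+\<close>)
      then show ?thesis by (simp add: interaction_swap[of E] subspace_neg[OF G])
    qed
  qed
  have corner: "E (int J) (int J) \<in> G"
  proof (cases "J = 3")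
    case False
    then have J4: "4 \<le> J" using J by simp
    \<comment> \<open>The indices add up to the corner, with \<open>wedge\<close> equal to - J, and
      they are ordered because J - 2 \<ge> 2. For J = 3 the pair would be (1,2), (2,1), which is
      unordered.\<close>
    have I: "interaction E (1, 2) (J - 1, J - 2) \<in> G" by (rule clJ) (use J4 in auto)
    have i: "int (J - 1) = int J - 1" "int (J - 2) = int J - 2" "real (J - 1) = real J - 1" "real (J - 2) = real J - 2"
      using J4 by (auto simp: of_nat_diff)
    let ?r = "real J *\<^sub>R E (2 - int J) (4 - int J) + (3 * real J - 4) *\<^sub>R (E (int J) (4 - int J) - E (2 - int J) (int J))"
    have r: "?r \<in> G"
      using J4 by (intro subspace_add[OF G] subspace_scale[OF G] subspace_diff[OF G] mem) auto
    show ?thesis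
    proof (rule subspace_cancel[OF G _ r, of "- real J"])
      have "interaction E (1, 2) (J - 1, J - 2) = (- real J) *\<^sub>R E (int J) (int J) + ?r"
      proof -
        have "int 1 + (int J - 1) = int J" "int 2 + (int J - 2) = int J"
          "int 1 - (int J - 1) = 2 - int J" "int 2 - (int J - 2) = 4 - int J"
          "real 1 * (real J - 2) - real 2 * (real J - 1) = - real J"
          "real 1 * (real J - 2) + real 2 * (real J - 1) = 3 * real J - 4" by simp_all
        then show ?thesis
          unfolding interaction_def wedge_def vee_def fst_conv snd_conv i
          by (simp only: scaleR_diff_right scaleR_minus_left) simp
      qed
      then show "(- real J) *\<^sub>R E (int J) (int J) + ?r \<in> G" using I by simp
    qed (use J in simp)
  next
    case True
    show ?thesis
    proof (cases "kbar a b (1, 2) = kbar a b (2, 1)")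
      case False
      have I: "interaction E (1, 2) (2, 1) \<in> G" by (rule clk) (use False True in \<open>auto simp: modesJ\<close>)
      let ?r = "3 *\<^sub>R E (-1) 1 + 5 *\<^sub>R (E 3 1 - E (-1) 3)"
      have r: "?r \<in> G"
        by (intro subspace_add[OF G] subspace_scale[OF G] subspace_diff[OF G] mem) (auto simp: True)
      have "E 3 3 \<in> G"
      proof (rule subspace_cancel[OF G _ r, of "- 3"])
        have "interaction E (1, 2) (2, 1) = (- 3) *\<^sub>R E 3 3 + ?r"
          by (simp add: interaction_def wedge_def vee_def algebra_simps)
        then show "(- 3) *\<^sub>R E 3 3 + ?r \<in> G" using I by simp
      qed simp
      then show ?thesis by (simp add: True)
    next
      case eq: True
      have j1: "j = 1" using True by (simp add: J_def)
      \<comment> \<open>Two interactions reach (5,3) and (5,1), giving relations with coefficients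
        (1, -7) and (4, -8). The determinant is 20, so both vectors are obtained.\<close>
      have "interaction E (2, 1) (3, 2) \<in> G" by (rule clJ) (auto simp: True)
      moreover have "interaction E (2, 1) (3, 2) = E 5 3 - 7 *\<^sub>R E 5 1 + (- E (-1) (-1) - 7 *\<^sub>R E (-1) 3)"
        using odd(2)[of 5 1] by (simp add: interaction_def wedge_def vee_def algebra_simps)
      moreover have "- E (-1) (-1) - 7 *\<^sub>R E (-1) 3 \<in> G"
        by (intro subspace_diff[OF G] subspace_neg[OF G] subspace_scale[OF G] mem) (auto simp: True)
      ultimately have u: "E 5 3 - 7 *\<^sub>R E 5 1 \<in> G" using subspace_cancel[OF G, of 1] by simp
      have "interaction E (3, 1) (2, 2) \<in> G" by (rule clk) (use kbar_cases[OF eq] True in \<open>auto simp: modesJ\<close>)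
      moreover have "interaction E (3, 1) (2, 2) = 4 *\<^sub>R E 5 3 - 8 *\<^sub>R E 5 1 + (- 4 *\<^sub>R E 1 (-1) - 8 *\<^sub>R E 1 3)"
        using odd(2)[of 5 1] by (simp add: interaction_def wedge_def vee_def algebra_simps)
      moreover have "- 4 *\<^sub>R E 1 (-1) - 8 *\<^sub>R E 1 3 \<in> G"
        by (intro subspace_diff[OF G] subspace_neg[OF G] subspace_scale[OF G] mem) (auto simp: True)
      ultimately have v: "4 *\<^sub>R E 5 3 - 8 *\<^sub>R E 5 1 \<in> G" using subspace_cancel[OF G, of 1] by simp
      have "(4 *\<^sub>R E 5 3 - 8 *\<^sub>R E 5 1) - 4 *\<^sub>R (E 5 3 - 7 *\<^sub>R E 5 1) \<in> G"
        by (intro subspace_diff[OF G] subspace_scale[OF G] u v)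
      moreover have "(4 *\<^sub>R E 5 3 - 8 *\<^sub>R E 5 1) - 4 *\<^sub>R (E 5 3 - 7 *\<^sub>R E 5 1) = 20 *\<^sub>R E 5 1 + 0"
        using scaleR_left_distrib[of 8 20 "E 5 1"] by (simp add: algebra_simps)
      ultimately have E51: "E 5 1 \<in> G"
        using subspace_cancel[OF G _ subspace_0[OF G], of 20 "E 5 1"] by simp
      have E53: "E 5 3 \<in> G"
        using subspace_add[OF G u subspace_scale[OF G E51, of 7]] by simp
      \<comment> \<open>(4,2) belongs to the column just added. Its interaction with (1,1) contains
        \<open>E (-3) 3\<close>, which is the corner up to sign, with coefficient \<open>vee\<close>
        = 6.\<close>
      have I: "interaction E (1, 1) (4, 2) \<in> G"
      proof (rule cl)
        show "E (int (fst (4::nat, 2::nat))) (int (snd (4::nat, 2::nat))) \<in> G" using col[of 2] True by simp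
        show "kbar a b (1, 1) \<noteq> kbar a b (4, 2)" by (rule kbar_strict) auto
        show "E (int (fst (1::nat, 1::nat))) (int (snd (1::nat, 1::nat))) \<in> G" using IH[of 1 1] True by simp
      qed (use Suc.prems j1 in \<open>auto simp: modes_def\<close>)
      let ?r = "- 2 *\<^sub>R E 5 3 - 6 *\<^sub>R E 5 1 + 2 *\<^sub>R E (-3) (-1)"
      have r: "?r \<in> G"
        by (intro subspace_add[OF G] subspace_diff[OF G] subspace_scale[OF G] E53 E51 mem) (auto simp: True)
      have "E 3 3 \<in> G"
      proof (rule subspace_cancel[OF G _ r, of 6])
        have "interaction E (1, 1) (4, 2) = 6 *\<^sub>R E 3 3 + ?r"
          using odd(2)[of 5 1] odd(1)[of 3 3] by (simp add: interaction_def wedge_def vee_def algebra_simps)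
        then show "6 *\<^sub>R E 3 3 + ?r \<in> G" using I by simp
      qed simp
      then show ?thesis by (simp add: True)
    qed
  qed
  from Suc.prems(2) show ?case
  proof (cases rule: modes_Suc_cases)
    case 1
    then show ?thesis using Suc.IH Suc.prems by simp
  next
    case 2
    then show ?thesis using corner by (simp add: J_def)
  next
    case (3 q)
    then show ?thesis using col[of q] by (simp add: J_def algebra_simps)
  next
    case (4 q)
    then show ?thesis using row[of q] by (simp add: J_def algebra_simps)
  qed
qed

end

section \<open>The Galerkin system\<close>

lemma gronwall_zero:
  fixes \<phi> :: "real \<Rightarrow> real"
  assumes cont: "continuous_on {0..t} \<phi>" and nn: "\<And>s. s \<in> {0..t} \<Longrightarrow> 0 \<le> \<phi> s"
    and l: "0 \<le> l" and ineq: "\<And>s. s \<in> {0..t} \<Longrightarrow> \<phi> s \<le> l * integral {0..s} \<phi>"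
    and s: "s \<in> {0..t}"
  shows "\<phi> s = 0"
proof -
  define \<Phi> where "\<Phi> = (\<lambda>s. integral {0..s} \<phi>)"
  \<comment> \<open>The hypothesis makes \<open>h\<close> nonincreasing, and it starts at 0. Hence
    the primitive is nonpositive and the inequality forces \<phi> to vanish.\<close>
  define h where "h = (\<lambda>s. exp (- l * s) * \<Phi> s)"
  have \<Phi>d: "(\<Phi> has_real_derivative \<phi> r) (at r within {0..t})" if "r \<in> {0..t}" for r
    unfolding \<Phi>_def by (rule integral_has_real_derivative[OF cont that])
  have "continuous_on {0..t} \<Phi>"
    unfolding \<Phi>_def by (rule indefinite_integral_continuous_1[OF integrable_continuous_real[OF cont]])
  then have "continuous_on {0..s} h"
    unfolding h_def using s by (intro continuous_intros) (auto intro: continuous_on_subset)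
  then have "h s \<le> h 0"
  proof (rule DERIV_nonpos_imp_decreasing_open[rotated 2])
    fix r assume r: "0 < r" "r < s"
    have "(at r within {0..t}) = at r" by (rule at_within_interior) (use r s in auto)
    then have "(\<Phi> has_real_derivative \<phi> r) (at r)" using \<Phi>d[of r] r s by simp
    then have "(h has_real_derivative exp (- l * r) * (\<phi> r - l * \<Phi> r)) (at r)"
      unfolding h_def by (auto intro!: derivative_eq_intros simp: algebra_simps)
    moreover have "exp (- l * r) * (\<phi> r - l * \<Phi> r) \<le> 0"
      using ineq[of r] r s by (auto simp: \<Phi>_def mult_nonneg_nonpos)
    ultimately show "\<exists>y. (h has_real_derivative y) (at r) \<and> y \<le> 0" by blast
  qed (use s in auto)
  then have "\<Phi> s \<le> 0" by (auto simp: h_def \<Phi>_def mult_le_0_iff)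
  then have "l * integral {0..s} \<phi> \<le> 0" using l by (simp add: \<Phi>_def mult_nonneg_nonpos)
  then show ?thesis using ineq[OF s] nn[OF s] by linarith
qed

context rectangle
begin

lemma B_lipschitz:
  assumes M: "\<And>m. m \<in> modes N \<Longrightarrow> \<bar>u m\<bar> \<le> M" "\<And>m. m \<in> modes N \<Longrightarrow> \<bar>w m\<bar> \<le> M" and M0: "0 \<le> M"
  shows "\<bar>\<B> a b N u k - \<B> a b N w k\<bar>
     \<le> (\<Sum>m\<in>modes N. \<Sum>n\<in>modes N. \<bar>Bcoef m n k\<bar> * (2 * M)) * (\<Sum>m\<in>modes N. \<bar>u m - w m\<bar>)"
proof -
  let ?\<Delta> = "\<Sum>m\<in>modes N. \<bar>u m - w m\<bar>"
  have fac: "(\<Sum>m\<in>modes N. \<Sum>n\<in>modes N. (2 * M * \<delta>) * \<bar>Bcoef m n k\<bar>)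
      = (\<Sum>m\<in>modes N. \<Sum>n\<in>modes N. \<bar>Bcoef m n k\<bar> * (2 * M)) * \<delta>" for \<delta>
    by (simp add: sum_distrib_left sum_distrib_right mult_ac)
  have \<Delta>: "\<bar>u m - w m\<bar> \<le> ?\<Delta>" if "m \<in> modes N" for m
    using that finite_modes by (intro member_le_sum[of m "modes N" "\<lambda>m. \<bar>u m - w m\<bar>"]) auto
  have prod: "\<bar>u m * u n - w m * w n\<bar> \<le> 2 * M * ?\<Delta>" if "m \<in> modes N" "n \<in> modes N" for m n
  proof -
    have "u m * u n - w m * w n = u m * (u n - w n) + (u m - w m) * w n" by (simp add: algebra_simps)
    then have "\<bar>u m * u n - w m * w n\<bar> \<le> \<bar>u m\<bar> * \<bar>u n - w n\<bar> + \<bar>u m - w m\<bar> * \<bar>w n\<bar>"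
      by (metis abs_mult abs_triangle_ineq)
    also have "\<dots> \<le> M * ?\<Delta> + ?\<Delta> * M"
      by (intro add_mono mult_mono M \<Delta> that) (auto simp: M0 sum_nonneg)
    finally show ?thesis by simp
  qed
  have "\<B> a b N u k - \<B> a b N w k = (\<Sum>m\<in>modes N. \<Sum>n\<in>modes N. (u m * u n - w m * w n) * Bcoef m n k)"
    by (simp add: B_eq_Bcoef sum_subtractf left_diff_distrib)
  also have "\<bar>\<dots>\<bar> \<le> (\<Sum>m\<in>modes N. \<Sum>n\<in>modes N. \<bar>(u m * u n - w m * w n) * Bcoef m n k\<bar>)"
    by (intro order_trans[OF sum_abs] sum_mono sum_abs)
  also have "\<dots> \<le> (\<Sum>m\<in>modes N. \<Sum>n\<in>modes N. (2 * M * ?\<Delta>) * \<bar>Bcoef m n k\<bar>)"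
    unfolding abs_mult by (intro sum_mono mult_right_mono prod) auto
  finally show ?thesis by (simp only: fac)
qed

lemma galerkin_solution_continuous:
  assumes "galerkin_solution a b \<nu> F N K t v y u" "k \<in> modes N" "0 \<le> t"
  shows "continuous_on {0..t} (\<lambda>s. u s k)"
proof -
  let ?g = "\<lambda>r. \<B> a b N (u r) k + \<nu> * kbar a b k * u r k + W_coord a b F k + (if k \<in> K then v r k else 0)"
  have I: "(?g has_integral (u s k - u 0 k)) {0..s}" if "s \<in> {0..t}" for s
    using assms that unfolding galerkin_solution_def by blast
  have "?g integrable_on {0..t}" using I[of t] assms(3) by auto
  then have "continuous_on {0..t} (\<lambda>s. u 0 k + integral {0..s} ?g)"
    by (intro continuous_intros indefinite_integral_continuous_1)
  moreover have "u 0 k + integral {0..s} ?g = u s k" if "s \<in> {0..t}" for s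
    using integral_unique[OF I[OF that]] by simp
  ultimately show ?thesis by (rule continuous_on_eq)
qed

text \<open>Controllability requires every trajectory to end at the target. The control cancels in
  the difference of two solutions, and continuity on [0,t] supplies a common bound \<open>M\<close>,
  hence a Lipschitz constant for the quadratic term.\<close>

lemma galerkin_solution_unique:
  assumes u: "galerkin_solution a b \<nu> F N K t v y u" and w: "galerkin_solution a b \<nu> F N K t v y w"
    and t: "0 \<le> t" and s: "s \<in> {0..t}" and k: "k \<in> modes N"
  shows "u s k = w s k"
proof -
  note fin = finite_modes[of N]
  have uc: "continuous_on {0..t} (\<lambda>s. u s m)" and wc: "continuous_on {0..t} (\<lambda>s. w s m)" if "m \<in> modes N" for m
    using galerkin_solution_continuous[OF u that t] galerkin_solution_continuous[OF w that t] by auto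
  define \<Theta> where "\<Theta> s = (\<Sum>m\<in>modes N. \<bar>u s m\<bar> + \<bar>w s m\<bar>)" for s
  have "continuous_on {0..t} \<Theta>" unfolding \<Theta>_def[abs_def] by (intro continuous_intros uc wc)
  then have "bounded (\<Theta> ` {0..t})" by (intro compact_imp_bounded compact_continuous_image) auto
  then obtain M where M: "\<And>s. s \<in> {0..t} \<Longrightarrow> \<bar>\<Theta> s\<bar> \<le> M"
    unfolding bounded_iff real_norm_def by blast
  have M0: "0 \<le> M" using M[OF s] by simp
  have le: "\<bar>u r m\<bar> + \<bar>w r m\<bar> \<le> M" if "r \<in> {0..t}" "m \<in> modes N" for r m
  proof -
    have "\<bar>u r m\<bar> + \<bar>w r m\<bar> \<le> \<Theta> r"
      unfolding \<Theta>_def using that fin by (intro member_le_sum[of m "modes N" "\<lambda>m. \<bar>u r m\<bar> + \<bar>w r m\<bar>"]) auto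
    then show ?thesis using M[OF that(1)] by linarith
  qed
  define \<phi> where "\<phi> s = (\<Sum>m\<in>modes N. \<bar>u s m - w s m\<bar>)" for s
  define c where "c k = (\<Sum>m\<in>modes N. \<Sum>n\<in>modes N. \<bar>Bcoef m n k\<bar> * (2 * M)) + \<bar>\<nu> * kbar a b k\<bar>" for k
  have c0: "0 \<le> c k" for k unfolding c_def using M0 by (intro add_nonneg_nonneg sum_nonneg) auto
  have \<phi>c: "continuous_on {0..t} \<phi>" unfolding \<phi>_def[abs_def] by (intro continuous_intros uc wc)
  have \<phi>m: "\<bar>u r m - w r m\<bar> \<le> \<phi> r" if "m \<in> modes N" for r m
    unfolding \<phi>_def using that fin by (intro member_le_sum[of m "modes N" "\<lambda>m. \<bar>u r m - w r m\<bar>"]) auto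
  let ?f = "\<lambda>x k r. \<B> a b N (x r) k + \<nu> * kbar a b k * x r k + W_coord a b F k + (if k \<in> K then v r k else 0)"
  have est: "\<bar>u s k - w s k\<bar> \<le> c k * integral {0..s} \<phi>" if s: "s \<in> {0..t}" and k: "k \<in> modes N" for s k
  proof -
    have y: "u 0 k = w 0 k" using u w k by (auto simp: galerkin_solution_def)
    have I: "((\<lambda>r. ?f u k r - ?f w k r) has_integral (u s k - u 0 k) - (w s k - w 0 k)) {0..s}"
      using u w s k by (intro has_integral_diff) (auto simp: galerkin_solution_def)
    have \<phi>I: "(\<lambda>r. c k * \<phi> r) integrable_on {0..s}"
      using s by (intro integrable_continuous_real continuous_intros continuous_on_subset[OF \<phi>c]) auto
    have "norm (integral {0..s} (\<lambda>r. ?f u k r - ?f w k r)) \<le> integral {0..s} (\<lambda>r. c k * \<phi> r)"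
    proof (rule integral_norm_bound_integral[OF _ \<phi>I])
      show "(\<lambda>r. ?f u k r - ?f w k r) integrable_on {0..s}" using I by blast
      fix r assume r: "r \<in> {0..s}"
      have rt: "r \<in> {0..t}" using r s by auto
      have b: "\<bar>u r m\<bar> \<le> M" "\<bar>w r m\<bar> \<le> M" if "m \<in> modes N" for m
        using le[OF rt that] by linarith+
      have "\<bar>\<B> a b N (u r) k - \<B> a b N (w r) k\<bar> \<le> (\<Sum>m\<in>modes N. \<Sum>n\<in>modes N. \<bar>Bcoef m n k\<bar> * (2 * M)) * \<phi> r"
        using B_lipschitz[OF b M0] by (simp add: \<phi>_def)
      moreover have "\<bar>\<nu> * kbar a b k * u r k - \<nu> * kbar a b k * w r k\<bar> \<le> \<bar>\<nu> * kbar a b k\<bar> * \<phi> r"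
        unfolding right_diff_distrib[symmetric] abs_mult[of "\<nu> * kbar a b k"] using \<phi>m[OF k] by (intro mult_left_mono) auto
      moreover have "?f u k r - ?f w k r = (\<B> a b N (u r) k - \<B> a b N (w r) k) + (\<nu> * kbar a b k * u r k - \<nu> * kbar a b k * w r k)"
        by simp
      ultimately show "norm (?f u k r - ?f w k r) \<le> c k * \<phi> r"
        unfolding c_def distrib_right real_norm_def
        by (smt (verit) abs_triangle_ineq)
    qed
    then show ?thesis using integral_unique[OF I] y by simp
  qed
  have "\<phi> s = 0"
  proof (rule gronwall_zero[OF \<phi>c])
    show "0 \<le> (\<Sum>k\<in>modes N. c k)" by (intro sum_nonneg c0)
    show "\<phi> s \<le> (\<Sum>k\<in>modes N. c k) * integral {0..s} \<phi>" if "s \<in> {0..t}" for s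
      unfolding \<phi>_def[of s] sum_distrib_right by (intro sum_mono est that)
  qed (use s in \<open>auto simp: \<phi>_def intro!: sum_nonneg\<close>)
  then show ?thesis using \<phi>m[OF k, of s] by simp
qed

end

section \<open>The truncated system as a quadratic control system\<close>

instance bcontfun :: (metric_space, banach) banach ..

text \<open>Bounded continuous functions are only known to be complete over a metric domain, which
  \<open>nat \<times> nat\<close> is not; hence the wrapper \<open>discrete\<close>.\<close>

type_synonym state = "(nat \<times> nat) discrete \<Rightarrow>\<^sub>C real"

abbreviation coord :: "state \<Rightarrow> nat \<times> nat \<Rightarrow> real" where
  "coord x k \<equiv> apply_bcontfun x (discrete k)"

lemma coord_eqI: "(\<And>k. coord x k = coord y k) \<Longrightarrow> x = y"
  by (rule bcontfun_eqI) (metis of_discrete_inverse)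

lemma bounded_linear_coord: "bounded_linear (\<lambda>x. coord x k)"
  by (rule bounded_linear_intro[where K = 1]) (auto intro: norm_bounded simp flip: real_norm_def)

locale galerkin = rectangle +
  fixes \<nu> :: real and F :: "real \<times> real \<Rightarrow> real \<times> real" and N :: nat
  assumes N: "1 \<le> N"
begin

definition of_coords :: "(nat \<times> nat \<Rightarrow> real) \<Rightarrow> state" where
  "of_coords g = Bcontfun (\<lambda>i. if of_discrete i \<in> modes N then g (of_discrete i) else 0)"

lemma coord_of_coords [simp]: "coord (of_coords g) k = (if k \<in> modes N then g k else 0)"
proof -
  have "(\<lambda>i. if of_discrete i \<in> modes N then g (of_discrete i) else 0) \<in> bcontfun"
  proof (rule bcontfun_normI)
    show "continuous_on UNIV (\<lambda>i. if of_discrete i \<in> modes N then g (of_discrete i) else 0)"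
      by (simp add: continuous_on_open_vimage open_discrete)
    show "norm (if of_discrete i \<in> modes N then g (of_discrete i) else 0) \<le> (\<Sum>k\<in>modes N. \<bar>g k\<bar>)" for i
      using member_le_sum[of "of_discrete i" "modes N" "\<lambda>k. \<bar>g k\<bar>"] finite_modes by (auto intro: sum_nonneg)
  qed
  then show ?thesis by (simp add: of_coords_def Bcontfun_inverse discrete_inverse)
qed

lemma norm_coord_le: "\<bar>coord x k\<bar> \<le> norm x"
  using norm_bounded[of x "discrete k"] by simp

lemma norm_of_coords_le: "(\<And>k. k \<in> modes N \<Longrightarrow> \<bar>g k\<bar> \<le> B) \<Longrightarrow> 0 \<le> B \<Longrightarrow> norm (of_coords g) \<le> B"
proof (rule norm_bound)
  show "norm (apply_bcontfun (of_coords g) i) \<le> B" if "\<And>k. k \<in> modes N \<Longrightarrow> \<bar>g k\<bar> \<le> B" "0 \<le> B" for i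
    using that coord_of_coords[of g "of_discrete i"] by (simp add: of_discrete_inverse)
qed

definition Qc :: "state \<Rightarrow> state \<Rightarrow> state" where
  "Qc x y = of_coords (\<lambda>k. \<Sum>m\<in>modes N. \<Sum>n\<in>modes N. coord x m * coord y n * Bcoef m n k)"

definition Lc :: "state \<Rightarrow> state" where
  "Lc x = of_coords (\<lambda>k. \<nu> * kbar a b k * coord x k)"

definition Fc :: "state" where "Fc = of_coords (W_coord a b F)"

definition controls :: "(state) set" where
  "controls = {x. \<forall>k. k \<notin> modes 1 \<longrightarrow> coord x k = 0}"

definition proj :: "state \<Rightarrow> state" where
  "proj x = of_coords (coord x)"

lemma bounded_bilinear_Qc: "bounded_bilinear Qc"
proof
  show "Qc (x + x') y = Qc x y + Qc x' y" "Qc x (y + y') = Qc x y + Qc x y'" for x x' y y'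
    by (auto intro!: coord_eqI simp: Qc_def algebra_simps sum.distrib)
  show "Qc (r *\<^sub>R x) y = r *\<^sub>R Qc x y" "Qc x (r *\<^sub>R y) = r *\<^sub>R Qc x y" for r x y
    by (auto intro!: coord_eqI simp: Qc_def sum_distrib_left mult_ac)
  let ?K = "\<Sum>k\<in>modes N. \<Sum>m\<in>modes N. \<Sum>n\<in>modes N. \<bar>Bcoef m n k\<bar>"
  have "norm (Qc x y) \<le> norm x * norm y * ?K" for x y
    unfolding Qc_def
  proof (rule norm_of_coords_le)
    fix k assume k: "k \<in> modes N"
    have "\<bar>\<Sum>m\<in>modes N. \<Sum>n\<in>modes N. coord x m * coord y n * Bcoef m n k\<bar>
      \<le> (\<Sum>m\<in>modes N. \<Sum>n\<in>modes N. \<bar>coord x m * coord y n * Bcoef m n k\<bar>)"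
      by (intro order_trans[OF sum_abs] sum_mono sum_abs)
    also have "\<dots> \<le> (\<Sum>m\<in>modes N. \<Sum>n\<in>modes N. norm x * norm y * \<bar>Bcoef m n k\<bar>)"
      unfolding abs_mult using norm_coord_le[of x] norm_coord_le[of y]
      by (intro sum_mono mult_mono) auto
    also have "\<dots> = norm x * norm y * (\<Sum>m\<in>modes N. \<Sum>n\<in>modes N. \<bar>Bcoef m n k\<bar>)"
      by (simp add: sum_distrib_left)
    also have "\<dots> \<le> norm x * norm y * ?K"
      by (intro mult_left_mono member_le_sum[of k "modes N" "\<lambda>k. \<Sum>m\<in>modes N. \<Sum>n\<in>modes N. \<bar>Bcoef m n k\<bar>"] k finite_modes)
         (auto intro!: sum_nonneg)
    finally show "\<bar>\<Sum>m\<in>modes N. \<Sum>n\<in>modes N. coord x m * coord y n * Bcoef m n k\<bar> \<le> norm x * norm y * ?K" .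
  qed (auto intro!: mult_nonneg_nonneg sum_nonneg)
  then show "\<exists>K. \<forall>x y. norm (Qc x y) \<le> norm x * norm y * K" by blast
qed

lemma bounded_linear_Lc: "bounded_linear Lc"
proof (rule bounded_linear_intro)
  show "Lc (x + y) = Lc x + Lc y" "Lc (r *\<^sub>R x) = r *\<^sub>R Lc x" for x y r
    by (auto intro!: coord_eqI simp: Lc_def algebra_simps)
  show "norm (Lc x) \<le> norm x * (\<Sum>k\<in>modes N. \<bar>\<nu> * kbar a b k\<bar>)" for x
    unfolding Lc_def
  proof (rule norm_of_coords_le)
    fix k assume k: "k \<in> modes N"
    have "\<bar>\<nu> * kbar a b k * coord x k\<bar> \<le> (\<Sum>k\<in>modes N. \<bar>\<nu> * kbar a b k\<bar>) * norm x"
      unfolding abs_mult[of _ "coord x k"] using norm_coord_le[of x k]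
      by (intro mult_mono member_le_sum[of k "modes N" "\<lambda>k. \<bar>\<nu> * kbar a b k\<bar>"] k finite_modes)
         (auto intro: sum_nonneg)
    then show "\<bar>\<nu> * kbar a b k * coord x k\<bar> \<le> norm x * (\<Sum>k\<in>modes N. \<bar>\<nu> * kbar a b k\<bar>)"
      by (simp add: mult.commute)
  qed (auto intro!: mult_nonneg_nonneg sum_nonneg)
qed

lemma bounded_linear_proj: "bounded_linear proj"
proof (rule bounded_linear_intro[where K = 1])
  show "proj (x + y) = proj x + proj y" "proj (r *\<^sub>R x) = r *\<^sub>R proj x" for x y r
    by (auto intro!: coord_eqI simp: proj_def)
  show "norm (proj x) \<le> norm x * 1" for x
    unfolding proj_def using norm_coord_le[of x] by (intro norm_of_coords_le) auto
qed

lemma proj_of_coords: "proj (of_coords g) = of_coords g"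
  by (auto intro!: coord_eqI simp: proj_def)

lemma modes_1: "modes 1 \<subseteq> modes N"
  by (rule modes_mono) (rule N)

sublocale quadratic_control Qc Lc Fc controls
  by (rule quadratic_control.intro[OF bounded_bilinear_Qc bounded_linear_Lc]) (auto simp: controls_def)

lemma field_apply:
  "k \<in> modes N \<Longrightarrow> coord (field x) k
     = \<B> a b N (coord x) k + \<nu> * kbar a b k * coord x k + W_coord a b F k"
  unfolding field_def by (simp add: Qc_def Lc_def Fc_def B_eq_Bcoef)

sublocale projected_control Qc Lc Fc controls proj
proof (intro projected_control.intro quadratic_control_axioms projected_control_axioms.intro bounded_linear_proj)
  show "proj (proj x) = proj x" for x by (simp add: proj_def[of x] proj_of_coords)
  show "proj (field x) = field x" for x
    unfolding field_def by (auto intro!: coord_eqI simp: proj_def Qc_def Lc_def Fc_def)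
  show "proj e = e" if "e \<in> controls" for e
  proof (rule coord_eqI)
    have "coord e k = 0" if "k \<notin> modes N" for k
      using that \<open>e \<in> controls\<close> modes_1 unfolding controls_def by blast
    then show "coord (proj e) k = coord e k" for k by (simp add: proj_def)
  qed
qed

section \<open>Steering in every mode\<close>

definition mode :: "nat \<times> nat \<Rightarrow> state" where
  "mode m = of_coords (\<lambda>k. if k = m then 1 else 0)"

text \<open>Modes outside the truncation give the zero vector.\<close>

definition odd_unit :: "int \<Rightarrow> int \<Rightarrow> state" where
  "odd_unit i j = of_coords (\<lambda>k. odd_delta i (fst k) * odd_delta j (snd k) / kbar a b k)"

lemma modes_pos: "k \<in> modes j \<Longrightarrow> 1 \<le> fst k \<and> 1 \<le> snd k"
  by (auto simp: modes_def)

lemma odd_delta_minus: "1 \<le> p \<Longrightarrow> odd_delta (- i) p = - odd_delta i p"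
  by (auto simp: odd_delta_def)

lemma odd_unit_odd: "odd_unit (- i) j = - odd_unit i j" "odd_unit i (- j) = - odd_unit i j"
  using modes_pos by (auto intro!: coord_eqI simp: odd_unit_def odd_delta_minus)

text \<open>The factor 1 / kbar is the one absorbed in \<open>Bcoef_sym\<close>; with it,
  interactions of the vectors \<open>odd_unit\<close> have integer coefficients.\<close>

lemma odd_unit_eq_mode:
  assumes "m \<in> modes N"
  shows "odd_unit (int (fst m)) (int (snd m)) = (1 / kbar a b m) *\<^sub>R mode m"
proof (rule coord_eqI)
  fix k
  show "coord (odd_unit (int (fst m)) (int (snd m))) k = coord ((1 / kbar a b m) *\<^sub>R mode m) k"
    using modes_pos[OF assms] by (cases k; cases m) (auto simp: odd_unit_def mode_def odd_delta_def)
qed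

lemma mode_eq_odd_unit:
  assumes "m \<in> modes N"
  shows "mode m = kbar a b m *\<^sub>R odd_unit (int (fst m)) (int (snd m))"
  using kbar_neg[of m] modes_pos[OF assms] by (simp add: odd_unit_eq_mode[OF assms])

lemma Qc_mode:
  assumes "m \<in> modes N" "n \<in> modes N"
  shows "Qc (mode m) (mode n) = of_coords (\<lambda>k. Bcoef m n k)"
proof -
  have "(\<Sum>p\<in>modes N. \<Sum>q\<in>modes N. coord (mode m) p * coord (mode n) q * Bcoef p q k) = Bcoef m n k" for k
  proof -
    have "(\<Sum>p\<in>modes N. \<Sum>q\<in>modes N. coord (mode m) p * coord (mode n) q * Bcoef p q k)
       = (\<Sum>p\<in>modes N. \<Sum>q\<in>modes N. if p = m then if q = n then Bcoef p q k else 0 else 0)"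
      by (intro sum.cong refl) (simp add: mode_def)
    also have "\<dots> = (\<Sum>p\<in>modes N. if p = m then \<Sum>q\<in>modes N. if q = n then Bcoef p q k else 0 else 0)"
      by (intro sum.cong refl) auto
    also have "\<dots> = Bcoef m n k" using assms finite_modes by simp
    finally show ?thesis .
  qed
  then show ?thesis by (simp add: Qc_def)
qed

lemma Qc_mode_sym:
  assumes "m \<in> modes N" "n \<in> modes N"
  shows "Qc (mode m) (mode n) + Qc (mode n) (mode m)
     = ((kbar a b m - kbar a b n) * pi\<^sup>2 / (4 * a * b)) *\<^sub>R interaction odd_unit m n"
proof (rule coord_eqI)
  fix k
  show "coord (Qc (mode m) (mode n) + Qc (mode n) (mode m)) k
     = coord (((kbar a b m - kbar a b n) * pi\<^sup>2 / (4 * a * b)) *\<^sub>R interaction odd_unit m n) k"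
  proof (cases "k \<in> modes N")
    case True
    have "coord (interaction odd_unit m n) k = interaction (\<lambda>i j. odd_delta i (fst k) * odd_delta j (snd k) / kbar a b k) m n"
      using True by (simp add: interaction_def odd_unit_def)
    then show ?thesis using True Bcoef_sym[of k m n] modes_pos[OF True] by (simp add: Qc_mode assms)
  next
    case False
    then show ?thesis by (simp add: Qc_mode assms interaction_def odd_unit_def)
  qed
qed

text \<open>The eigenvalue difference is zero for n = m. This gives the stationarity of single modes
  demanded by \<open>impulsive_bracket\<close>.\<close>

lemma Qc_mode_self: "m \<in> modes N \<Longrightarrow> Qc (mode m) (mode m) = 0"
  using Qc_mode_sym[of m m] by (simp flip: scaleR_2)

text \<open>Saturation is applied to the subspace of impulsive directions. Its closure under
  \<open>interaction\<close> is \<open>impulsive_bracket\<close> followed by division by a scalar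
  that is nonzero because the values of \<open>kbar\<close> differ.\<close>

lemma impulsive_mode:
  assumes "k \<in> modes N"
  shows "impulsive (\<lambda>s::real. s *\<^sub>R mode k)"
proof -
  define G where "G = {g. impulsive (\<lambda>s::real. s *\<^sub>R g)}"
  have G: "subspace G" unfolding G_def by (rule subspace_impulsive)
  have mode_iff: "mode m \<in> G \<longleftrightarrow> odd_unit (int (fst m)) (int (snd m)) \<in> G" if "m \<in> modes N" for m
    using subspace_scale[OF G] mode_eq_odd_unit[OF that] odd_unit_eq_mode[OF that] by metis
  have "odd_unit (int (fst k)) (int (snd k)) \<in> G"
  proof (rule saturation[where E = odd_unit, OF G odd_unit_odd _ _ N order_refl assms])
    fix m assume m: "m \<in> modes 1"
    have "mode m \<in> controls" using m by (auto simp: controls_def mode_def)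
    then have "mode m \<in> G" unfolding G_def using impulsive_control by simp
    then show "odd_unit (int (fst m)) (int (snd m)) \<in> G" using mode_iff m modes_1 by blast
  next
    fix m n
    assume mn: "m \<in> modes N" "n \<in> modes N" and d: "odd_unit (int (fst m)) (int (snd m)) \<in> G" "odd_unit (int (fst n)) (int (snd n)) \<in> G"
      and ne: "kbar a b m \<noteq> kbar a b n"
    have "mode m \<in> G" "mode n \<in> G" using d mode_iff mn by auto
    then have "Qc (mode m) (mode n) + Qc (mode n) (mode m) \<in> G"
      unfolding G_def mem_Collect_eq by (rule impulsive_bracket) (use mn Qc_mode_self in auto)
    then have "((kbar a b m - kbar a b n) * pi\<^sup>2 / (4 * a * b)) *\<^sub>R interaction odd_unit m n + 0 \<in> G"
      using Qc_mode_sym[OF mn] by simp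
    then show "interaction odd_unit m n \<in> G"
      by (rule subspace_cancel[OF G _ subspace_0[OF G]]) (use ne a b in auto)
  qed
  then show ?thesis using mode_iff[OF assms] by (simp add: G_def)
qed

text \<open>The parameter is now the translation vector itself, the form in which
  \<open>exact_small_time\<close> looks for a fixed point.\<close>

lemma impulsive_proj: "impulsive proj"
proof -
  have "impulsive (\<lambda>x. \<Sum>k\<in>modes N. coord x k *\<^sub>R mode k)"
    by (rule impulsive_sum[OF finite_modes bounded_linear_coord impulsive_mode])
  moreover have "(\<Sum>k\<in>modes N. coord x k *\<^sub>R mode k) = proj x" for x
  proof (rule coord_eqI)
    fix l
    have "coord (\<Sum>k\<in>modes N. coord x k *\<^sub>R mode k) l = (\<Sum>k\<in>modes N. coord (coord x k *\<^sub>R mode k) l)"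
      by (rule linear_sum[OF bounded_linear.linear[OF bounded_linear_coord]])
    also have "\<dots> = (\<Sum>k\<in>modes N. if k = l then coord x l else 0)"
      by (intro sum.cong refl) (auto simp: mode_def)
    also have "\<dots> = coord (proj x) l" using finite_modes by (simp add: proj_def)
    finally show "coord (\<Sum>k\<in>modes N. coord x k *\<^sub>R mode k) l = coord (proj x) l" .
  qed
  ultimately show ?thesis by simp
qed

lemma controllable:
  assumes t: "0 < t"
  shows "galerkin_controllable a b \<nu> F N (modes 1) t"
  unfolding galerkin_controllable_def
proof (intro allI)
  fix y z :: "nat \<times> nat \<Rightarrow> real"
  have "reach t (of_coords y) (of_coords z)"
    by (rule exact_controllability[OF impulsive_proj t]) (rule proj_of_coords)+
  from reach_realize[OF this] obtain v x where v: "\<And>r. v r \<in> controls" "v \<in> borel_measurable borel" "bounded (range v)"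
    and x: "x 0 = of_coords y" "x t = of_coords z"
      "\<And>s. s \<in> {0..t} \<Longrightarrow> ((\<lambda>q. field (x q) + v q) has_integral (x s - of_coords y)) {0..s}"
    by blast
  define v' where "v' = (\<lambda>s k. coord (v s) k)"
  define u where "u = (\<lambda>s k. coord (x s) k)"
  have "Linfty_control (modes 1) t v'"
    unfolding Linfty_control_def
  proof (intro ballI conjI)
    fix k
    have "(\<lambda>s. coord (v s) k) \<in> borel_measurable borel"
      using measurable_compose[OF v(2) borel_measurable_continuous_onI[OF linear_continuous_on[OF bounded_linear_coord]]]
      by simp
    then show "(\<lambda>s. v' s k) \<in> borel_measurable (lebesgue_on {0..t})"
      unfolding v'_def by (intro measurable_restrict_space1 measurable_completion) simp
    obtain M where "\<And>s. norm (v s) \<le> M" using v(3) by (auto simp: bounded_iff)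
    then have "\<bar>v' s k\<bar> \<le> M" for s unfolding v'_def using norm_coord_le order_trans by blast
    then show "\<exists>M. AE s in lebesgue_on {0..t}. \<bar>v' s k\<bar> \<le> M" by blast
  qed
  moreover have sol: "galerkin_solution a b \<nu> F N (modes 1) t v' y u"
    unfolding galerkin_solution_def
  proof (intro ballI conjI)
    fix k assume k: "k \<in> modes N"
    show u0: "u 0 k = y k" using k by (simp add: u_def x)
    fix s assume s: "s \<in> {0..t}"
    have "((\<lambda>q. coord (field (x q) + v q) k) has_integral coord (x s - of_coords y) k) {0..s}"
      using has_integral_linear[OF x(3)[OF s] bounded_linear_coord[of k]] by (simp add: o_def)
    moreover have "coord (x s - of_coords y) k = u s k - u 0 k" using k u0 by (simp add: u_def)
    moreover have "coord (field (x q) + v q) k = \<B> a b N (u q) k + \<nu> * kbar a b k * u q k + W_coord a b F k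
       + (if k \<in> modes 1 then v' q k else 0)" for q
    proof -
      have "coord (v q) k = 0" if "k \<notin> modes 1"
        using v(1)[of q] that unfolding controls_def by blast
      then show ?thesis using k by (simp add: field_apply u_def v'_def)
    qed
    ultimately show "((\<lambda>r. \<B> a b N (u r) k + \<nu> * kbar a b k * u r k + W_coord a b F k
       + (if k \<in> modes 1 then v' r k else 0)) has_integral (u s k - u 0 k)) {0..s}" by simp
  qed
  \<comment> \<open>The constructed trajectory ends at \<open>z\<close>, and uniqueness carries this
    over to any other solution for the same control.\<close>
  moreover have "w t k = z k" if "galerkin_solution a b \<nu> F N (modes 1) t v' y w" "k \<in> modes N" for w k
    using galerkin_solution_unique[OF that(1) sol, of t k] that(2) t by (simp add: u_def x)
  ultimately show "\<exists>v. Linfty_control (modes 1) t v \<and> (\<exists>u. galerkin_solution a b \<nu> F N (modes 1) t v y u) \<and>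
      (\<forall>u. galerkin_solution a b \<nu> F N (modes 1) t v y u \<longrightarrow> (\<forall>k\<in>modes N. u t k = z k))" by blast
qed

end

theorem mainTheorem9:
  fixes a b \<nu> t :: real
    and F :: "real \<times> real \<Rightarrow> real \<times> real"
    and N :: nat
  assumes "a > 0" and "b > 0"
    and "\<nu> > 0"
    and "F \<in> H_space a b"
    and "N \<ge> 1"
    and "t > 0"
  shows "galerkin_controllable a b \<nu> F N (modes 1) t"
proof -
  interpret galerkin a b \<nu> F N
    by unfold_locales (use assms in auto)
  show ?thesis by (rule controllable) (rule assms)
qed

end
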